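(* Let $n\ge2$, $1<p<\infty$, $F$ as in the context, $\Omega\subset\mathbb R^n$ a bounded open set with $C^{1,\alpha}$ boundary ($\alpha\in\,]0,1[$), and $\beta\in L^1(\partial\Omega)$, $\beta\ge0$, with $\int_{\partial\Omega}\beta F(\nu)\,d\mathcal H^{n-1}>0$. Let $\tilde u\in C^{1,\alpha}(\Omega)\cap L^\infty(\Omega)$ be a positive minimizer of the variational problem defining $\ell_1(\beta,\Omega)$ with $\|\tilde u\|_\infty=1$. Let $\varphi\ge0$ be a function in $L^{p'}(\Omega)$, $p'=\frac{p}{p-1}$, with $\varphi\not\equiv[F(\nabla\tilde u)]^{p-1}/\tilde u^{p-1}$. Then there exists a set $S\subset\,]0,1[$ of positive measure such that for every $t\in S$, $$\ell_1(\beta,\Omega)>\mathcal F_\Omega(U_t,\varphi),$$ where $\mathcal F_\Omega(U_t,\varphi)=\frac{1}{|U_t|}\Big(-(p-1)\int_{U_t}\varphi^{p'}dx+\int_{S_t}\varphi F(\nu)\,d\mathcal H^{n-1}+\int_{\Gamma_t}\beta F(\nu)\,d\mathcal H^{n-1}\Big)$.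
   Context: $F:\mathbb R^n\to[0,\infty)$ is convex, even, $F(t\xi)=|t|F(\xi)$, $a|\xi|\le F(\xi)\le b|\xi|$ ($0<a\le b$), $F\in C^2(\mathbb R^n\setminus\{0\})$, Hessian of $F^p$ positive definite off the origin. $\nu$ denotes the Euclidean unit normal (outer normal on $\partial\Omega$; unit normal to the level set on $S_t$, orientation irrelevant since $F$ is even). $\ell_1(\beta,\Omega)=\inf_{v\in W^{1,p}(\Omega),v\not\equiv0}\frac{\int_\Omega F^p(\nabla v)dx+\int_{\partial\Omega}\beta|v|^pF(\nu)d\mathcal H^{n-1}}{\int_\Omega|v|^pdx}$ is the first Robin eigenvalue of $\mathcal Q_pu=\operatorname{div}(F^{p-1}(\nabla u)F_\xi(\nabla u))$. For $t\in[0,1]$: $U_t=\{x\in\Omega:\tilde u>t\}$, $S_t=\{x\in\Omega:\tilde u=t\}$, $\Gamma_t=\{x\in\partial\Omega:\tilde u>t\}$. *)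

theory Defs
  imports "HOL-Analysis.Analysis"
begin

definition hausdorff_pre :: "real \<Rightarrow> real \<Rightarrow> 'a::euclidean_space set \<Rightarrow> ennreal" where
  "hausdorff_pre s \<delta> A =
     (INF C \<in> {C :: nat \<Rightarrow> 'a set. A \<subseteq> (\<Union>i. C i) \<and> (\<forall>i. bounded (C i) \<and> diameter (C i) \<le> \<delta>)}.
        (\<Sum>i. ennreal (unit_ball_vol s * (diameter (C i) / 2) powr s)))"

definition hausdorff_outer :: "real \<Rightarrow> 'a::euclidean_space set \<Rightarrow> ennreal" where
  "hausdorff_outer s A = (SUP \<delta> \<in> {0<..}. hausdorff_pre s \<delta> A)"

definition hausdorff_measure :: "real \<Rightarrow> 'a::euclidean_space measure" where
  "hausdorff_measure s = completion (measure_of UNIV (sets borel) (hausdorff_outer s))"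

abbreviation Hn1 :: "'a::euclidean_space measure" where
  "Hn1 \<equiv> hausdorff_measure (real (DIM('a) - 1))"

definition grad :: "('a::euclidean_space \<Rightarrow> real) \<Rightarrow> 'a \<Rightarrow> 'a" where
  "grad f x = (SOME g. (f has_derivative (\<lambda>h. g \<bullet> h)) (at x))"

definition C2_on :: "'a::euclidean_space set \<Rightarrow> ('a \<Rightarrow> real) \<Rightarrow> bool" where
  "C2_on S f \<longleftrightarrow> (\<exists>G H. (\<forall>x\<in>S. (f has_derivative (\<lambda>h. G x \<bullet> h)) (at x)
                                  \<and> (G has_derivative H x) (at x))
                 \<and> (\<forall>i\<in>Basis. \<forall>j\<in>Basis. continuous_on S (\<lambda>x. H x i \<bullet> j)))"

definition hessian_pos_def_on :: "'a::euclidean_space set \<Rightarrow> ('a \<Rightarrow> real) \<Rightarrow> bool" where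
  "hessian_pos_def_on S f \<longleftrightarrow> (\<exists>G H. \<forall>x\<in>S. (f has_derivative (\<lambda>h. G x \<bullet> h)) (at x)
                                  \<and> (G has_derivative H x) (at x)
                                  \<and> (\<forall>v. v \<noteq> 0 \<longrightarrow> v \<bullet> H x v > 0))"

definition C1alpha_on :: "real \<Rightarrow> 'a::euclidean_space set \<Rightarrow> ('a \<Rightarrow> real) \<Rightarrow> bool" where
  "C1alpha_on \<alpha> \<Omega> u \<longleftrightarrow> (\<exists>G. (\<forall>x\<in>\<Omega>. (u has_derivative (\<lambda>h. G x \<bullet> h)) (at x))
      \<and> continuous_on \<Omega> G
      \<and> (\<forall>K. compact K \<and> K \<subseteq> \<Omega> \<longrightarrow> (\<exists>C. \<forall>x\<in>K. \<forall>y\<in>K. norm (G x - G y) \<le> C * dist x y powr \<alpha>)))"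

fun Ck :: "nat \<Rightarrow> ('a::euclidean_space \<Rightarrow> real) set" where
  "Ck 0 = {f. continuous_on UNIV f}"
| "Ck (Suc k) = {f. (\<forall>x. f differentiable (at x)) \<and>
                    (\<forall>i\<in>Basis. (\<lambda>x. frechet_derivative f (at x) i) \<in> Ck k)}"

definition test_fun :: "'a::euclidean_space set \<Rightarrow> ('a \<Rightarrow> real) \<Rightarrow> bool" where
  "test_fun \<Omega> \<psi> \<longleftrightarrow> (\<forall>k. \<psi> \<in> Ck k) \<and> compact (closure {x. \<psi> x \<noteq> 0})
                     \<and> closure {x. \<psi> x \<noteq> 0} \<subseteq> \<Omega>"

definition local_defining_fun ::
  "real \<Rightarrow> 'a::euclidean_space set \<Rightarrow> 'a \<Rightarrow> real \<Rightarrow> ('a \<Rightarrow> real) \<Rightarrow> ('a \<Rightarrow> 'a) \<Rightarrow> bool" where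
  "local_defining_fun \<alpha> \<Omega> x0 r \<rho> G \<longleftrightarrow> 0 < r
     \<and> (\<forall>x\<in>ball x0 r. (\<rho> has_derivative (\<lambda>h. G x \<bullet> h)) (at x) \<and> G x \<noteq> 0)
     \<and> (\<exists>C. \<forall>x\<in>ball x0 r. \<forall>y\<in>ball x0 r. norm (G x - G y) \<le> C * dist x y powr \<alpha>)
     \<and> \<Omega> \<inter> ball x0 r = {x\<in>ball x0 r. \<rho> x < 0}
     \<and> frontier \<Omega> \<inter> ball x0 r = {x\<in>ball x0 r. \<rho> x = 0}"

definition C1alpha_boundary :: "real \<Rightarrow> 'a::euclidean_space set \<Rightarrow> bool" where
  "C1alpha_boundary \<alpha> \<Omega> \<longleftrightarrow> (\<forall>x0\<in>frontier \<Omega>. \<exists>r \<rho> G. local_defining_fun \<alpha> \<Omega> x0 r \<rho> G)"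

definition outer_normal :: "'a::euclidean_space set \<Rightarrow> 'a \<Rightarrow> 'a" where
  "outer_normal \<Omega> x = (SOME \<nu>. \<exists>\<alpha> r \<rho> G. 0 < \<alpha> \<and> local_defining_fun \<alpha> \<Omega> x r \<rho> G
                                      \<and> \<nu> = (1 / norm (G x)) *\<^sub>R G x)"

definition anisotropic :: "real \<Rightarrow> real \<Rightarrow> real \<Rightarrow> ('a::euclidean_space \<Rightarrow> real) \<Rightarrow> bool" where
  "anisotropic p a b F \<longleftrightarrow> convex_on UNIV F \<and> (\<forall>\<xi>. F \<xi> \<ge> 0) \<and> (\<forall>\<xi>. F (- \<xi>) = F \<xi>)
     \<and> (\<forall>t \<xi>. F (t *\<^sub>R \<xi>) = \<bar>t\<bar> * F \<xi>)
     \<and> 0 < a \<and> a \<le> b \<and> (\<forall>\<xi>. a * norm \<xi> \<le> F \<xi> \<and> F \<xi> \<le> b * norm \<xi>)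
     \<and> C2_on (- {0}) F \<and> hessian_pos_def_on (- {0}) (\<lambda>\<xi>. F \<xi> powr p)"

definition Lp :: "real \<Rightarrow> 'a::euclidean_space set \<Rightarrow> ('a \<Rightarrow> real) \<Rightarrow> bool" where
  "Lp q \<Omega> f \<longleftrightarrow> set_borel_measurable lebesgue \<Omega> f \<and> set_integrable lebesgue \<Omega> (\<lambda>x. \<bar>f x\<bar> powr q)"

definition weak_grad :: "'a::euclidean_space set \<Rightarrow> ('a \<Rightarrow> real) \<Rightarrow> ('a \<Rightarrow> 'a) \<Rightarrow> bool" where
  "weak_grad \<Omega> v Dv \<longleftrightarrow> (\<forall>\<psi> i. test_fun \<Omega> \<psi> \<and> i \<in> Basis \<longrightarrow>
      set_integrable lebesgue \<Omega> (\<lambda>x. v x * frechet_derivative \<psi> (at x) i)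
    \<and> set_integrable lebesgue \<Omega> (\<lambda>x. (Dv x \<bullet> i) * \<psi> x)
    \<and> (LINT x:\<Omega>|lebesgue. v x * frechet_derivative \<psi> (at x) i)
        = - (LINT x:\<Omega>|lebesgue. (Dv x \<bullet> i) * \<psi> x))"

definition sobolev :: "real \<Rightarrow> 'a::euclidean_space set \<Rightarrow> ('a \<Rightarrow> real) \<Rightarrow> ('a \<Rightarrow> 'a) \<Rightarrow> bool" where
  "sobolev p \<Omega> v Dv \<longleftrightarrow> Lp p \<Omega> v \<and> set_borel_measurable lebesgue \<Omega> Dv
     \<and> set_integrable lebesgue \<Omega> (\<lambda>x. norm (Dv x) powr p) \<and> weak_grad \<Omega> v Dv"

definition is_trace :: "real \<Rightarrow> 'a::euclidean_space set \<Rightarrow> ('a \<Rightarrow> real) \<Rightarrow> ('a \<Rightarrow> 'a) \<Rightarrow> ('a \<Rightarrow> real) \<Rightarrow> bool" where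
  "is_trace p \<Omega> v Dv g \<longleftrightarrow> set_borel_measurable Hn1 (frontier \<Omega>) g \<and>
    (\<exists>w :: nat \<Rightarrow> 'a \<Rightarrow> real. \<exists>Gw :: nat \<Rightarrow> 'a \<Rightarrow> 'a.
       (\<forall>k x. (w k has_derivative (\<lambda>h. Gw k x \<bullet> h)) (at x)) \<and> (\<forall>k. continuous_on UNIV (Gw k))
     \<and> (\<forall>k. set_integrable lebesgue \<Omega> (\<lambda>x. \<bar>w k x - v x\<bar> powr p))
     \<and> (\<forall>k. set_integrable lebesgue \<Omega> (\<lambda>x. norm (Gw k x - Dv x) powr p))
     \<and> (\<forall>k. set_integrable Hn1 (frontier \<Omega>) (\<lambda>x. \<bar>w k x - g x\<bar> powr p))
     \<and> (\<lambda>k. LINT x:\<Omega>|lebesgue. \<bar>w k x - v x\<bar> powr p) \<longlonglongrightarrow> 0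
     \<and> (\<lambda>k. LINT x:\<Omega>|lebesgue. norm (Gw k x - Dv x) powr p) \<longlonglongrightarrow> 0
     \<and> (\<lambda>k. LINT x:frontier \<Omega>|Hn1. \<bar>w k x - g x\<bar> powr p) \<longlonglongrightarrow> 0)"

definition rayleigh ::
  "real \<Rightarrow> ('a::euclidean_space \<Rightarrow> real) \<Rightarrow> ('a \<Rightarrow> real) \<Rightarrow> 'a set \<Rightarrow> ('a \<Rightarrow> real) \<Rightarrow> ('a \<Rightarrow> 'a) \<Rightarrow> ('a \<Rightarrow> real) \<Rightarrow> real" where
  "rayleigh p F \<beta> \<Omega> v Dv g =
     ((LINT x:\<Omega>|lebesgue. F (Dv x) powr p)
      + (LINT x:frontier \<Omega>|Hn1. \<beta> x * \<bar>g x\<bar> powr p * F (outer_normal \<Omega> x)))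
     / (LINT x:\<Omega>|lebesgue. \<bar>v x\<bar> powr p)"

text \<open>Admissible competitors (those with infinite Rayleigh quotient are irrelevant for the infimum).\<close>
definition admissible ::
  "real \<Rightarrow> ('a::euclidean_space \<Rightarrow> real) \<Rightarrow> ('a \<Rightarrow> real) \<Rightarrow> 'a set \<Rightarrow> ('a \<Rightarrow> real) \<Rightarrow> ('a \<Rightarrow> 'a) \<Rightarrow> ('a \<Rightarrow> real) \<Rightarrow> bool" where
  "admissible p F \<beta> \<Omega> v Dv g \<longleftrightarrow> sobolev p \<Omega> v Dv \<and> is_trace p \<Omega> v Dv g
     \<and> set_integrable Hn1 (frontier \<Omega>) (\<lambda>x. \<beta> x * \<bar>g x\<bar> powr p * F (outer_normal \<Omega> x))
     \<and> \<not> (AE x in lebesgue. x \<in> \<Omega> \<longrightarrow> v x = 0)"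

definition ell1 :: "real \<Rightarrow> ('a::euclidean_space \<Rightarrow> real) \<Rightarrow> ('a \<Rightarrow> real) \<Rightarrow> 'a set \<Rightarrow> real" where
  "ell1 p F \<beta> \<Omega> = Inf {rayleigh p F \<beta> \<Omega> v Dv g | v Dv g. admissible p F \<beta> \<Omega> v Dv g}"

text \<open>u: the eigenfunction in Omega; g: its boundary values (trace); U_t, S_t, Gamma_t as in the paper.
  The unit normal on S_t is grad u / |grad u|.\<close>
definition level_functional ::
  "real \<Rightarrow> ('a::euclidean_space \<Rightarrow> real) \<Rightarrow> ('a \<Rightarrow> real) \<Rightarrow> 'a set \<Rightarrow> ('a \<Rightarrow> real) \<Rightarrow> ('a \<Rightarrow> real)
   \<Rightarrow> ('a \<Rightarrow> real) \<Rightarrow> real \<Rightarrow> real" where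
  "level_functional p F \<beta> \<Omega> u g \<phi> t =
     (let U = {x\<in>\<Omega>. u x > t}; S = {x\<in>\<Omega>. u x = t}; \<Gamma> = {x\<in>frontier \<Omega>. g x > t} in
      (1 / measure lebesgue U) *
        (- (p - 1) * (LINT x:U|lebesgue. \<phi> x powr (p / (p - 1)))
         + (LINT x:S|Hn1. \<phi> x * F ((1 / norm (grad u x)) *\<^sub>R grad u x))
         + (LINT x:\<Gamma>|Hn1. \<beta> x * F (outer_normal \<Omega> x))))"

end

theory Submission
  imports Defs
begin

text \<open>
  Multiply the claimed inequality by \<open>|U\<^sub>t|\<close> and integrate it over \<open>t \<in> (0,1)\<close> against the weight \<open>p t\<^sup>p\<^sup>-\<^sup>1\<close>.
  By the layer cake formula and the coarea inequality, the resulting difference of the two sides is at least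
  \<open>\<ell>\<^sub>1 \<integral> u\<^sup>p - \<integral>\<^sub>\<partial>\<^sub>\<Omega> \<beta> u\<^sup>p F(\<nu>) + (p - 1) \<integral> \<phi>\<^sup>p\<^sup>' u\<^sup>p - p \<integral> u\<^sup>p\<^sup>-\<^sup>1 \<phi> F(\<nabla>u)\<close>.
  As the Rayleigh quotient of \<open>u\<close> is \<open>\<ell>\<^sub>1\<close>, the first two terms add up to \<open>\<integral> F(\<nabla>u)\<^sup>p\<close>, and Young's inequality
  makes the sum positive, strictly so because \<open>\<phi>\<close> differs from \<open>F(\<nabla>u)\<^sup>p\<^sup>-\<^sup>1 / u\<^sup>p\<^sup>-\<^sup>1\<close> on a set of positive measure.
  Only the inequality \<open>\<le>\<close> of the coarea formula enters; it holds with the sharp constant because a \<open>C\<^sup>1\<close> function is nearly linear on small balls, which cover a set with arbitrarily small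
  excess volume by Vitali's theorem.
\<close>

section \<open>Upper integrals and slices of balls\<close>

text \<open>The weight \<open>p * t powr (p - 1)\<close> serves twice. It is the density of
  \<open>t powr p\<close>, so volumes of superlevel sets integrate to the p-th power of
  \<open>u\<close>; and on the level \<open>t\<close> it equals \<open>p * u x powr (p - 1)\<close>,
  so the surface term becomes a volume integral of
  \<open>p * F (G x) * (u x powr (p - 1) * \<phi> x)\<close>, the product in Young's inequality.
  Equality there means that \<open>u x powr (p - 1) * \<phi> x\<close> is
  \<open>F (G x) powr (p - 1)\<close>, exactly the excluded choice of \<open>\<phi>\<close>. Three
  obstacles shape the rest. The surface integral is not known to be finite or to depend measurably
  on \<open>t\<close>, so it is only bounded from above, and the good levels are defined through a
  measurable majorant. The Rayleigh quotient contains the weak gradient, whereas normals of level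
  sets come from the classical one, so the two have to be identified almost everywhere. Finally,
  \<open>\<phi>\<close> is only Lebesgue measurable, while surface integrals can see sets of volume
  zero.\<close>

text \<open>The upper integral avoids any measurability question about
  \<open>t \<mapsto> \<H>\<^sup>n\<^sup>-\<^sup>1(A \<inter> {u = t})\<close>.\<close>

definition upper_integral_le :: "(real \<Rightarrow> ennreal) \<Rightarrow> ennreal \<Rightarrow> bool" where
  "upper_integral_le f K \<longleftrightarrow>
     (\<exists>c\<in>borel_measurable lborel. (\<forall>t. f t \<le> c t) \<and> (\<integral>\<^sup>+t. c t \<partial>lborel) \<le> K)"

lemma upper_integral_leI:
  assumes "c \<in> borel_measurable lborel" "\<And>t. f t \<le> c t" "(\<integral>\<^sup>+t. c t \<partial>lborel) \<le> K"
  shows "upper_integral_le f K"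
  using assms unfolding upper_integral_le_def by blast

lemma upper_integral_le_mono:
  assumes "upper_integral_le f K" "\<And>t. g t \<le> f t" "K \<le> L"
  shows "upper_integral_le g L"
  using assms unfolding upper_integral_le_def by (meson order_trans)

lemma upper_integral_le_suminf:
  fixes f :: "nat \<Rightarrow> real \<Rightarrow> ennreal"
  assumes "\<And>i. upper_integral_le (f i) (K i)"
  shows "upper_integral_le (\<lambda>t. \<Sum>i. f i t) (\<Sum>i. K i)"
proof -
  obtain c where c: "\<And>i. c i \<in> borel_measurable lborel" "\<And>i t. f i t \<le> c i t"
      "\<And>i. (\<integral>\<^sup>+t. c i t \<partial>lborel) \<le> K i"
    using assms unfolding upper_integral_le_def by metis
  show ?thesis
  proof (rule upper_integral_leI)
    show "(\<lambda>t. \<Sum>i. c i t) \<in> borel_measurable lborel" using c by measurable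
    show "(\<Sum>i. f i t) \<le> (\<Sum>i. c i t)" for t by (intro suminf_le c) auto
    have "(\<integral>\<^sup>+t. (\<Sum>i. c i t) \<partial>lborel) = (\<Sum>i. \<integral>\<^sup>+t. c i t \<partial>lborel)"
      by (rule nn_integral_suminf) (rule c)
    also have "\<dots> \<le> (\<Sum>i. K i)" by (intro suminf_le c) auto
    finally show "(\<integral>\<^sup>+t. (\<Sum>i. c i t) \<partial>lborel) \<le> (\<Sum>i. K i)" .
  qed
qed

lemma upper_integral_le_add:
  assumes "upper_integral_le f K" "upper_integral_le g L"
  shows "upper_integral_le (\<lambda>t. f t + g t) (K + L)"
proof -
  obtain c d where c: "c \<in> borel_measurable lborel" "\<And>t. f t \<le> c t" "(\<integral>\<^sup>+t. c t \<partial>lborel) \<le> K"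
    and d: "d \<in> borel_measurable lborel" "\<And>t. g t \<le> d t" "(\<integral>\<^sup>+t. d t \<partial>lborel) \<le> L"
    using assms unfolding upper_integral_le_def by metis
  show ?thesis
    by (rule upper_integral_leI[of "\<lambda>t. c t + d t"])
       (use c d in \<open>auto simp: nn_integral_add add_mono\<close>)
qed

lemma upper_integral_le_cmult:
  assumes "upper_integral_le f K"
  shows "upper_integral_le (\<lambda>t. a * f t) (a * K)"
proof -
  obtain c where c: "c \<in> borel_measurable lborel" "\<And>t. f t \<le> c t" "(\<integral>\<^sup>+t. c t \<partial>lborel) \<le> K"
    using assms unfolding upper_integral_le_def by metis
  show ?thesis
    by (rule upper_integral_leI[of "\<lambda>t. a * c t"])
       (use c in \<open>auto simp: nn_integral_cmult mult_left_mono\<close>)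
qed

text \<open>Fatou's lemma for the measurable majorants. Every limit of the coarea argument passes
  through it: the scale of the covers, the linearization error, and increasing sequences of
  integrands.\<close>

lemma upper_integral_le_liminf:
  fixes f :: "nat \<Rightarrow> real \<Rightarrow> ennreal"
  assumes "\<And>i. upper_integral_le (f i) (K i)"
    and "\<And>t. g t \<le> liminf (\<lambda>i. f i t)" "liminf K \<le> L"
  shows "upper_integral_le g L"
proof -
  obtain c where c: "\<And>i. c i \<in> borel_measurable lborel" "\<And>i t. f i t \<le> c i t"
      "\<And>i. (\<integral>\<^sup>+t. c i t \<partial>lborel) \<le> K i"
    using assms unfolding upper_integral_le_def by metis
  show ?thesis
  proof (rule upper_integral_leI)
    show "(\<lambda>t. liminf (\<lambda>i. c i t)) \<in> borel_measurable lborel" using c by measurable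
    show "g t \<le> liminf (\<lambda>i. c i t)" for t
      by (rule order_trans[OF assms(2)]) (intro Liminf_mono always_eventually allI c)
    have "(\<integral>\<^sup>+t. liminf (\<lambda>i. c i t) \<partial>lborel) \<le> liminf (\<lambda>i. \<integral>\<^sup>+t. c i t \<partial>lborel)"
      by (rule nn_integral_liminf) (rule c)
    also have "\<dots> \<le> liminf K" by (intro Liminf_mono always_eventually allI c)
    finally show "(\<integral>\<^sup>+t. liminf (\<lambda>i. c i t) \<partial>lborel) \<le> L" using assms(3) by simp
  qed
qed

text \<open>The relative area of the slice of a unit ball of dimension \<open>m + 1\<close> at height \<open>x\<close>; below, the profile is
  widened by \<open>\<epsilon>\<close> because the level sets of a nearly linear function leave the hyperplane by that much.\<close>

definition slice_profile :: "nat \<Rightarrow> real \<Rightarrow> ennreal" where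
  "slice_profile m x = ennreal (indicator {-1..1} x * sqrt (1 - x\<^sup>2) ^ m)"

lemma slice_profile_measurable [measurable]: "slice_profile m \<in> borel_measurable borel"
  unfolding slice_profile_def by measurable

text \<open>Cavalieri's principle for the unit ball: the profile integrates to a Beta value, and its
  Gamma factors, with \<open>Gamma (1 / 2)\<close> equal to the square root of pi, raise the
  dimension of the ball volume by one.\<close>

lemma nn_integral_slice_profile:
  "ennreal (unit_ball_vol (real m)) * (\<integral>\<^sup>+x. slice_profile m x \<partial>lborel) = ennreal (unit_ball_vol (real (Suc m)))"
proof -
  have "(\<integral>\<^sup>+x. slice_profile m x \<partial>lborel) = ennreal (Beta (1 / 2) (real m / 2 + 1))"
    unfolding slice_profile_def by (rule emeasure_cball_aux_integral)
  moreover have "unit_ball_vol (real m) * Beta (1 / 2) (real m / 2 + 1) = unit_ball_vol (real (Suc m))"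
  proof -
    have "Gamma (real m / 2 + 1) > 0" by (intro Gamma_real_pos) auto
    then have "Gamma (real m / 2 + 1) \<noteq> 0" by linarith
    then have "unit_ball_vol (real m) * Beta (1 / 2) (real m / 2 + 1)
        = pi powr (real m / 2) * Gamma (1/2) / Gamma (1/2 + (real m / 2 + 1))"
      by (simp add: unit_ball_vol_def Beta_def)
    also have "Gamma (1/2 :: real) = pi powr (1/2)"
      by (simp add: Gamma_one_half_real powr_half_sqrt)
    also have "pi powr (real m / 2) * pi powr (1/2) = pi powr (real (Suc m) / 2)"
      by (simp add: powr_add [symmetric] field_simps)
    also have "1/2 + (real m / 2 + 1) = real (Suc m) / 2 + 1" by (simp add: field_simps)
    finally show ?thesis by (simp add: unit_ball_vol_def)
  qed
  ultimately show ?thesis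
    by (simp add: ennreal_mult' [symmetric])
qed

text \<open>For \<epsilon> > 0 this is the profile at the distance from \<open>s\<close> to the
  interval from -\<epsilon> to \<epsilon>. Written in three pieces, each half can be translated back
  on its own, so widening costs only the plateau of length 2\<epsilon>.\<close>

definition wide_profile :: "real \<Rightarrow> nat \<Rightarrow> real \<Rightarrow> ennreal" where
  "wide_profile \<epsilon> m s = indicator {-\<epsilon>..\<epsilon>} s + indicator {\<epsilon><..} s * slice_profile m (s - \<epsilon>)
      + indicator {..<-\<epsilon>} s * slice_profile m (s + \<epsilon>)"

lemma wide_profile_measurable [measurable]: "wide_profile \<epsilon> m \<in> borel_measurable borel"
  unfolding wide_profile_def by measurable

lemma nn_integral_wide_profile:
  assumes "\<epsilon> > 0"
  shows "(\<integral>\<^sup>+x. wide_profile \<epsilon> m x \<partial>lborel) \<le> ennreal (2 * \<epsilon>) + (\<integral>\<^sup>+x. slice_profile m x \<partial>lborel)"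
proof -
  have a: "(\<integral>\<^sup>+x. indicator {\<epsilon><..} x * slice_profile m (x - \<epsilon>) \<partial>lborel)
     = (\<integral>\<^sup>+x. indicator {0<..} x * slice_profile m x \<partial>lborel)"
    by (subst nn_integral_real_affine[of _ 1 "\<epsilon>"]) (auto intro!: nn_integral_cong simp: indicator_def)
  have b: "(\<integral>\<^sup>+x. indicator {..<-\<epsilon>} x * slice_profile m (x + \<epsilon>) \<partial>lborel)
     = (\<integral>\<^sup>+x. indicator {..<0} x * slice_profile m x \<partial>lborel)"
    by (subst nn_integral_real_affine[of _ 1 "-\<epsilon>"]) (auto intro!: nn_integral_cong simp: indicator_def)
  have c: "(\<integral>\<^sup>+x. indicator {-\<epsilon>..\<epsilon>} x \<partial>lborel) = ennreal (2 * \<epsilon>)"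
    using assms by simp
  have "(\<integral>\<^sup>+x. wide_profile \<epsilon> m x \<partial>lborel) = ennreal (2 * \<epsilon>)
     + (\<integral>\<^sup>+x. indicator {0<..} x * slice_profile m x \<partial>lborel)
     + (\<integral>\<^sup>+x. indicator {..<0} x * slice_profile m x \<partial>lborel)"
    unfolding wide_profile_def by (subst nn_integral_add; (subst nn_integral_add)?) (simp_all add: a b c)
  also have "\<dots> = ennreal (2 * \<epsilon>) + (\<integral>\<^sup>+x. indicator {0<..} x * slice_profile m x
     + indicator {..<0} x * slice_profile m x \<partial>lborel)"
    by (subst nn_integral_add) (simp_all add: add.assoc)
  also have "\<dots> \<le> ennreal (2 * \<epsilon>) + (\<integral>\<^sup>+x. slice_profile m x \<partial>lborel)"
    by (intro add_left_mono nn_integral_mono) (auto simp: indicator_def)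
  finally show ?thesis .
qed

lemma wide_profile_ge:
  assumes "max (\<bar>s\<bar> - \<epsilon>) 0 \<le> 1" "0 < \<epsilon>"
  shows "ennreal (sqrt (1 - (max (\<bar>s\<bar> - \<epsilon>) 0)\<^sup>2) ^ m) \<le> wide_profile \<epsilon> m s"
proof -
  consider "\<bar>s\<bar> \<le> \<epsilon>" | "s > \<epsilon>" | "s < -\<epsilon>" by linarith
  then show ?thesis
  proof cases
    case 1 then show ?thesis by (auto simp: wide_profile_def indicator_def max_def)
  next
    case 2
    then have "max (\<bar>s\<bar> - \<epsilon>) 0 = s - \<epsilon>" using assms by auto
    with 2 show ?thesis using assms by (auto simp: wide_profile_def slice_profile_def indicator_def)
  next
    case 3
    then have "max (\<bar>s\<bar> - \<epsilon>) 0 = -(s + \<epsilon>)" using assms by auto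
    then have "(max (\<bar>s\<bar> - \<epsilon>) 0)\<^sup>2 = (s + \<epsilon>)\<^sup>2" "-(s + \<epsilon>) \<le> 1"
      using assms(1) by (simp_all only: power2_minus)
    with 3 show ?thesis using assms(2)
      by (auto simp: wide_profile_def slice_profile_def indicator_def)
  qed
qed

text \<open>The loss factor of the slice estimate. The numerator is the relative cost of the plateau
  of the widened profile; the denominator accounts for radii enlarged by
  \<open>1 / sqrt (1 - \<epsilon>\<^sup>2)\<close> in dimension \<open>n - 1\<close>. It tends to 1
  as \<epsilon> tends to 0.\<close>

definition slice_dist :: "real \<Rightarrow> nat \<Rightarrow> real" where
  "slice_dist \<epsilon> n = (1 + 2 * \<epsilon> * unit_ball_vol (real (n - 1)) / unit_ball_vol (real n))
                      / sqrt (1 - \<epsilon>\<^sup>2) ^ (n - 1)"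

text \<open>Split along the unit vector \<open>e\<close> of \<open>v\<close>; \<open>P\<close> is
  the orthogonal projection off \<open>e\<close>. Points at level \<open>t\<close> have height at
  least \<open>w * r\<close> above or below the centre, so by Pythagoras their projections lie in a
  ball of radius \<open>r * sqrt (1 - w\<^sup>2)\<close>. Two points of equal level differ along
  \<open>e\<close> by at most \<epsilon> times their distance, so their distance exceeds that of the
  projections by at most the factor \<open>1 / sqrt (1 - \<epsilon>\<^sup>2)\<close>.\<close>

lemma ball_slice_diameter:
  fixes u :: "'a::euclidean_space \<Rightarrow> real" and v :: 'a
  assumes v: "v \<noteq> 0" and \<epsilon>: "0 < \<epsilon>" "\<epsilon> < 1" and r: "r > 0"
    and lin: "\<And>x y. x \<in> cball c r \<Longrightarrow> y \<in> cball c r \<Longrightarrow> \<bar>u y - u x - v \<bullet> (y - x)\<bar> \<le> \<epsilon> * norm v * norm (y - x)"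
    and ne: "{x \<in> cball c r. u x = t} \<noteq> {}"
  defines "w \<equiv> max (\<bar>(t - u c) / (norm v * r)\<bar> - \<epsilon>) 0"
  shows "w \<le> 1" "diameter {x \<in> cball c r. u x = t} / 2 \<le> r / sqrt (1 - \<epsilon>\<^sup>2) * sqrt (1 - w\<^sup>2)"
proof -
  define e where "e = v /\<^sub>R norm v"
  have ve: "v = norm v *\<^sub>R e" and ne1: "norm e = 1" using v by (auto simp: e_def)
  have nv: "norm v > 0" using v by simp
  have ee: "e \<bullet> e = 1" using ne1 by (simp add: dot_square_norm)
  have lin': "\<bar>(u y - u x) / norm v - e \<bullet> (y - x)\<bar> \<le> \<epsilon> * norm (y - x)"
    if "x \<in> cball c r" "y \<in> cball c r" for x y
  proof -
    have "(u y - u x) / norm v - e \<bullet> (y - x) = (u y - u x - v \<bullet> (y - x)) / norm v"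
      using nv by (subst (2) ve) (simp add: field_simps)
    then have "\<bar>(u y - u x) / norm v - e \<bullet> (y - x)\<bar> = \<bar>u y - u x - v \<bullet> (y - x)\<bar> / norm v"
      by simp
    also have "\<dots> \<le> \<epsilon> * norm v * norm (y - x) / norm v"
      using lin[OF that] nv by (intro divide_right_mono) auto
    finally show ?thesis using nv by simp
  qed
  define P where "P = (\<lambda>x. x - (e \<bullet> x) *\<^sub>R e)"
  have P: "(norm x)\<^sup>2 = (norm (P x))\<^sup>2 + (e \<bullet> x)\<^sup>2" for x
    unfolding P_def power2_norm_eq_inner
    by (simp add: inner_diff_left inner_diff_right inner_commute ee power2_eq_square algebra_simps)
  have Pd: "P (x - y) = P x - P y" for x y by (simp add: P_def algebra_simps inner_diff_right)
  have w0: "0 \<le> w" by (simp add: w_def)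
  have A: "(norm (P (x - c)))\<^sup>2 \<le> r\<^sup>2 * (1 - w\<^sup>2)" if x: "x \<in> cball c r" "u x = t" for x
  proof -
    have nx: "norm (x - c) \<le> r" using x by (simp add: dist_norm norm_minus_commute)
    have cc: "c \<in> cball c r" using r by simp
    have "\<bar>(t - u c) / norm v - e \<bullet> (x - c)\<bar> \<le> \<epsilon> * r"
      using lin'[OF cc x(1), unfolded x(2)] mult_left_mono[OF nx less_imp_le[OF \<epsilon>(1)]] by linarith
    then have "\<bar>e \<bullet> (x - c)\<bar> \<ge> \<bar>(t - u c) / norm v\<bar> - \<epsilon> * r" by linarith
    also have "\<bar>(t - u c) / norm v\<bar> - \<epsilon> * r = (\<bar>(t - u c) / (norm v * r)\<bar> - \<epsilon>) * r"
      using r nv by (simp add: abs_mult field_simps)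
    finally have "w * r \<le> \<bar>e \<bullet> (x - c)\<bar>" unfolding w_def by (auto simp: max_def)
    then have "(w * r)\<^sup>2 \<le> (e \<bullet> (x - c))\<^sup>2" 
      using w0 r by (metis abs_ge_zero mult_nonneg_nonneg power2_abs power_mono less_imp_le)
    moreover have "(norm (x - c))\<^sup>2 \<le> r\<^sup>2" using nx by (intro power_mono) auto
    ultimately show ?thesis using P[of "x - c"] by (simp add: power_mult_distrib algebra_simps)
  qed
  obtain z where z: "z \<in> cball c r" "u z = t" using ne by blast
  have "0 \<le> r\<^sup>2 * (1 - w\<^sup>2)" using A[OF z] by (meson zero_le_power2 order_trans)
  then have w1: "w\<^sup>2 \<le> 1" using r by (auto simp: zero_le_mult_iff)
  then show "w \<le> 1" using w0 by (simp add: abs_square_le_1)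
  have e2: "1 - \<epsilon>\<^sup>2 > 0" using \<epsilon> by (simp add: abs_square_less_1)
  define d where "d = r / sqrt (1 - \<epsilon>\<^sup>2) * sqrt (1 - w\<^sup>2)"
  have d0: "d \<ge> 0" unfolding d_def using r e2 w1 by auto
  have D: "norm (y - x) \<le> 2 * d" if x: "x \<in> cball c r" "u x = t" and y: "y \<in> cball c r" "u y = t" for x y
  proof -
    have B: "norm (P (z - c)) \<le> r * sqrt (1 - w\<^sup>2)" if "z \<in> cball c r" "u z = t" for z
    proof (rule power2_le_imp_le)
      show "(norm (P (z - c)))\<^sup>2 \<le> (r * sqrt (1 - w\<^sup>2))\<^sup>2"
        using A[OF that] w1 by (simp add: power_mult_distrib)
    qed (use r w1 in simp)
    note B[OF x] B[OF y]
    moreover have "P (y - x) = P (y - c) - P (x - c)" by (simp add: Pd [symmetric])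
    ultimately have "norm (P (y - x)) \<le> 2 * (r * sqrt (1 - w\<^sup>2))"
      using norm_triangle_ineq4[of "P (y - c)" "P (x - c)"] by simp
    then have "(norm (P (y - x)))\<^sup>2 \<le> 4 * (r\<^sup>2 * (1 - w\<^sup>2))"
      using power_mono[of "norm (P (y - x))" _ 2] w1 by (fastforce simp: power_mult_distrib)
    moreover have "\<bar>e \<bullet> (y - x)\<bar> \<le> \<epsilon> * norm (y - x)" using lin'[OF x(1) y(1)] x y by simp
    then have "(e \<bullet> (y - x))\<^sup>2 \<le> \<epsilon>\<^sup>2 * (norm (y - x))\<^sup>2"
      using power_mono[of "\<bar>e \<bullet> (y - x)\<bar>" "\<epsilon> * norm (y - x)" 2] by (simp add: power_mult_distrib)
    ultimately have "(norm (y - x))\<^sup>2 * (1 - \<epsilon>\<^sup>2) \<le> 4 * (r\<^sup>2 * (1 - w\<^sup>2))"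
      using P[of "y - x"] by (simp add: algebra_simps)
    then have "(norm (y - x))\<^sup>2 \<le> (2 * d)\<^sup>2"
    proof -
      have "(2 * d)\<^sup>2 = 4 * (r\<^sup>2 * (1 - w\<^sup>2)) / (1 - \<epsilon>\<^sup>2)"
        using e2 w1 by (simp add: d_def power_mult_distrib power_divide)
      with \<open>(norm (y - x))\<^sup>2 * (1 - \<epsilon>\<^sup>2) \<le> 4 * (r\<^sup>2 * (1 - w\<^sup>2))\<close> show ?thesis
        by (simp only: pos_le_divide_eq[OF e2])
    qed
    then show ?thesis by (rule power2_le_imp_le) (use d0 in simp)
  qed
  have "diameter {x \<in> cball c r. u x = t} \<le> 2 * d"
  proof (rule diameter_le)
    show "norm (x - y) \<le> 2 * d" if "x \<in> {x \<in> cball c r. u x = t}" "y \<in> {x \<in> cball c r. u x = t}" for x y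
      using D[of y x] that by simp
  qed (use d0 in simp)
  then show "diameter {x \<in> cball c r. u x = t} / 2 \<le> r / sqrt (1 - \<epsilon>\<^sup>2) * sqrt (1 - w\<^sup>2)"
    unfolding d_def [symmetric] by simp
qed

text \<open>Balls are the right test sets: their hyperplane slices are balls again, whose volumes integrate to
  exactly the volume of the ball, so the constant is sharp as \<open>\<epsilon> \<rightarrow> 0\<close>.\<close>

lemma ball_slice_upper_integral:
  fixes u :: "'a::euclidean_space \<Rightarrow> real" and v :: 'a
  assumes n: "DIM('a) \<ge> 2" and v: "v \<noteq> 0" and \<epsilon>: "0 < \<epsilon>" "\<epsilon> < 1" and r: "r > 0"
    and lin: "\<And>x y. x \<in> cball c r \<Longrightarrow> y \<in> cball c r \<Longrightarrow> \<bar>u y - u x - v \<bullet> (y - x)\<bar> \<le> \<epsilon> * norm v * norm (y - x)"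
  shows "upper_integral_le
     (\<lambda>t. ennreal (unit_ball_vol (real (DIM('a) - 1)) * (diameter {x \<in> cball c r. u x = t} / 2) powr real (DIM('a) - 1)))
     (ennreal (slice_dist \<epsilon> DIM('a) * norm v) * emeasure lborel (cball c r))"
proof -
  define m where "m = DIM('a) - 1"
  have m: "m \<ge> 1" "DIM('a) = Suc m" using n by (auto simp: m_def)
  define om where "om = unit_ball_vol (real m)"
  define on where "on = unit_ball_vol (real (Suc m))"
  have om: "om > 0" "on > 0" by (auto simp: om_def on_def)
  have nv: "norm v > 0" using v by simp
  have e2: "1 - \<epsilon>\<^sup>2 > 0" using \<epsilon> by (simp add: abs_square_less_1)
  define k where "k = r / sqrt (1 - \<epsilon>\<^sup>2)"
  have k: "k > 0" using r e2 by (simp add: k_def)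
  \<comment> \<open>The argument is the level rescaled to a unit ball and unit slope;
    \<open>k\<close> is the enlarged radius from \<open>ball_slice_diameter\<close>.\<close>
  define C where "C = (\<lambda>t. ennreal (om * k ^ m) * wide_profile \<epsilon> m ((t - u c) / (norm v * r)))"
  show ?thesis
  proof (rule upper_integral_leI[of C])
    show "C \<in> borel_measurable lborel" unfolding C_def by measurable
    show "ennreal (unit_ball_vol (real (DIM('a) - 1)) * (diameter {x \<in> cball c r. u x = t} / 2) powr real (DIM('a) - 1)) \<le> C t" for t
    proof (cases "{x \<in> cball c r. u x = t} = {}")
      case True
      show ?thesis by (subst True) (use m in simp)
    next
      case False
      define w where "w = max (\<bar>(t - u c) / (norm v * r)\<bar> - \<epsilon>) 0"
      note D = ball_slice_diameter[OF v \<epsilon> r lin False, folded w_def k_def]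
      have w1: "w\<^sup>2 \<le> 1" using D(1) by (simp add: w_def abs_square_le_1)
      have d0: "0 \<le> diameter {x \<in> cball c r. u x = t}"
        by (rule diameter_ge_0) (rule bounded_subset[OF bounded_cball], auto)
      have "(diameter {x \<in> cball c r. u x = t} / 2) powr real m \<le> (k * sqrt (1 - w\<^sup>2)) powr real m"
        using D(2) d0 by (intro powr_mono2) auto
      \<comment> \<open>The base is 0 when \<open>w\<close> is 1, and \<open>0 powr 0\<close> is 0
        whereas \<open>0 ^ 0\<close> is 1; hence the use of \<open>m \<ge> 1\<close>.\<close>
      also have "\<dots> = (k * sqrt (1 - w\<^sup>2)) ^ m"
        using k w1 m by (intro powr_realpow') (auto intro!: mult_nonneg_nonneg)
      finally have "om * (diameter {x \<in> cball c r. u x = t} / 2) powr real m \<le> om * k ^ m * sqrt (1 - w\<^sup>2) ^ m"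
        using om by (simp add: power_mult_distrib mult_left_mono mult.assoc)
      then have "ennreal (om * (diameter {x \<in> cball c r. u x = t} / 2) powr real m) \<le> ennreal (om * k ^ m) * ennreal (sqrt (1 - w\<^sup>2) ^ m)"
        using om k w1 by (subst ennreal_mult [symmetric]) (auto intro!: ennreal_leI)
      also have "\<dots> \<le> C t"
        unfolding C_def w_def using D(1) \<epsilon> by (intro mult_left_mono wide_profile_ge) (auto simp: w_def)
      finally show ?thesis by (simp add: om_def m)
    qed
    have "(\<integral>\<^sup>+t. C t \<partial>lborel) = ennreal (om * k ^ m) * (\<integral>\<^sup>+t. wide_profile \<epsilon> m ((t - u c) / (norm v * r)) \<partial>lborel)"
      unfolding C_def by (rule nn_integral_cmult) measurable
    also have "(\<integral>\<^sup>+t. wide_profile \<epsilon> m ((t - u c) / (norm v * r)) \<partial>lborel) = ennreal (norm v * r) * (\<integral>\<^sup>+s. wide_profile \<epsilon> m s \<partial>lborel)"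
      using nv r by (subst nn_integral_real_affine[of _ "norm v * r" "u c"]) (auto simp: field_simps)
    also have "ennreal (om * k ^ m) * (ennreal (norm v * r) * (\<integral>\<^sup>+s. wide_profile \<epsilon> m s \<partial>lborel))
        \<le> ennreal (om * k ^ m) * (ennreal (norm v * r) * (ennreal (2 * \<epsilon>) + (\<integral>\<^sup>+x. slice_profile m x \<partial>lborel)))"
      using \<epsilon> by (intro mult_left_mono nn_integral_wide_profile) auto
    also have "\<dots> = ennreal (k ^ m * norm v * r) * (ennreal (om * (2 * \<epsilon>)) + ennreal om * (\<integral>\<^sup>+x. slice_profile m x \<partial>lborel))"
      using om k nv r \<epsilon> by (simp add: ennreal_mult distrib_left mult_ac)
    also have "\<dots> = ennreal (k ^ m * norm v * r * (om * (2 * \<epsilon>) + on))"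
      using om k nv r \<epsilon> unfolding om_def nn_integral_slice_profile
      by (fold om_def on_def) (simp add: ennreal_mult [symmetric] ennreal_plus [symmetric] del: ennreal_plus)
    also have "k ^ m * norm v * r * (om * (2 * \<epsilon>) + on) = (slice_dist \<epsilon> DIM('a) * norm v) * (on * r ^ Suc m)"
    proof -
      define X where "X = sqrt (1 - \<epsilon>\<^sup>2) ^ m"
      have X: "slice_dist \<epsilon> DIM('a) = (1 + 2 * \<epsilon> * om / on) / X"
        by (simp add: slice_dist_def m om_def on_def X_def)
      have "X > 0" using e2 by (simp add: X_def)
      then show ?thesis unfolding k_def power_divide X_def [symmetric] X using om by (simp add: field_simps)
    qed
    also have "ennreal \<dots> = ennreal (slice_dist \<epsilon> DIM('a) * norm v) * emeasure lborel (cball c r)"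
      using om r nv by (subst ennreal_mult'') (auto simp: emeasure_cball m on_def)
    finally show "(\<integral>\<^sup>+t. C t \<partial>lborel) \<le> ennreal (slice_dist \<epsilon> DIM('a) * norm v) * emeasure lborel (cball c r)" .
  qed
qed

section \<open>Covering by small balls\<close>

lemma nn_integral_count_space_suminf:
  assumes "countable D"
  shows "(\<integral>\<^sup>+x. f x \<partial>count_space D)
     = (\<Sum>i. if i \<in> to_nat_on D ` D then f (from_nat_into D i) else 0)"
proof -
  have b: "bij_betw (to_nat_on D) D (to_nat_on D ` D)"
    using assms by (simp add: inj_on_to_nat_on inj_on_imp_bij_betw)
  have "(\<integral>\<^sup>+x. f x \<partial>count_space D) = (\<integral>\<^sup>+x. f (from_nat_into D (to_nat_on D x)) \<partial>count_space D)"
    using assms by (intro nn_integral_cong) simp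
  also have "\<dots> = (\<integral>\<^sup>+i. f (from_nat_into D i) \<partial>count_space (to_nat_on D ` D))"
    by (rule nn_integral_bij_count_space[OF b])
  also have "\<dots> = (\<integral>\<^sup>+i. f (from_nat_into D i) * indicator (to_nat_on D ` D) i \<partial>count_space UNIV)"
    by (rule nn_integral_count_space_indicator) auto
  also have "\<dots> = (\<Sum>i. f (from_nat_into D i) * indicator (to_nat_on D ` D) i)"
    by (rule nn_integral_count_space_nat)
  also have "\<dots> = (\<Sum>i. if i \<in> to_nat_on D ` D then f (from_nat_into D i) else 0)"
    by (intro suminf_cong) (auto simp: indicator_def)
  finally show ?thesis .
qed

lemma nn_integral_count_space_Un_le:
  "(\<integral>\<^sup>+x. f x \<partial>count_space (C \<union> D)) \<le> (\<integral>\<^sup>+x. f x \<partial>count_space C) + (\<integral>\<^sup>+x. f x \<partial>count_space D)"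
proof -
  have "(\<integral>\<^sup>+x. f x \<partial>count_space (C \<union> D)) = (\<integral>\<^sup>+x. f x * indicator (C \<union> D) x \<partial>count_space UNIV)"
    by (rule nn_integral_count_space_indicator) auto
  also have "\<dots> \<le> (\<integral>\<^sup>+x. f x * indicator C x + f x * indicator D x \<partial>count_space UNIV)"
    by (intro nn_integral_mono) (auto simp: indicator_def)
  also have "\<dots> = (\<integral>\<^sup>+x. f x \<partial>count_space C) + (\<integral>\<^sup>+x. f x \<partial>count_space D)"
    by (subst nn_integral_add) (simp_all add: nn_integral_count_space_indicator [symmetric])
  finally show ?thesis .
qed

abbreviation pcball :: "'a::euclidean_space \<times> real \<Rightarrow> 'a set" where
  "pcball d \<equiv> cball (fst d) (snd d)"

text \<open>Vitali's theorem leaves out a null set, which must still be covered because its slices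
  may carry Hausdorff measure. Here overlaps are harmless: disjoint balls inside an open set of
  volume at most \<open>\<eta> / 5 ^ DIM('a)\<close> cover \<open>N\<close> after enlargement by 5,
  at total volume at most \<eta>.\<close>

lemma negligible_cover_cballs:
  fixes N B :: "'a::euclidean_space set"
  assumes N: "negligible N" "N \<subseteq> B" "open B" and \<delta>: "\<delta> > 0" and \<eta>: "\<eta> > 0"
  obtains D where "countable D" "\<And>d. d \<in> D \<Longrightarrow> 0 < snd d \<and> 2 * snd d \<le> \<delta> \<and> pcball d \<subseteq> B"
    "N \<subseteq> \<Union> (pcball ` D)" "(\<integral>\<^sup>+d. emeasure lborel (pcball d) \<partial>count_space D) \<le> ennreal \<eta>"
proof -
  have L: "N \<in> lmeasurable" "measure lebesgue N = 0" 
    using N(1) by (auto simp: negligible_iff_measure)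
  obtain T where T: "open T" "N \<subseteq> T" "T - N \<in> lmeasurable" "emeasure lebesgue (T - N) < ennreal (\<eta> / 5 ^ DIM('a))"
    using sets_lebesgue_outer_open[of N "\<eta> / 5 ^ DIM('a)"] L \<eta> by auto
  define V where "V = T \<inter> B"
  have V: "open V" "N \<subseteq> V" "V \<subseteq> B" using T N by (auto simp: V_def)
  have "emeasure lborel V \<le> emeasure lebesgue T" 
    using V(1) T(1) by (simp add: V_def emeasure_mono)
  also have "T = (T - N) \<union> N" using T by auto
  also have "emeasure lebesgue \<dots> \<le> emeasure lebesgue (T - N) + emeasure lebesgue N"
    using T L by (intro emeasure_subadditive) auto
  also have "emeasure lebesgue N = 0" using N(1) L(1) negligible_iff_emeasure0 by blast
  also have "emeasure lebesgue (T - N) + 0 \<le> ennreal (\<eta> / 5 ^ DIM('a))" using T by simp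
  finally have eV: "emeasure lborel V \<le> ennreal (\<eta> / 5 ^ DIM('a))" .
  \<comment> \<open>The size and inclusion conditions are imposed on the enlarged balls, since those
    form the final cover.\<close>
  define K where "K = {d. 0 < snd d \<and> 2 * (5 * snd d) \<le> \<delta> \<and> cball (fst d) (5 * snd d) \<subseteq> V}"
  have cov: "N \<subseteq> (\<Union>d\<in>K. ball (fst d) (snd d))"
  proof
    fix x assume "x \<in> N"
    then obtain e where e: "e > 0" "cball x e \<subseteq> V" using V(1,2) by (meson \<open>x \<in> N\<close> open_contains_cball subsetD)
    define r where "r = min (e / 5) (\<delta> / 10)"
    have "cball x (5 * r) \<subseteq> cball x e" by (rule subset_cball) (simp add: r_def)
    then have "(x, r) \<in> K" using e \<delta> by (auto simp: K_def r_def)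
    moreover have "x \<in> ball x r" using e \<delta> by (simp add: r_def)
    ultimately show "x \<in> (\<Union>d\<in>K. ball (fst d) (snd d))" by force
  qed
  obtain C where C: "countable C" "C \<subseteq> K"
     "pairwise (\<lambda>i j. disjnt (ball (fst i) (snd i)) (ball (fst j) (snd j))) C"
     "N \<subseteq> (\<Union>i\<in>C. ball (fst i) (5 * snd i))"
    by (rule Vitali_covering_lemma_balls[OF cov, of \<delta>]) (use \<delta> in \<open>auto simp: K_def\<close>)
  define s where "s = (\<lambda>d::'a\<times>real. (fst d, 5 * snd d))"
  have s: "inj_on s C" by (auto simp: inj_on_def s_def prod_eq_iff)
  show ?thesis
  proof (rule that[of "s ` C"])
    show "countable (s ` C)" using C by simp
    show "0 < snd d \<and> 2 * snd d \<le> \<delta> \<and> pcball d \<subseteq> B" if "d \<in> s ` C" for d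
    proof -
      obtain d' where "d' \<in> C" "d = s d'" using \<open>d \<in> s ` C\<close> by blast
      moreover have "d' \<in> K" using \<open>d' \<in> C\<close> C(2) by blast
      ultimately show ?thesis using V(3) by (force simp: s_def K_def)
    qed
    show "N \<subseteq> \<Union> (pcball ` s ` C)" 
    proof
      fix x assume "x \<in> N"
      then obtain i where i: "i \<in> C" "x \<in> ball (fst i) (5 * snd i)" using C(4) by blast
      then have "x \<in> pcball (s i)" by (simp add: s_def)
      then show "x \<in> \<Union> (pcball ` s ` C)" using i(1) by blast
    qed
    have pos: "snd d > 0" if "d \<in> C" for d
    proof -
      have "d \<in> K" using that C(2) by blast
      then show ?thesis by (simp add: K_def)
    qed
    have "(\<integral>\<^sup>+d. emeasure lborel (pcball d) \<partial>count_space (s ` C)) = (\<integral>\<^sup>+d. emeasure lborel (pcball (s d)) \<partial>count_space C)"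
      by (rule nn_integral_bij_count_space[symmetric]) (simp add: s inj_on_imp_bij_betw)
    also have "\<dots> = (\<integral>\<^sup>+d. ennreal (5 ^ DIM('a)) * emeasure lborel (ball (fst d) (snd d)) \<partial>count_space C)"
    proof (intro nn_integral_cong)
      fix d :: "'a \<times> real" assume "d \<in> space (count_space C)"
      then have "snd d > 0" using pos by simp
      then show "emeasure lborel (pcball (s d)) = ennreal (5 ^ DIM('a)) * emeasure lborel (ball (fst d) (snd d))"
        by (simp add: s_def emeasure_cball emeasure_ball power_mult_distrib ennreal_mult [symmetric] mult_ac)
    qed
    also have "\<dots> = ennreal (5 ^ DIM('a)) * (\<integral>\<^sup>+d. emeasure lborel (ball (fst d) (snd d)) \<partial>count_space C)"
      by (rule nn_integral_cmult) simp
    also have "(\<integral>\<^sup>+d. emeasure lborel (ball (fst d) (snd d)) \<partial>count_space C) = emeasure lborel (\<Union>d\<in>C. ball (fst d) (snd d))"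
      using C(1,3) by (intro emeasure_UN_countable[symmetric]) (simp_all add: disjoint_family_on_def pairwise_def disjnt_def)
    also have "\<dots> \<le> emeasure lborel V"
    proof (intro emeasure_mono)
      show "(\<Union>d\<in>C. ball (fst d) (snd d)) \<subseteq> V"
      proof (intro UN_least)
        fix d assume d: "d \<in> C"
        have "ball (fst d) (snd d) \<subseteq> cball (fst d) (5 * snd d)" using pos[OF d] by auto
        moreover have "d \<in> K" using d C(2) by blast
        ultimately show "ball (fst d) (snd d) \<subseteq> V" unfolding K_def by blast
      qed
    qed (use V in simp)
    also note eV
    also have "ennreal (5 ^ DIM('a)) * ennreal (\<eta> / 5 ^ DIM('a)) = ennreal \<eta>"
      using \<eta> by (simp add: ennreal_mult [symmetric])
    finally show "(\<integral>\<^sup>+d. emeasure lborel (pcball d) \<partial>count_space (s ` C)) \<le> ennreal \<eta>"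
      by (simp add: mult_left_mono)
  qed
qed

text \<open>Half of \<eta> pays for an open set \<open>V\<close> around \<open>A\<close>, filled up
  to a null set by disjoint balls whose volumes therefore add up to at most that of
  \<open>V\<close>; the other half pays for covering the null remainder.\<close>

lemma measurable_cover_cballs:
  fixes A B :: "'a::euclidean_space set"
  assumes A: "A \<in> sets lebesgue" "A \<subseteq> B" "open B" and \<delta>: "\<delta> > 0" and \<eta>: "\<eta> > 0"
  obtains D where "countable D" "\<And>d. d \<in> D \<Longrightarrow> 0 < snd d \<and> 2 * snd d \<le> \<delta> \<and> pcball d \<subseteq> B"
    "A \<subseteq> \<Union> (pcball ` D)"
    "(\<integral>\<^sup>+d. emeasure lborel (pcball d) \<partial>count_space D) \<le> emeasure lebesgue A + ennreal \<eta>"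
proof -
  obtain T where T: "open T" "A \<subseteq> T" "T - A \<in> lmeasurable" "emeasure lebesgue (T - A) < ennreal (\<eta> / 2)"
    using sets_lebesgue_outer_open[of A "\<eta> / 2"] A \<eta> by auto
  define V where "V = T \<inter> B"
  have V: "open V" "A \<subseteq> V" "V \<subseteq> B" using T A by (auto simp: V_def)
  have "emeasure lborel V \<le> emeasure lebesgue T" 
    using V(1) T(1) by (simp add: V_def emeasure_mono)
  also have "T = A \<union> (T - A)" using T by auto
  also have "emeasure lebesgue \<dots> \<le> emeasure lebesgue A + emeasure lebesgue (T - A)"
    using T A by (intro emeasure_subadditive) auto
  also have "\<dots> \<le> emeasure lebesgue A + ennreal (\<eta> / 2)" using T by (intro add_left_mono) simp
  finally have eV: "emeasure lborel V \<le> emeasure lebesgue A + ennreal (\<eta> / 2)" .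
  define K where "K = {d. 0 < snd d \<and> 2 * snd d \<le> \<delta> \<and> pcball d \<subseteq> V}"
  obtain C where C: "countable C" "C \<subseteq> K"
     "pairwise (\<lambda>i j. disjnt (pcball i) (pcball j)) C"
     "negligible (V - (\<Union>i\<in>C. pcball i))"
  proof (rule Vitali_covering_theorem_cballs[of K snd V fst])
    show "0 < snd i" if "i \<in> K" for i using that by (simp add: K_def)
    show "\<exists>i. i \<in> K \<and> x \<in> pcball i \<and> snd i < d" if xd: "x \<in> V" "0 < d" for x d
    proof -
      obtain e where e: "e > 0" "cball x e \<subseteq> V" using V(1) xd(1) by (meson open_contains_cball)
      define r where "r = min e (min (\<delta> / 2) (d / 2))"
      have "cball x r \<subseteq> cball x e" by (rule subset_cball) (simp add: r_def)
      then have "(x, r) \<in> K" "r < d" "x \<in> cball x r" using e \<delta> that by (auto simp: K_def r_def)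
      then show ?thesis by force
    qed
  qed auto
  obtain D where D: "countable D" "\<And>d. d \<in> D \<Longrightarrow> 0 < snd d \<and> 2 * snd d \<le> \<delta> \<and> pcball d \<subseteq> B"
    "V - (\<Union>i\<in>C. pcball i) \<subseteq> \<Union> (pcball ` D)"
    "(\<integral>\<^sup>+d. emeasure lborel (pcball d) \<partial>count_space D) \<le> ennreal (\<eta> / 2)"
    by (rule negligible_cover_cballs[OF C(4) _ A(3) \<delta> half_gt_zero[OF \<eta>]])
       (use V(3) in auto)
  show ?thesis
  proof (rule that[of "C \<union> D"])
    show "countable (C \<union> D)" using C D by simp
    show "0 < snd d \<and> 2 * snd d \<le> \<delta> \<and> pcball d \<subseteq> B" if "d \<in> C \<union> D" for d
      using that
    proof
      assume "d \<in> C"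
      then have "d \<in> K" using C(2) by blast
      then show ?thesis unfolding K_def using V(3) by (metis (mono_tags, lifting) mem_Collect_eq order_trans)
    qed (rule D(2))
    show "A \<subseteq> \<Union> (pcball ` (C \<union> D))" using V(2) D(3) by auto
    have "(\<integral>\<^sup>+d. emeasure lborel (pcball d) \<partial>count_space C) = emeasure lborel (\<Union>d\<in>C. pcball d)"
      using C(1,3) by (intro emeasure_UN_countable[symmetric]) (simp_all add: disjoint_family_on_def pairwise_def disjnt_def)
    also have "\<dots> \<le> emeasure lborel V"
      by (intro emeasure_mono) (use C(2) V in \<open>auto simp: K_def\<close>)
    also note eV
    finally have "(\<integral>\<^sup>+d. emeasure lborel (pcball d) \<partial>count_space (C \<union> D)) \<le> (emeasure lebesgue A + ennreal (\<eta> / 2)) + ennreal (\<eta> / 2)"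
      using D(4) by (intro order_trans[OF nn_integral_count_space_Un_le add_mono])
    also have "\<dots> = emeasure lebesgue A + ennreal \<eta>"
      using \<eta> by (simp add: add.assoc ennreal_plus [symmetric] del: ennreal_plus)
    finally show "(\<integral>\<^sup>+d. emeasure lborel (pcball d) \<partial>count_space (C \<union> D)) \<le> emeasure lebesgue A + ennreal \<eta>" .
  qed
qed

section \<open>The coarea inequality\<close>

lemma upper_integral_le_top: "upper_integral_le f top"
  by (rule upper_integral_leI[of "\<lambda>_. top"]) auto

text \<open>The balls are intersected with \<open>E\<close> before they are used as a cover, so that
  the diameters of slices enter rather than those of the balls.\<close>

lemma hausdorff_pre_le_cballs:
  fixes E :: "'a::euclidean_space set"
  assumes D: "countable D" "\<And>d. d \<in> D \<Longrightarrow> 0 < snd d \<and> 2 * snd d \<le> \<delta>" "E \<subseteq> \<Union> (pcball ` D)"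
    and s: "s > 0" and \<delta>: "\<delta> > 0"
  shows "hausdorff_pre s \<delta> E \<le> (\<Sum>i. if i \<in> to_nat_on D ` D
     then ennreal (unit_ball_vol s * (diameter (pcball (from_nat_into D i) \<inter> E) / 2) powr s) else 0)"
proof -
  define C where "C = (\<lambda>i. if i \<in> to_nat_on D ` D then pcball (from_nat_into D i) \<inter> E else {})"
  have mem: "from_nat_into D i \<in> D" if "i \<in> to_nat_on D ` D" for i
    using that D(1) by auto
  have "hausdorff_pre s \<delta> E \<le> (\<Sum>i. ennreal (unit_ball_vol s * (diameter (C i) / 2) powr s))"
    unfolding hausdorff_pre_def
  proof (rule INF_lower, clarify, intro conjI allI)
    show "E \<subseteq> (\<Union>i. C i)"
    proof
      fix x assume x: "x \<in> E"
      then obtain d where d: "d \<in> D" "x \<in> pcball d" using D(3) by blast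
      then have "x \<in> C (to_nat_on D d)" using x D(1) by (simp add: C_def)
      then show "x \<in> (\<Union>i. C i)" by blast
    qed
    show "bounded (C i)" for i unfolding C_def by (auto intro: bounded_subset[OF bounded_cball])
    show "diameter (C i) \<le> \<delta>" for i
    proof (cases "i \<in> to_nat_on D ` D")
      case True
      have "diameter (pcball (from_nat_into D i) \<inter> E) \<le> diameter (pcball (from_nat_into D i))"
        by (rule diameter_subset) auto
      also have "\<dots> \<le> \<delta>" using D(2)[OF mem[OF True]] by simp
      finally show ?thesis using True by (simp add: C_def)
    qed (use \<delta> in \<open>simp add: C_def\<close>)
  qed
  also have "\<dots> = (\<Sum>i. if i \<in> to_nat_on D ` D
     then ennreal (unit_ball_vol s * (diameter (pcball (from_nat_into D i) \<inter> E) / 2) powr s) else 0)"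
    using s by (intro suminf_cong) (simp add: C_def)
  finally show ?thesis .
qed

lemma hausdorff_pre_antimono: "\<delta> \<le> \<delta>' \<Longrightarrow> hausdorff_pre s \<delta>' E \<le> hausdorff_pre s \<delta> E"
  unfolding hausdorff_pre_def by (rule INF_superset_mono) (auto intro: order_trans)

lemma hausdorff_outer_le_liminf:
  "hausdorff_outer s E \<le> liminf (\<lambda>k. hausdorff_pre s (1 / real (Suc k)) E)"
  unfolding hausdorff_outer_def
proof (rule SUP_least)
  fix \<delta> :: real assume "\<delta> \<in> {0<..}"
  then have "\<forall>\<^sub>F k in sequentially. 1 / real (Suc k) < \<delta>"
    using LIMSEQ_inverse_real_of_nat[THEN order_tendstoD(2), of \<delta>] by (simp add: inverse_eq_divide)
  then have "\<forall>\<^sub>F k in sequentially. hausdorff_pre s \<delta> E \<le> hausdorff_pre s (1 / real (Suc k)) E"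
    by eventually_elim (intro hausdorff_pre_antimono less_imp_le)
  then show "hausdorff_pre s \<delta> E \<le> liminf (\<lambda>k. hausdorff_pre s (1 / real (Suc k)) E)"
    by (rule Liminf_bounded)
qed

text \<open>Slices of the balls covering \<open>A\<close> cover every level set in \<open>A\<close>
  simultaneously. Each ball contributes at most a constant times its volume after integration over
  the levels, and the volumes add up to little more than that of \<open>A\<close>.\<close>

lemma level_set_hausdorff_le_nearly_linear:
  fixes u :: "'a::euclidean_space \<Rightarrow> real" and v :: 'a
  assumes n: "DIM('a) \<ge> 2" and v: "v \<noteq> 0" and \<epsilon>: "0 < \<epsilon>" "\<epsilon> < 1"
    and lin: "\<And>x y. x \<in> B \<Longrightarrow> y \<in> B \<Longrightarrow> \<bar>u y - u x - v \<bullet> (y - x)\<bar> \<le> \<epsilon> * norm v * norm (y - x)"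
    and A: "A \<in> sets lebesgue" "A \<subseteq> B" "open B"
  shows "upper_integral_le (\<lambda>t. hausdorff_outer (real (DIM('a) - 1)) {x \<in> A. u x = t})
           (ennreal (slice_dist \<epsilon> DIM('a) * norm v) * emeasure lebesgue A)"
proof -
  define s where "s = real (DIM('a) - 1)"
  have s: "s > 0" using n by (simp add: s_def)
  define K where "K = ennreal (slice_dist \<epsilon> DIM('a) * norm v)"
  \<comment> \<open>A single \<delta> serves as scale of the cover and as excess volume, so one
    limit removes both.\<close>
  have pre: "upper_integral_le (\<lambda>t. hausdorff_pre s \<delta> {x \<in> A. u x = t})
      (K * (emeasure lebesgue A + ennreal \<delta>))" if \<delta>: "\<delta> > 0" for \<delta>
  proof -
    obtain D where D: "countable D" "\<And>d. d \<in> D \<Longrightarrow> 0 < snd d \<and> 2 * snd d \<le> \<delta> \<and> pcball d \<subseteq> B"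
      "A \<subseteq> \<Union> (pcball ` D)"
      "(\<integral>\<^sup>+d. emeasure lborel (pcball d) \<partial>count_space D) \<le> emeasure lebesgue A + ennreal \<delta>"
      using measurable_cover_cballs[OF A \<delta> \<delta>] by blast
    have mem: "from_nat_into D i \<in> D" if "i \<in> to_nat_on D ` D" for i
      using that D(1) by auto
    define f where "f = (\<lambda>i t. if i \<in> to_nat_on D ` D
     then ennreal (unit_ball_vol s * (diameter {x \<in> pcball (from_nat_into D i). u x = t} / 2) powr s) else 0)"
    define L where "L = (\<lambda>i. if i \<in> to_nat_on D ` D then K * emeasure lborel (pcball (from_nat_into D i)) else 0)"
    have fL: "upper_integral_le (f i) (L i)" for i
    proof (cases "i \<in> to_nat_on D ` D")
      case True
      note d = D(2)[OF mem[OF True]]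
      have "upper_integral_le (\<lambda>t. ennreal (unit_ball_vol s * (diameter {x \<in> pcball (from_nat_into D i). u x = t} / 2) powr s))
         (K * emeasure lborel (pcball (from_nat_into D i)))"
        unfolding s_def K_def using d by (intro ball_slice_upper_integral n v \<epsilon> lin) auto
      then show ?thesis using True by (simp add: f_def L_def)
    next
      case False
      then show ?thesis by (simp add: f_def L_def upper_integral_leI[of "\<lambda>_. 0"])
    qed
    have "upper_integral_le (\<lambda>t. \<Sum>i. f i t) (\<Sum>i. L i)"
      by (rule upper_integral_le_suminf[OF fL])
    then show ?thesis
    proof (rule upper_integral_le_mono)
      show "hausdorff_pre s \<delta> {x \<in> A. u x = t} \<le> (\<Sum>i. f i t)" for t
      proof -
        have "hausdorff_pre s \<delta> {x \<in> A. u x = t} \<le> (\<Sum>i. if i \<in> to_nat_on D ` D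
     then ennreal (unit_ball_vol s * (diameter (pcball (from_nat_into D i) \<inter> {x \<in> A. u x = t}) / 2) powr s) else 0)"
          using D by (intro hausdorff_pre_le_cballs s \<delta>) auto
        also have "\<dots> \<le> (\<Sum>i. f i t)"
        proof (intro suminf_le)
          fix i
          have "diameter (pcball (from_nat_into D i) \<inter> {x \<in> A. u x = t}) \<le> diameter {x \<in> pcball (from_nat_into D i). u x = t}"
            by (rule diameter_subset) (auto intro: bounded_subset[OF bounded_cball])
          moreover have "diameter (pcball (from_nat_into D i) \<inter> {x \<in> A. u x = t}) \<ge> 0"
            by (rule diameter_ge_0) (auto intro: bounded_subset[OF bounded_cball])
          ultimately show "(if i \<in> to_nat_on D ` D
     then ennreal (unit_ball_vol s * (diameter (pcball (from_nat_into D i) \<inter> {x \<in> A. u x = t}) / 2) powr s) else 0) \<le> f i t"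
            using s by (auto simp: f_def intro!: ennreal_leI mult_left_mono powr_mono2)
        qed auto
        finally show ?thesis .
      qed
      have "(\<Sum>i. L i) = (\<integral>\<^sup>+d. K * emeasure lborel (pcball d) \<partial>count_space D)"
        unfolding L_def by (rule nn_integral_count_space_suminf[OF D(1), symmetric])
      also have "\<dots> = K * (\<integral>\<^sup>+d. emeasure lborel (pcball d) \<partial>count_space D)"
        by (rule nn_integral_cmult) simp
      finally show "(\<Sum>i. L i) \<le> K * (emeasure lebesgue A + ennreal \<delta>)"
        using D(4) by (simp add: mult_left_mono)
    qed
  qed
  have "(\<lambda>k. 1 / real (Suc k)) \<longlonglongrightarrow> 0"
    using LIMSEQ_inverse_real_of_nat by (simp add: inverse_eq_divide)
  then have "(\<lambda>k. ennreal (1 / real (Suc k))) \<longlonglongrightarrow> ennreal 0" by (rule tendsto_ennrealI)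
  then have "(\<lambda>k. K * (emeasure lebesgue A + ennreal (1 / real (Suc k)))) \<longlonglongrightarrow> K * (emeasure lebesgue A + ennreal 0)"
    by (intro ennreal_tendsto_cmult tendsto_add tendsto_const) (auto simp: K_def)
  then have "liminf (\<lambda>k. K * (emeasure lebesgue A + ennreal (1 / real (Suc k)))) \<le> K * emeasure lebesgue A"
    using lim_imp_Liminf[OF sequentially_bot] by fastforce
  moreover have "upper_integral_le (\<lambda>t. hausdorff_pre s (1 / real (Suc k)) {x \<in> A. u x = t})
      (K * (emeasure lebesgue A + ennreal (1 / real (Suc k))))" for k
    by (rule pre) simp
  ultimately show ?thesis unfolding s_def [symmetric] K_def [symmetric]
    by (rule upper_integral_le_liminf[OF _ hausdorff_outer_le_liminf, rotated])
qed

text \<open>The gradient is a parameter so that its continuity can be assumed directly;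
  \<open>grad u\<close>, defined by choice, is identified with it on the domain in
  \<open>grad_eq\<close>.\<close>

locale C1_function =
  fixes \<Omega> :: "'a::euclidean_space set" and u :: "'a \<Rightarrow> real" and G :: "'a \<Rightarrow> 'a"
  assumes open_domain: "open \<Omega>"
    and has_gradient: "\<And>x. x \<in> \<Omega> \<Longrightarrow> (u has_derivative (\<lambda>h. G x \<bullet> h)) (at x)"
    and continuous_gradient: "continuous_on \<Omega> G"
begin

text \<open>A linearization error relative to the slope makes sense only where the slope is nonzero.
  Critical points cost nothing later because \<open>F 0 = 0\<close>.\<close>

definition regular :: "'a set" where "regular = {x \<in> \<Omega>. G x \<noteq> 0}"

lemma continuous: "continuous_on \<Omega> u"
  using has_gradient by (intro continuous_at_imp_continuous_on ballI has_derivative_continuous)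

lemma open_regular: "open regular"
proof -
  have "regular = \<Omega> \<inter> G -` (- {0})" by (auto simp: regular_def)
  then show ?thesis
    using continuous_open_preimage[OF continuous_gradient open_domain, of "- {0}"] by auto
qed

lemma level_set_borel: "{x \<in> \<Omega>. u x = t} \<in> sets borel"
proof -
  have "open (\<Omega> \<inter> u -` (- {t}))"
    by (rule continuous_open_preimage[OF continuous open_domain]) auto
  moreover have "{x \<in> \<Omega>. u x = t} = \<Omega> - (\<Omega> \<inter> u -` (- {t}))" by auto
  ultimately show ?thesis using open_domain by (metis sets.Diff borel_open)
qed

lemma gradient_norm_measurable:
  "A \<in> sets borel \<Longrightarrow> A \<subseteq> \<Omega> \<Longrightarrow> (\<lambda>x. ennreal (norm (G x)) * indicator A x) \<in> borel_measurable borel"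
proof -
  assume A: "A \<in> sets borel" "A \<subseteq> \<Omega>"
  have "(\<lambda>x. indicator A x *\<^sub>R G x) \<in> borel_measurable borel"
    using A by (intro borel_measurable_continuous_on_indicator continuous_on_subset[OF continuous_gradient])
  then have "(\<lambda>x. ennreal (norm (indicator A x *\<^sub>R G x))) \<in> borel_measurable borel" by measurable
  also have "(\<lambda>x. ennreal (norm (indicator A x *\<^sub>R G x))) = (\<lambda>x. ennreal (norm (G x)) * indicator A x)"
    by (auto simp: indicator_def)
  finally show ?thesis .
qed

text \<open>The mean value inequality for \<open>u\<close> minus the linear map \<open>G x\<close>:
  its gradient \<open>G w - G x\<close> is small near \<open>x\<close> by continuity. The error is
  measured relative to \<open>norm (G x)\<close>, as the slice estimate demands.\<close>

lemma nearly_linear_ball: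
  assumes x: "x \<in> regular" and \<epsilon>: "\<epsilon> > 0"
  obtains \<rho> where "\<rho> > 0" "ball x \<rho> \<subseteq> regular"
    "\<And>y. y \<in> ball x \<rho> \<Longrightarrow> norm (G y - G x) \<le> \<epsilon> * norm (G x)"
    "\<And>y z. y \<in> ball x \<rho> \<Longrightarrow> z \<in> ball x \<rho> \<Longrightarrow> \<bar>u z - u y - G x \<bullet> (z - y)\<bar> \<le> \<epsilon> * norm (G x) * norm (z - y)"
proof -
  have G0: "norm (G x) > 0" using x by (simp add: regular_def)
  have xO: "x \<in> \<Omega>" using x by (simp add: regular_def)
  have "isCont G x" using continuous_gradient open_domain xO by (simp add: continuous_on_eq_continuous_at)
  then obtain d where d: "d > 0" "\<And>y. dist y x < d \<Longrightarrow> dist (G y) (G x) < \<epsilon> * norm (G x)"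
    unfolding continuous_at_eps_delta using \<epsilon> G0 by (metis mult_pos_pos)
  obtain e where e: "e > 0" "ball x e \<subseteq> regular" using open_regular x open_contains_ball by blast
  define \<rho> where "\<rho> = min d e"
  have sub: "ball x \<rho> \<subseteq> ball x e" by (rule subset_ball) (simp add: \<rho>_def)
  have g: "norm (G y - G x) \<le> \<epsilon> * norm (G x)" if "y \<in> ball x \<rho>" for y
    using d(2)[of y] that by (simp add: \<rho>_def dist_norm norm_minus_commute)
  have "\<bar>u z - u y - G x \<bullet> (z - y)\<bar> \<le> \<epsilon> * norm (G x) * norm (z - y)" if "y \<in> ball x \<rho>" "z \<in> ball x \<rho>" for y z
  proof -
    have "norm ((\<lambda>w. u w - G x \<bullet> w) z - (\<lambda>w. u w - G x \<bullet> w) y) \<le> \<epsilon> * norm (G x) * norm (z - y)"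
    proof (rule differentiable_bound[of "ball x \<rho>" _ "\<lambda>w h. (G w - G x) \<bullet> h"])
      fix w assume w: "w \<in> ball x \<rho>"
      then have "w \<in> \<Omega>" using sub e by (auto simp: regular_def)
      from has_gradient[OF this] have "((\<lambda>w. u w - G x \<bullet> w) has_derivative (\<lambda>h. G w \<bullet> h - G x \<bullet> h)) (at w)"
        by (auto intro!: derivative_eq_intros)
      then show "((\<lambda>w. u w - G x \<bullet> w) has_derivative (\<lambda>h. (G w - G x) \<bullet> h)) (at w within ball x \<rho>)"
        by (simp add: inner_diff_left has_derivative_at_withinI)
      show "onorm (\<lambda>h. (G w - G x) \<bullet> h) \<le> \<epsilon> * norm (G x)"
      proof (rule onorm_le)
        fix h
        have "norm ((G w - G x) \<bullet> h) \<le> norm (G w - G x) * norm h" using Cauchy_Schwarz_ineq2 by auto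
        also have "\<dots> \<le> \<epsilon> * norm (G x) * norm h" using g[OF w] by (rule mult_right_mono) simp
        finally show "norm ((G w - G x) \<bullet> h) \<le> \<epsilon> * norm (G x) * norm h" .
      qed
    qed (use that in auto)
    then show ?thesis by (simp add: inner_diff_right algebra_simps)
  qed
  then show ?thesis using that[of \<rho>] d(1) e sub g by (auto simp: \<rho>_def)
qed

end

text \<open>The shift by 2 keeps \<epsilon> strictly between 0 and 1 from the first index on. The
  divisor \<open>1 - \<epsilon>\<close> comes from replacing the slope at a ball's centre by the
  slope at the point of integration.\<close>

lemma slice_dist_tendsto:
  "((\<lambda>k. slice_dist (1 / real (k + 2)) n / (1 - 1 / real (k + 2))) \<longlongrightarrow> 1) sequentially"
proof -
  have "(\<lambda>k. 1 / real (k + 2)) \<longlonglongrightarrow> 0"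
    using LIMSEQ_ignore_initial_segment[OF lim_1_over_n, of 2] by simp
  then have "(\<lambda>k. slice_dist (1 / real (k + 2)) n / (1 - 1 / real (k + 2))) \<longlonglongrightarrow>
      (1 + 2 * 0 * unit_ball_vol (real (n - 1)) / unit_ball_vol (real n)) / sqrt (1 - 0\<^sup>2) ^ (n - 1) / (1 - 0)"
    unfolding slice_dist_def times_divide_eq_left [symmetric]
    by (intro tendsto_intros) (auto simp: unit_ball_vol_pos less_imp_neq[symmetric] simp del: unit_ball_vol_nonneg)
  then show ?thesis by simp
qed

context C1_function
begin

text \<open>Countably many balls of near linearity cover \<open>regular\<close>; made disjoint, they
  cut \<open>A\<close> into pieces on which the slope is constant up to the factor
  \<open>1 - \<epsilon>\<close>, so the estimate with constant slope becomes an integral of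
  \<open>norm (G x)\<close>. \<open>M\<close> stands for the Hausdorff measure on Borel sets; that
  the latter really is a measure is certified only in the final proof.\<close>

lemma level_set_coarea:
  assumes n: "DIM('a) \<ge> 2"
    and M: "sets M = sets borel" "\<And>E. E \<in> sets borel \<Longrightarrow> emeasure M E = hausdorff_outer (real (DIM('a) - 1)) E"
    and A: "A \<in> sets borel" "A \<subseteq> regular"
  shows "upper_integral_le (\<lambda>t. emeasure M {x \<in> A. u x = t})
           (\<integral>\<^sup>+x. ennreal (norm (G x)) * indicator A x \<partial>lborel)" (is "upper_integral_le ?m ?I")
\<comment> \<open>Finiteness of \<open>?I\<close> allows the factor to pass to its limit 1 in the
  product at the end; a nonempty \<open>regular\<close> allows the covering balls to be enumerated
  by \<open>from_nat_into\<close>.\<close>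
proof (cases "?I = top \<or> regular = {}")
  case True
  then show ?thesis
  proof
    assume "regular = {}"
    then have "A = {}" using A by simp
    then show ?thesis by (simp add: upper_integral_leI[of "\<lambda>_. 0"])
  qed (simp add: upper_integral_le_top)
next
  case False
  have AO: "A \<subseteq> \<Omega>" using A by (auto simp: regular_def)
  have step: "upper_integral_le ?m (ennreal (slice_dist \<epsilon> DIM('a) / (1 - \<epsilon>)) * ?I)" if \<epsilon>: "0 < \<epsilon>" "\<epsilon> < 1" for \<epsilon>
  proof -
    define P where "P = (\<lambda>x r. r > 0 \<and> (\<forall>y\<in>ball x r. norm (G y - G x) \<le> \<epsilon> * norm (G x))
      \<and> (\<forall>y\<in>ball x r. \<forall>z\<in>ball x r. \<bar>u z - u y - G x \<bullet> (z - y)\<bar> \<le> \<epsilon> * norm (G x) * norm (z - y)))"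
    have "\<forall>x\<in>regular. \<exists>r. P x r"
    proof
      fix x assume "x \<in> regular"
      then show "\<exists>r. P x r"
        by (rule nearly_linear_ball[OF _ \<epsilon>(1)]) (auto simp: P_def)
    qed
    from bchoice[OF this] obtain \<rho> where P: "\<And>x. x \<in> regular \<Longrightarrow> P x (\<rho> x)" by blast
    have \<rho>: "\<And>x. x \<in> regular \<Longrightarrow> \<rho> x > 0"
      "\<And>x y. x \<in> regular \<Longrightarrow> y \<in> ball x (\<rho> x) \<Longrightarrow> norm (G y - G x) \<le> \<epsilon> * norm (G x)"
      "\<And>x y z. x \<in> regular \<Longrightarrow> y \<in> ball x (\<rho> x) \<Longrightarrow> z \<in> ball x (\<rho> x) \<Longrightarrow> \<bar>u z - u y - G x \<bullet> (z - y)\<bar> \<le> \<epsilon> * norm (G x) * norm (z - y)"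
      using P unfolding P_def by simp_all
    obtain F' where F': "F' \<subseteq> (\<lambda>x. ball x (\<rho> x)) ` regular" "countable F'" "\<Union> F' = (\<Union>x\<in>regular. ball x (\<rho> x))"
      by (rule Lindelof[of "(\<lambda>x. ball x (\<rho> x)) ` regular"]) auto
    obtain I where I: "I \<subseteq> regular" "countable I" "F' = (\<lambda>x. ball x (\<rho> x)) ` I"
      using F'(1,2) countable_subset_image[of F' "\<lambda>x. ball x (\<rho> x)" regular] by auto
    have cov: "regular \<subseteq> (\<Union>x\<in>I. ball x (\<rho> x))"
    proof
      fix x assume "x \<in> regular"
      then have "x \<in> (\<Union>x\<in>regular. ball x (\<rho> x))" using \<rho>(1) by force
      then show "x \<in> (\<Union>x\<in>I. ball x (\<rho> x))" using F'(3) I(3) by simp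
    qed
    have "I \<noteq> {}" using False cov by auto
    define X where "X = from_nat_into I"
    have X: "X k \<in> regular" for k unfolding X_def using I(1) from_nat_into[OF \<open>I \<noteq> {}\<close>] by blast
    define B where "B = (\<lambda>k. ball (X k) (\<rho> (X k)))"
    have "I = range X" using I(2) \<open>I \<noteq> {}\<close> by (simp add: X_def)
    with cov have covB: "regular \<subseteq> (\<Union>k. B k)" by (simp add: B_def)
    define A' where "A' = (\<lambda>k. A \<inter> disjointed B k)"
    have A': "A' k \<in> sets borel" for k
    proof -
      have "disjointed B k \<in> sets borel"
      proof -
        have "range B \<subseteq> sets borel" by (auto simp: B_def)
        from sets.range_disjointed_sets[OF this] show ?thesis by blast
      qed
      then show ?thesis using A by (simp add: A'_def)
    qed
    have A'B: "A' k \<subseteq> B k" "A' k \<subseteq> A" for k using disjointed_subset[of B k] by (auto simp: A'_def)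
    have UA': "(\<Union>k. A' k) = A"
    proof -
      have "(\<Union>k. A' k) = A \<inter> (\<Union>k. disjointed B k)" by (auto simp: A'_def)
      then show ?thesis using covB A(2) by (auto simp: UN_disjointed_eq)
    qed
    have dA': "disjoint_family A'"
      using disjoint_family_disjointed[of B] by (auto simp: disjoint_family_on_def A'_def)
    have lev: "{x \<in> A' k. u x = t} \<in> sets borel" for k t
    proof -
      have "{x \<in> A' k. u x = t} = A' k \<inter> {x \<in> \<Omega>. u x = t}" using A'B(2)[of k] AO by auto
      then show ?thesis using A'[of k] level_set_borel[of t] by simp
    qed
    define c where "c = slice_dist \<epsilon> DIM('a)"
    have "1 - \<epsilon>\<^sup>2 > 0" using \<epsilon> by (simp add: abs_square_less_1)
    then have c0: "c \<ge> 0" using \<epsilon> by (simp add: c_def slice_dist_def)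
    have piece: "upper_integral_le (\<lambda>t. emeasure M {x \<in> A' k. u x = t})
       (ennreal (c / (1 - \<epsilon>)) * (\<integral>\<^sup>+x. ennreal (norm (G x)) * indicator (A' k) x \<partial>lborel))" for k
    proof -
      have "upper_integral_le (\<lambda>t. hausdorff_outer (real (DIM('a) - 1)) {x \<in> A' k. u x = t})
           (ennreal (slice_dist \<epsilon> DIM('a) * norm (G (X k))) * emeasure lebesgue (A' k))"
      proof (rule level_set_hausdorff_le_nearly_linear[OF n _ \<epsilon>, of _ "B k"])
        show "G (X k) \<noteq> 0" using X by (simp add: regular_def)
        show "\<bar>u y - u x - G (X k) \<bullet> (y - x)\<bar> \<le> \<epsilon> * norm (G (X k)) * norm (y - x)"
          if "x \<in> B k" "y \<in> B k" for x y using \<rho>(3)[OF X] that by (simp add: B_def)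
        show "A' k \<in> sets lebesgue" using A'[of k] by simp
      qed (use A'B in \<open>auto simp: B_def\<close>)
      then show ?thesis
      proof (rule upper_integral_le_mono)
        show "emeasure M {x \<in> A' k. u x = t} \<le> hausdorff_outer (real (DIM('a) - 1)) {x \<in> A' k. u x = t}" for t
          using M(2)[OF lev] by simp
        have ge: "(1 - \<epsilon>) * norm (G (X k)) \<le> norm (G x)" if "x \<in> A' k" for x
        proof -
          have "norm (G x - G (X k)) \<le> \<epsilon> * norm (G (X k))"
            using \<rho>(2)[OF X] that A'B(1)[of k] by (auto simp: B_def)
          moreover have "norm (G (X k)) \<le> norm (G x) + norm (G x - G (X k))"
            using norm_triangle_sub[of "G (X k)" "G x"] by (simp add: norm_minus_commute)
          ultimately show ?thesis by (simp add: algebra_simps)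
        qed
        have "ennreal (c * norm (G (X k))) * emeasure lebesgue (A' k) = (\<integral>\<^sup>+x. ennreal (c * norm (G (X k))) * indicator (A' k) x \<partial>lborel)"
          using A'[of k] by (simp add: nn_integral_cmult_indicator)
        also have "\<dots> \<le> (\<integral>\<^sup>+x. ennreal (c / (1 - \<epsilon>)) * (ennreal (norm (G x)) * indicator (A' k) x) \<partial>lborel)"
        proof (rule nn_integral_mono)
          fix x
          show "ennreal (c * norm (G (X k))) * indicator (A' k) x \<le> ennreal (c / (1 - \<epsilon>)) * (ennreal (norm (G x)) * indicator (A' k) x)"
          proof (cases "x \<in> A' k")
            case True
            have "c * norm (G (X k)) = c / (1 - \<epsilon>) * ((1 - \<epsilon>) * norm (G (X k)))" using \<epsilon> by simp
            also have "\<dots> \<le> c / (1 - \<epsilon>) * norm (G x)" using ge[OF True] c0 \<epsilon> by (intro mult_left_mono) auto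
            finally have "ennreal (c * norm (G (X k))) \<le> ennreal (c / (1 - \<epsilon>)) * ennreal (norm (G x))"
              using c0 \<epsilon> by (subst ennreal_mult [symmetric]) (auto intro!: ennreal_leI)
            then show ?thesis using True by simp
          qed simp
        qed
        also have "\<dots> = ennreal (c / (1 - \<epsilon>)) * (\<integral>\<^sup>+x. ennreal (norm (G x)) * indicator (A' k) x \<partial>lborel)"
          using gradient_norm_measurable[OF A', of k] A'B(2)[of k] AO by (intro nn_integral_cmult) simp
        finally show "ennreal (slice_dist \<epsilon> DIM('a) * norm (G (X k))) * emeasure lebesgue (A' k)
          \<le> ennreal (c / (1 - \<epsilon>)) * (\<integral>\<^sup>+x. ennreal (norm (G x)) * indicator (A' k) x \<partial>lborel)"
          by (simp add: c_def)
      qed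
    qed
    have "upper_integral_le (\<lambda>t. \<Sum>k. emeasure M {x \<in> A' k. u x = t})
       (\<Sum>k. ennreal (c / (1 - \<epsilon>)) * (\<integral>\<^sup>+x. ennreal (norm (G x)) * indicator (A' k) x \<partial>lborel))"
      by (rule upper_integral_le_suminf[OF piece])
    moreover have "(\<Sum>k. emeasure M {x \<in> A' k. u x = t}) = emeasure M {x \<in> A. u x = t}" for t
    proof -
      have "(\<Sum>k. emeasure M {x \<in> A' k. u x = t}) = emeasure M (\<Union>k. {x \<in> A' k. u x = t})"
      proof (rule suminf_emeasure)
        show "range (\<lambda>k. {x \<in> A' k. u x = t}) \<subseteq> sets M" using lev by (auto simp: M(1))
        show "disjoint_family (\<lambda>k. {x \<in> A' k. u x = t})"
          using dA' unfolding disjoint_family_on_def by blast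
      qed
      also have "(\<Union>k. {x \<in> A' k. u x = t}) = {x \<in> A. u x = t}" using UA' by auto
      finally show ?thesis .
    qed
    moreover have "(\<Sum>k. ennreal (c / (1 - \<epsilon>)) * (\<integral>\<^sup>+x. ennreal (norm (G x)) * indicator (A' k) x \<partial>lborel))
       = ennreal (c / (1 - \<epsilon>)) * ?I"
    proof -
      have "?I = (\<integral>\<^sup>+x. (\<Sum>k. ennreal (norm (G x)) * indicator (A' k) x) \<partial>lborel)"
        by (subst UA' [symmetric]) (simp add: suminf_indicator[OF dA'] ennreal_suminf_cmult)
      also have "\<dots> = (\<Sum>k. \<integral>\<^sup>+x. ennreal (norm (G x)) * indicator (A' k) x \<partial>lborel)"
        using gradient_norm_measurable[OF A'] A'B(2) AO by (intro nn_integral_suminf) auto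
      finally show ?thesis by (simp add: ennreal_suminf_cmult)
    qed
    ultimately show ?thesis by (simp add: c_def)
  qed
  have "(\<lambda>k. ennreal (slice_dist (1 / real (k + 2)) DIM('a) / (1 - 1 / real (k + 2))) * ?I) \<longlonglongrightarrow> ennreal 1 * ?I"
    using False by (intro ennreal_tendsto_cmult[of ?I, unfolded mult.commute[of ?I]] tendsto_ennrealI slice_dist_tendsto) (auto simp: less_top)
  then have "liminf (\<lambda>k. ennreal (slice_dist (1 / real (k + 2)) DIM('a) / (1 - 1 / real (k + 2))) * ?I) \<le> ?I"
    using lim_imp_Liminf[OF sequentially_bot] by fastforce
  moreover have "upper_integral_le ?m (ennreal (slice_dist (1 / real (k + 2)) DIM('a) / (1 - 1 / real (k + 2))) * ?I)" for k
    by (rule step) auto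
  moreover have "?m t \<le> liminf (\<lambda>k::nat. ?m t)" for t by (simp add: Liminf_const)
  ultimately show ?thesis
    by (rule upper_integral_le_liminf[rotated 2])
qed

text \<open>Induction over nonnegative Borel functions. In the step to increasing limits the
  majorants need not be monotone, which is why the Fatou rule is used there.\<close>

theorem coarea_inequality:
  assumes n: "DIM('a) \<ge> 2"
    and M: "sets M = sets borel" "\<And>E. E \<in> sets borel \<Longrightarrow> emeasure M E = hausdorff_outer (real (DIM('a) - 1)) E"
    and f: "f \<in> borel_measurable borel"
  shows "upper_integral_le (\<lambda>t. \<integral>\<^sup>+x. f x * indicator {x \<in> regular. u x = t} x \<partial>M)
           (\<integral>\<^sup>+x. f x * (ennreal (norm (G x)) * indicator regular x) \<partial>lborel)"
proof -
  have R [measurable]: "regular \<in> sets borel" using open_regular by simp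
  have [measurable]: "{x \<in> regular. u x = t} \<in> sets M" for t
  proof -
    have "{x \<in> regular. u x = t} = regular \<inter> {x \<in> \<Omega>. u x = t}" by (auto simp: regular_def)
    then show ?thesis using R level_set_borel[of t] by (simp add: M(1))
  qed
  have [measurable]: "(\<lambda>x. ennreal (norm (G x)) * indicator regular x) \<in> borel_measurable lborel"
    using gradient_norm_measurable[OF R] by (auto simp: regular_def)
  have meas: "borel_measurable M = (borel_measurable borel :: ('a \<Rightarrow> ennreal) set)"
    by (rule measurable_cong_sets) (simp_all add: M(1))
  show ?thesis
    using f
  proof (induction rule: borel_measurable_induct)
    case (cong f g)
    then have "f = g" by auto
    with cong show ?case by simp
  next
    case (set A)
    have "upper_integral_le (\<lambda>t. emeasure M {x \<in> A \<inter> regular. u x = t})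
             (\<integral>\<^sup>+x. ennreal (norm (G x)) * indicator (A \<inter> regular) x \<partial>lborel)"
      using set R by (intro level_set_coarea[OF n M]) auto
    moreover have "emeasure M {x \<in> A \<inter> regular. u x = t} = (\<integral>\<^sup>+x. indicator A x * indicator {x \<in> regular. u x = t} x \<partial>M)" for t
    proof -
      have "{x \<in> A \<inter> regular. u x = t} = A \<inter> regular \<inter> {x \<in> \<Omega>. u x = t}" by (auto simp: regular_def)
      then have "{x \<in> A \<inter> regular. u x = t} \<in> sets M" using set R level_set_borel[of t] by (simp add: M(1))
      then have "emeasure M {x \<in> A \<inter> regular. u x = t} = (\<integral>\<^sup>+x. indicator {x \<in> A \<inter> regular. u x = t} x \<partial>M)" by simp
      also have "\<dots> = (\<integral>\<^sup>+x. indicator A x * indicator {x \<in> regular. u x = t} x \<partial>M)"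
        by (intro nn_integral_cong) (auto simp: indicator_def)
      finally show ?thesis .
    qed
    moreover have "(\<lambda>x. ennreal (norm (G x)) * indicator (A \<inter> regular) x) = (\<lambda>x. indicator A x * (ennreal (norm (G x)) * indicator regular x))"
      by (auto simp: indicator_def)
    ultimately show ?case by simp
  next
    case (mult f c)
    then have [measurable]: "f \<in> borel_measurable M" "f \<in> borel_measurable lborel" by (simp_all add: meas)
    have "(\<integral>\<^sup>+x. c * f x * indicator {x \<in> regular. u x = t} x \<partial>M) = c * (\<integral>\<^sup>+x. f x * indicator {x \<in> regular. u x = t} x \<partial>M)" for t
      by (simp add: mult.assoc nn_integral_cmult)
    moreover have "(\<integral>\<^sup>+x. c * f x * (ennreal (norm (G x)) * indicator regular x) \<partial>lborel) = c * (\<integral>\<^sup>+x. f x * (ennreal (norm (G x)) * indicator regular x) \<partial>lborel)"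
      by (simp only: mult.assoc) (rule nn_integral_cmult, measurable)
    ultimately show ?case using upper_integral_le_cmult[OF mult.IH, of c] by simp
  next
    case (add f g)
    then have [measurable]: "f \<in> borel_measurable M" "f \<in> borel_measurable lborel"
      "g \<in> borel_measurable M" "g \<in> borel_measurable lborel" by (simp_all add: meas)
    have "(\<integral>\<^sup>+x. (g x + f x) * indicator {x \<in> regular. u x = t} x \<partial>M)
       = (\<integral>\<^sup>+x. g x * indicator {x \<in> regular. u x = t} x \<partial>M) + (\<integral>\<^sup>+x. f x * indicator {x \<in> regular. u x = t} x \<partial>M)" for t
      by (simp only: distrib_right) (rule nn_integral_add, measurable)
    moreover have "(\<integral>\<^sup>+x. (g x + f x) * (ennreal (norm (G x)) * indicator regular x) \<partial>lborel)
       = (\<integral>\<^sup>+x. g x * (ennreal (norm (G x)) * indicator regular x) \<partial>lborel) + (\<integral>\<^sup>+x. f x * (ennreal (norm (G x)) * indicator regular x) \<partial>lborel)"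
      by (simp only: distrib_right) (rule nn_integral_add, measurable)
    ultimately show ?case using upper_integral_le_add[OF add.IH(2,1)] by simp
  next
    case (seq U)
    then have [measurable]: "U i \<in> borel_measurable M" "U i \<in> borel_measurable lborel" for i by (simp_all add: meas)
    have inc: "incseq (\<lambda>i x. U i x * w x)" for w :: "'a \<Rightarrow> ennreal"
      using \<open>incseq U\<close> by (auto simp: incseq_def le_fun_def intro!: mult_right_mono)
    show ?case
    proof (rule upper_integral_le_liminf[OF seq.IH])
      fix t
      have "(\<integral>\<^sup>+x. (SUP i. U i) x * indicator {x \<in> regular. u x = t} x \<partial>M)
         = (\<integral>\<^sup>+x. (SUP i. U i x * indicator {x \<in> regular. u x = t} x) \<partial>M)"
        by (simp add: SUP_mult_right_ennreal image_comp)
      also have "\<dots> = (SUP i. \<integral>\<^sup>+x. U i x * indicator {x \<in> regular. u x = t} x \<partial>M)"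
        by (rule nn_integral_monotone_convergence_SUP[OF inc]) measurable
      also have "\<dots> \<le> liminf (\<lambda>i. \<integral>\<^sup>+x. U i x * indicator {x \<in> regular. u x = t} x \<partial>M)"
      proof -
        have "incseq (\<lambda>i. \<integral>\<^sup>+x. U i x * indicator {x \<in> regular. u x = t} x \<partial>M)"
          using inc by (auto simp: incseq_def le_fun_def intro!: nn_integral_mono)
        from lim_imp_Liminf[OF sequentially_bot LIMSEQ_SUP[OF this]] show ?thesis by simp
      qed
      finally show "(\<integral>\<^sup>+x. (SUP i. U i) x * indicator {x \<in> regular. u x = t} x \<partial>M)
        \<le> liminf (\<lambda>i. \<integral>\<^sup>+x. U i x * indicator {x \<in> regular. u x = t} x \<partial>M)" .
    next
      have "U i x \<le> (SUP i. U i) x" for i x unfolding SUP_apply by (rule SUP_upper) simp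
      then show "liminf (\<lambda>i. \<integral>\<^sup>+x. U i x * (ennreal (norm (G x)) * indicator regular x) \<partial>lborel)
         \<le> (\<integral>\<^sup>+x. (SUP i. U i) x * (ennreal (norm (G x)) * indicator regular x) \<partial>lborel)"
        by (intro Liminf_le always_eventually allI nn_integral_mono mult_right_mono) auto
      qed
qed
qed

end

section \<open>The weak gradient of a continuously differentiable function\<close>

lemma power_div_fact_le_exp:
  fixes x :: real
  assumes "x \<ge> 0"
  shows "x ^ n / fact n \<le> exp x"
proof (rule sums_le)
  show "(\<lambda>m. if m = n then x ^ m / fact m else 0) sums (x ^ n / fact n)" by (rule sums_single)
  show "(\<lambda>m. x ^ m /\<^sub>R fact m) sums exp x" by (rule exp_converges)
  show "(if m = n then x ^ m / fact m else 0) \<le> x ^ m /\<^sub>R fact m" for m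
    using assms by (simp add: divide_inverse mult.commute)
qed

text \<open>The powers in the denominator make the family closed under differentiation up to linear
  combinations: it contains the terms of all derivatives of the classical function
  \<open>exp (- 1 / s)\<close>.\<close>

definition flat :: "nat \<Rightarrow> real \<Rightarrow> real" where
  "flat m s = (if s \<le> 0 then 0 else exp (- 1 / s) / s ^ m)"

lemma flat_nonneg: "flat m s \<ge> 0"
  by (simp add: flat_def)

text \<open>One term of the exponential series at \<open>1 / s\<close>. Linear decay at 0 is enough,
  since dividing by \<open>s\<close> only raises the index \<open>m\<close>.\<close>

lemma flat_bound: "\<bar>flat m s\<bar> \<le> fact (Suc m) * \<bar>s\<bar>"
proof (cases "s \<le> 0")
  case False
  then have s: "s > 0" by simp
  have "(1 / s) ^ Suc m / fact (Suc m) \<le> exp (1 / s)"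
    using s by (intro power_div_fact_le_exp) simp
  then have "exp (- 1 / s) / s ^ m \<le> fact (Suc m) * s"
    using s by (simp add: exp_minus field_simps del: fact_Suc)
  then show ?thesis using s by (simp add: flat_def)
next
  case True
  then have "flat m s = 0" by (simp add: flat_def)
  then show ?thesis by (simp only: abs_zero) (intro mult_nonneg_nonneg, auto)
qed

text \<open>Only \<open>s = 0\<close> is delicate: the difference quotient of \<open>flat m\<close>
  there is \<open>flat (Suc m)\<close>, which tends to 0 by \<open>flat_bound\<close>.\<close>

lemma flat_has_derivative:
  "(flat m has_real_derivative (flat (m + 2) s - real m * flat (Suc m) s)) (at s)"
proof -
  consider "s < 0" | "s = 0" | "s > 0" by linarith
  then show ?thesis
  proof cases
    case 1
    have "(flat m has_real_derivative 0) (at s)"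
      by (rule has_field_derivative_transform_within_open[of "\<lambda>_. 0" _ _ "{..<0}"])
         (use 1 in \<open>auto simp: flat_def\<close>)
    then show ?thesis using 1 by (simp add: flat_def)
  next
    case 2
    have "(\<lambda>h. flat m h / h) \<midarrow>0\<rightarrow> 0"
    proof (rule Lim_null_comparison)
      show "\<forall>\<^sub>F h in at 0. norm (flat m h / h) \<le> fact (Suc (Suc m)) * \<bar>h\<bar>"
      proof (intro always_eventually allI)
        fix h :: real
        have "flat m h / h = flat (Suc m) h" by (simp add: flat_def)
        then show "norm (flat m h / h) \<le> fact (Suc (Suc m)) * \<bar>h\<bar>" using flat_bound[of "Suc m" h] by simp
      qed
      show "(\<lambda>h::real. fact (Suc (Suc m)) * \<bar>h\<bar>) \<midarrow>0\<rightarrow> 0"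
        by (rule tendsto_eq_intros refl | simp)+
    qed
    then have "(flat m has_real_derivative 0) (at 0)"
      by (simp add: DERIV_def flat_def [of m 0])
    then show ?thesis using 2 by (simp add: flat_def)
  next
    case 3
    have "((\<lambda>s. exp (- 1 / s) / s ^ m) has_real_derivative
        (exp (-1/s) / s ^ (m + 2) - real m * (exp (-1/s) / s ^ Suc m))) (at s)"
    proof -
      have "((\<lambda>s. exp (- 1 / s) * inverse (s ^ m)) has_real_derivative
        (exp (-1/s) * (1 / s^2)) * inverse (s ^ m) + exp (-1/s) * (- (real m * s ^ (m - 1)) / (s ^ m)\<^sup>2)) (at s)"
        using 3 by (auto intro!: derivative_eq_intros simp: power2_eq_square field_simps)
      moreover have "exp (-1/s) * (- (real m * s ^ (m - 1)) / (s ^ m)\<^sup>2) = - (real m * (exp (-1/s) / s ^ Suc m))"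
        using 3 by (cases m) (simp_all add: power2_eq_square)
      moreover have "(exp (-1/s) * (1 / s^2)) * inverse (s ^ m) = exp (-1/s) / s ^ (m + 2)"
        by (simp add: divide_inverse power_add power2_eq_square mult_ac)
      ultimately have "((\<lambda>s. exp (- 1 / s) * inverse (s ^ m)) has_real_derivative
          exp (-1/s) / s ^ (m + 2) + - (real m * (exp (-1/s) / s ^ Suc m))) (at s)"
        by (simp only:)
      then show ?thesis by (simp only: divide_inverse diff_conv_add_uminus)
    qed
    then have "(flat m has_real_derivative
        (exp (-1/s) / s ^ (m + 2) - real m * (exp (-1/s) / s ^ Suc m))) (at s)"
      by (rule has_field_derivative_transform_within_open[of _ _ _ "{0<..}"])
         (use 3 in \<open>auto simp: flat_def\<close>)
    then show ?thesis using 3 by (simp add: flat_def)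
  qed
qed

text \<open>A class of functions closed under all directional derivatives. Membership therefore
  gives every \<open>Ck\<close> at once, without formulas for higher derivatives.\<close>

inductive_set flat_algebra :: "('a::euclidean_space \<Rightarrow> real) set" where
  const: "(\<lambda>x. c) \<in> flat_algebra"
| flat: "(\<lambda>x. flat m (v \<bullet> x + d)) \<in> flat_algebra"
| add: "f \<in> flat_algebra \<Longrightarrow> g \<in> flat_algebra \<Longrightarrow> (\<lambda>x. f x + g x) \<in> flat_algebra"
| mult: "f \<in> flat_algebra \<Longrightarrow> g \<in> flat_algebra \<Longrightarrow> (\<lambda>x. f x * g x) \<in> flat_algebra"

lemma flat_algebra_has_derivative:
  assumes "f \<in> flat_algebra"
  shows "\<exists>D. (\<forall>x. (f has_derivative D x) (at x)) \<and> (\<forall>i. (\<lambda>x. D x i) \<in> flat_algebra)"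
  using assms
proof induction
  case (const c)
  show ?case
    by (rule exI[of _ "\<lambda>x h. 0"]) (auto intro: flat_algebra.const)
next
  case (flat m v d)
  let ?D = "\<lambda>x h. (flat (m + 2) (v \<bullet> x + d) + (- real m) * flat (Suc m) (v \<bullet> x + d)) * (v \<bullet> h)"
  have "((\<lambda>x. flat m (v \<bullet> x + d)) has_derivative ?D x) (at x)" for x
  proof -
    have "((\<lambda>x. v \<bullet> x + d) has_derivative (\<lambda>h. v \<bullet> h)) (at x)"
      by (auto intro!: derivative_eq_intros)
    from has_derivative_compose[OF this flat_has_derivative[of m "v \<bullet> x + d", unfolded has_field_derivative_def]]
    show ?thesis by simp
  qed
  moreover have "(\<lambda>x. ?D x i) \<in> flat_algebra" for i
    by (intro flat_algebra.intros)
  ultimately show ?case by (intro exI[of _ ?D]) auto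
next
  case (add f g)
  then obtain D E where "\<And>x. (f has_derivative D x) (at x)" "\<And>i. (\<lambda>x. D x i) \<in> flat_algebra"
    "\<And>x. (g has_derivative E x) (at x)" "\<And>i. (\<lambda>x. E x i) \<in> flat_algebra" by blast
  then show ?case
    by (intro exI[of _ "\<lambda>x h. D x h + E x h"]) (auto intro!: derivative_intros flat_algebra.intros)
next
  case (mult f g)
  then obtain D E where "\<And>x. (f has_derivative D x) (at x)" "\<And>i. (\<lambda>x. D x i) \<in> flat_algebra"
    "\<And>x. (g has_derivative E x) (at x)" "\<And>i. (\<lambda>x. E x i) \<in> flat_algebra" by blast
  with mult show ?case
    by (intro exI[of _ "\<lambda>x h. f x * E x h + D x h * g x"]) (auto intro!: derivative_intros flat_algebra.intros)
qed

lemma flat_algebra_Ck: "f \<in> flat_algebra \<Longrightarrow> f \<in> Ck k"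
proof (induction k arbitrary: f)
  case 0
  obtain D where "\<And>x. (f has_derivative D x) (at x)" using flat_algebra_has_derivative[OF 0] by blast
  then show ?case by (auto intro!: continuous_at_imp_continuous_on has_derivative_continuous)
next
  case (Suc k)
  obtain D where D: "\<And>x. (f has_derivative D x) (at x)" "\<And>i. (\<lambda>x. D x i) \<in> flat_algebra"
    using flat_algebra_has_derivative[OF Suc.prems] by blast
  have "frechet_derivative f (at x) = D x" for x using frechet_derivative_at[OF D(1)] by simp
  with D Suc.IH show ?case by (auto simp: differentiable_def)
qed

lemma flat_algebra_prod:
  "finite I \<Longrightarrow> (\<And>i. i \<in> I \<Longrightarrow> f i \<in> flat_algebra) \<Longrightarrow> (\<lambda>x. \<Prod>i\<in>I. f i x) \<in> flat_algebra"
  by (induction I rule: finite_induct) (auto intro: flat_algebra.intros)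

text \<open>The factor \<open>k\<close> sharpens the transition at the faces:
  \<open>flat 0 (k * s)\<close> tends to 1 for positive \<open>s\<close>. For \<open>k = 0\<close>
  the bump vanishes, so limits are taken along \<open>Suc k\<close>.\<close>

definition box_bump :: "nat \<Rightarrow> 'a::euclidean_space \<Rightarrow> 'a \<Rightarrow> 'a \<Rightarrow> real" where
  "box_bump k a b x = (\<Prod>i\<in>Basis. flat 0 (real k * (x \<bullet> i - a \<bullet> i)) * flat 0 (real k * (b \<bullet> i - x \<bullet> i)))"

lemma box_bump_flat_algebra: "box_bump k a b \<in> flat_algebra"
proof -
  have "(\<lambda>x. \<Prod>i\<in>Basis. flat 0 ((real k *\<^sub>R i) \<bullet> x + - real k * (a \<bullet> i)) * flat 0 ((- real k *\<^sub>R i) \<bullet> x + real k * (b \<bullet> i))) \<in> flat_algebra"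
    by (intro flat_algebra_prod flat_algebra.intros) auto
  moreover have "box_bump k a b = (\<lambda>x. \<Prod>i\<in>Basis. flat 0 ((real k *\<^sub>R i) \<bullet> x + - real k * (a \<bullet> i)) * flat 0 ((- real k *\<^sub>R i) \<bullet> x + real k * (b \<bullet> i)))"
    unfolding box_bump_def by (intro ext prod.cong refl arg_cong2[of _ _ _ _ "(*)"] arg_cong[of _ _ "flat 0"]) (auto simp: inner_commute algebra_simps)
  ultimately show ?thesis by simp
qed

lemma flat_0_le_1: "flat 0 s \<le> 1"
  by (simp add: flat_def)

lemma box_bump_bounds: "0 \<le> box_bump k a b x" "box_bump k a b x \<le> 1"
  unfolding box_bump_def
  by (intro prod_nonneg prod_le_1 ballI conjI mult_nonneg_nonneg flat_nonneg mult_le_one flat_0_le_1)+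

lemma box_bump_eq_0:
  assumes "x \<notin> box a b"
  shows "box_bump k a b x = 0"
proof -
  obtain i where i: "i \<in> Basis" "x \<bullet> i \<le> a \<bullet> i \<or> b \<bullet> i \<le> x \<bullet> i"
    using assms by (force simp: mem_box)
  then have "flat 0 (real k * (x \<bullet> i - a \<bullet> i)) * flat 0 (real k * (b \<bullet> i - x \<bullet> i)) = 0"
    by (auto simp: flat_def mult_le_0_iff)
  then show ?thesis unfolding box_bump_def using i(1) by (intro prod_zero) auto
qed

lemma box_bump_tendsto: "(\<lambda>k. box_bump (Suc k) a b x) \<longlonglongrightarrow> indicator (box a b) x"
proof (cases "x \<in> box a b")
  case True
  have "(\<lambda>k. flat 0 (real (Suc k) * s)) \<longlonglongrightarrow> 1" if "s > 0" for s
  proof -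
    have "(\<lambda>k. exp (- (inverse (real (Suc k)) / s))) \<longlonglongrightarrow> exp (- (0 / s))"
      by (intro tendsto_intros LIMSEQ_inverse_real_of_nat) (use that in auto)
    moreover have "flat 0 (real (Suc k) * s) = exp (- (inverse (real (Suc k)) / s))" for k
      using that by (simp add: flat_def field_simps mult_le_0_iff del: of_nat_Suc)
    ultimately show ?thesis by simp
  qed
  then have "(\<lambda>k. box_bump (Suc k) a b x) \<longlonglongrightarrow> (\<Prod>i\<in>(Basis::'a set). 1 * 1)"
    unfolding box_bump_def using True by (intro tendsto_prod tendsto_mult) (auto simp: mem_box)
  then show ?thesis using True by simp
qed (simp add: box_bump_eq_0)

lemma test_fun_box_bump:
  assumes "cbox a b \<subseteq> \<Omega>"
  shows "test_fun \<Omega> (box_bump k a b)"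
proof -
  have "{x. box_bump k a b x \<noteq> 0} \<subseteq> cbox a b" using box_bump_eq_0 box_subset_cbox by blast
  then have "closure {x. box_bump k a b x \<noteq> 0} \<subseteq> cbox a b" by (intro closure_minimal) auto
  moreover from this have "compact (closure {x. box_bump k a b x \<noteq> 0})"
    by (metis closed_closure compact_cbox compact_Int_closed inf.absorb2)
  ultimately show ?thesis
    using assms flat_algebra_Ck[OF box_bump_flat_algebra] by (auto simp: test_fun_def)
qed

section \<open>Integration by parts and identification of the gradients\<close>

text \<open>Difference quotients integrate to 0 by translation invariance and converge to the
  derivative. They are dominated: bounded through the mean value theorem, and supported in the box
  enlarged by 1 because the increments are at most 1.\<close>

lemma integral_directional_derivative_eq_0:
  fixes w :: "'a::euclidean_space \<Rightarrow> real"
  assumes deriv: "\<And>x. (w has_derivative W x) (at x)"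
    and cont: "continuous_on UNIV (\<lambda>x. W x i)"
    and supp: "\<And>x. x \<notin> cbox a b \<Longrightarrow> w x = 0" "\<And>x. x \<notin> cbox a b \<Longrightarrow> W x i = 0"
    and i: "i \<in> Basis"
  shows "(LINT x|lborel. W x i) = 0"
proof -
  have contw: "continuous_on UNIV w"
    using deriv by (intro continuous_at_imp_continuous_on ballI has_derivative_continuous)
  obtain M where M: "\<And>x. \<bar>W x i\<bar> \<le> M" "M \<ge> 0"
  proof -
    have "compact ((\<lambda>x. W x i) ` cbox a b)"
      by (intro compact_continuous_image continuous_on_subset[OF cont]) auto
    then obtain M where "\<And>x. x \<in> cbox a b \<Longrightarrow> \<bar>W x i\<bar> \<le> M"
      using compact_imp_bounded bounded_iff by (metis (no_types, lifting) imageI real_norm_def)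
    then have "\<bar>W x i\<bar> \<le> max M 0" for x using supp(2)[of x] by (cases "x \<in> cbox a b") force+
    then show ?thesis using that[of "max M 0"] by simp
  qed
  have mw [measurable]: "w \<in> borel_measurable borel" using contw by (rule borel_measurable_continuous_onI)
  have intw: "integrable lborel w"
  proof -
    have "integrable lborel (\<lambda>x. indicator (cbox a b) x *\<^sub>R w x)"
      by (rule borel_integrable_compact) (auto intro: continuous_on_subset[OF contw])
    also have "(\<lambda>x. indicator (cbox a b) x *\<^sub>R w x) = w"
    proof
      show "indicator (cbox a b) x *\<^sub>R w x = w x" for x using supp(1)[of x] by (cases "x \<in> cbox a b") auto
    qed
    finally show ?thesis .
  qed
  define h where "h = (\<lambda>k. inverse (real (Suc k)))"
  have h: "0 < h k" "h k \<le> 1" "h k \<noteq> 0" for k by (auto simp: h_def inverse_le_1_iff)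
  define q where "q = (\<lambda>k x. (w (x + h k *\<^sub>R i) - w x) / h k)"
  have shift: "integrable lborel (\<lambda>x. w (x + c))" "(LINT x|lborel. w (x + c)) = (LINT x|lborel. w x)" for c
  proof -
    have "integrable (distr lborel borel ((+) c)) w" using intw by (simp add: lborel_distr_plus)
    then show "integrable lborel (\<lambda>x. w (x + c))"
      by (subst (asm) integrable_distr_eq) (auto simp: add.commute)
    have "(LINT x|lborel. w x) = (LINT x|distr lborel borel ((+) c). w x)" by (simp add: lborel_distr_plus)
    also have "\<dots> = (LINT x|lborel. w (c + x))" by (rule integral_distr) auto
    finally show "(LINT x|lborel. w (x + c)) = (LINT x|lborel. w x)" by (simp add: add.commute)
  qed
  have q0: "(LINT x|lborel. q k x) = 0" for k
    using shift[of "h k *\<^sub>R i"] intw by (simp add: q_def)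
  have path: "((\<lambda>s. w (x + s *\<^sub>R i)) has_real_derivative W (x + s *\<^sub>R i) i) (at s)" for x s
  proof -
    have "((\<lambda>s. x + s *\<^sub>R i) has_derivative (\<lambda>d. d *\<^sub>R i)) (at s)" by (auto intro!: derivative_eq_intros)
    from has_derivative_compose[OF this deriv]
    have "((\<lambda>s. w (x + s *\<^sub>R i)) has_derivative (\<lambda>d. W (x + s *\<^sub>R i) (d *\<^sub>R i))) (at s)" .
    then show ?thesis
      using linear_cmul[OF has_derivative_linear[OF deriv]]
      by (simp add: has_field_derivative_def mult.commute[of _ "W _ i"])
  qed
  have q_bound: "\<bar>q k x\<bar> \<le> M" for k x
  proof -
    obtain s where "0 < s" "s < h k" "w (x + h k *\<^sub>R i) - w (x + 0 *\<^sub>R i) = (h k - 0) * W (x + s *\<^sub>R i) i"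
      using MVT2[OF h(1)[of k], of "\<lambda>s. w (x + s *\<^sub>R i)" "\<lambda>s. W (x + s *\<^sub>R i) i"] path by blast
    then have "q k x = W (x + s *\<^sub>R i) i" using h[of k] by (simp add: q_def)
    then show ?thesis using M(1) by simp
  qed
  have q_supp: "q k x = 0" if x: "x \<notin> cbox (a - One) (b + One)" for k x
  proof -
    obtain j where j: "j \<in> Basis" "x \<bullet> j < a \<bullet> j - 1 \<or> b \<bullet> j + 1 < x \<bullet> j"
      using x by (force simp: mem_box inner_diff_left inner_add_left)
    have "0 \<le> h k * (i \<bullet> j)" "h k * (i \<bullet> j) \<le> 1" using h[of k] i j(1) by (auto simp: inner_Basis)
    then have "x \<notin> cbox a b" "x + h k *\<^sub>R i \<notin> cbox a b"
      using j by (force simp: mem_box inner_add_left)+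
    then show ?thesis using supp(1) by (simp add: q_def)
  qed
  have "(\<lambda>k. LINT x|lborel. q k x) \<longlonglongrightarrow> (LINT x|lborel. W x i)"
  proof (rule integral_dominated_convergence[where w = "\<lambda>x. M * indicator (cbox (a - One) (b + One)) x"])
    show "(\<lambda>x. W x i) \<in> borel_measurable lborel"
      using borel_measurable_continuous_onI[OF cont] by simp
    show "q k \<in> borel_measurable lborel" for k unfolding q_def by measurable
    show "integrable lborel (\<lambda>x. M * indicator (cbox (a - One) (b + One)) x)"
      by (intro integrable_mult_right integrable_real_indicator) (simp_all add: emeasure_bounded_finite[OF bounded_cbox, unfolded infinity_ennreal_def])
    show "AE x in lborel. norm (q k x) \<le> M * indicator (cbox (a - One) (b + One)) x" for k
      using q_bound q_supp by (intro AE_I2) (auto simp: indicator_def)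
    show "AE x in lborel. (\<lambda>k. q k x) \<longlonglongrightarrow> W x i"
    proof (intro AE_I2)
      fix x
      have "(\<lambda>d. (w (x + d *\<^sub>R i) - w x) / d) \<midarrow>0\<rightarrow> W x i"
        using path[of x 0] by (simp add: DERIV_def)
      moreover have "filterlim h (at 0) sequentially"
        by (rule filterlim_atI) (use h(3) LIMSEQ_inverse_real_of_nat in \<open>auto simp: h_def\<close>)
      ultimately show "(\<lambda>k. q k x) \<longlonglongrightarrow> W x i"
        unfolding q_def by (rule filterlim_compose)
    qed
  qed
  then show ?thesis using q0 by (simp add: LIMSEQ_const_iff)
qed

text \<open>The positive and negative parts are densities of measures that agree on boxes, an
  intersection-stable generator; hence the measures agree, hence the densities. Two equal parts of
  one function vanish.\<close>

lemma AE_zero_if_box_integrals_zero: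
  fixes f :: "'a::euclidean_space \<Rightarrow> real"
  assumes f: "integrable lebesgue f"
    and zero: "\<And>a b. (LINT x:box a b|lebesgue. f x) = 0"
  shows "AE x in lebesgue. f x = 0"
proof -
  \<comment> \<open>A Borel version is needed because the generator argument compares measures on
    the Borel sets.\<close>
  obtain g where g [measurable]: "g \<in> borel_measurable lborel" and fg: "AE x in lborel. f x = g x"
    using completion_ex_borel_measurable_real[of f lborel] f by auto
  have fg': "AE x in lebesgue. f x = g x" using fg by (rule AE_completion)
  have gl: "g \<in> borel_measurable lebesgue" by (rule measurable_completion) (rule g)
  have ig: "integrable lborel g"
  proof -
    have "integrable lebesgue g" using f fg' gl by (subst integrable_cong_AE[of _ _ f]) (auto elim: AE_mp)
    then show ?thesis by (simp add: integrable_completion)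
  qed
  have z: "(LINT x|lborel. indicator (box a b) x * g x) = 0" for a b
  proof -
    have "(LINT x|lborel. indicator (box a b) x * g x) = (LINT x|lebesgue. indicator (box a b) x * g x)"
      by (rule integral_completion[symmetric]) measurable
    also have "\<dots> = (LINT x|lebesgue. indicator (box a b) x * f x)"
      using fg' f gl by (intro integral_cong_AE) (auto intro!: borel_measurable_times borel_measurable_indicator)
    finally show ?thesis using zero[of a b] by (simp add: set_lebesgue_integral_def)
  qed
  define P where "P = (\<lambda>x. ennreal (g x))"
  define N where "N = (\<lambda>x. ennreal (- g x))"
  have [measurable]: "P \<in> borel_measurable lborel" "N \<in> borel_measurable lborel"
    unfolding P_def N_def by measurable
  have eq: "(\<integral>\<^sup>+x. P x * indicator (box a b) x \<partial>lborel) = (\<integral>\<^sup>+x. N x * indicator (box a b) x \<partial>lborel)"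
    and fin: "(\<integral>\<^sup>+x. P x * indicator (box a b) x \<partial>lborel) \<noteq> \<infinity>" for a b
  proof -
    have i: "integrable lborel (\<lambda>x. indicator (box a b) x * g x)"
      using integrable_real_mult_indicator[OF _ ig, of "box a b"] by (simp add: mult.commute)
    have p: "(\<lambda>x. ennreal (indicator (box a b) x * g x)) = (\<lambda>x. P x * indicator (box a b) x)"
      "(\<lambda>x. ennreal (- (indicator (box a b) x * g x))) = (\<lambda>x. N x * indicator (box a b) x)"
      by (auto simp: P_def N_def indicator_def)
    note fins = real_integrable_def[THEN iffD1, OF i, unfolded p]
    have "enn2real (\<integral>\<^sup>+x. P x * indicator (box a b) x \<partial>lborel) = enn2real (\<integral>\<^sup>+x. N x * indicator (box a b) x \<partial>lborel)"
      using real_lebesgue_integral_def[OF i] z[of a b] unfolding p by simp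
    then show "(\<integral>\<^sup>+x. P x * indicator (box a b) x \<partial>lborel) = (\<integral>\<^sup>+x. N x * indicator (box a b) x \<partial>lborel)"
      using fins by (metis ennreal_enn2real infinity_ennreal_def less_top)
    show "(\<integral>\<^sup>+x. P x * indicator (box a b) x \<partial>lborel) \<noteq> \<infinity>" using fins by simp
  qed
  have "density lborel P = density lborel N"
  proof (rule measure_eqI_generator_eq)
    let ?E = "range (\<lambda>(a, b). box a b::'a set)"
    show "Int_stable ?E" by (auto simp: Int_stable_def box_Int_box)
    show "?E \<subseteq> Pow UNIV" "sets (density lborel P) = sigma_sets UNIV ?E" "sets (density lborel N) = sigma_sets UNIV ?E"
      by (simp_all add: borel_eq_box)
    let ?A = "\<lambda>n::nat. box (- (real n *\<^sub>R One)) (real n *\<^sub>R One) :: 'a set"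
    show "range ?A \<subseteq> ?E" "(\<Union>i. ?A i) = UNIV" unfolding UN_box_eq_UNIV by auto
    show "emeasure (density lborel P) (?A i) \<noteq> \<infinity>" for i using fin by (simp add: emeasure_density)
    show "emeasure (density lborel P) X = emeasure (density lborel N) X" if "X \<in> ?E" for X
      using that eq by (auto simp: emeasure_density)
  qed
  then have "AE x in lborel. P x = N x" by (intro sigma_finite_measure.density_unique[OF sigma_finite_lborel]) auto
  then have "AE x in lborel. g x = 0"
    by eventually_elim (metis P_def N_def ennreal_eq_0_iff ennreal_inj linear neg_0_le_iff_le neg_le_0_iff_le antisym)
  then have "AE x in lebesgue. g x = 0" by (rule AE_completion)
  with fg' show ?thesis by eventually_elim simp
qed

context C1_function
begin

text \<open>The product of \<open>u\<close> with the bump, extended by 0, is continuously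
  differentiable with compact support in the box, so its directional derivative has integral 0; the
  product rule does the rest.\<close>

lemma box_bump_integration_by_parts:
  assumes ab: "cbox a b \<subseteq> \<Omega>" and i: "i \<in> Basis"
    and int: "set_integrable lebesgue \<Omega> (\<lambda>x. u x * frechet_derivative (box_bump k a b) (at x) i)"
  shows "set_integrable lebesgue \<Omega> (\<lambda>x. (G x \<bullet> i) * box_bump k a b x)"
    "(LINT x:\<Omega>|lebesgue. u x * frechet_derivative (box_bump k a b) (at x) i)
       = - (LINT x:\<Omega>|lebesgue. (G x \<bullet> i) * box_bump k a b x)"
proof -
  define \<psi> where "\<psi> = box_bump k a b"
  obtain D where D: "\<And>x. (\<psi> has_derivative D x) (at x)" "\<And>i. (\<lambda>x. D x i) \<in> flat_algebra"
    using flat_algebra_has_derivative[OF box_bump_flat_algebra] unfolding \<psi>_def by blast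
  have fD: "frechet_derivative \<psi> (at x) = D x" for x using frechet_derivative_at[OF D(1)] by simp
  have \<psi>0: "\<psi> x = 0" if "x \<notin> cbox a b" for x
    using that box_bump_eq_0 box_subset_cbox unfolding \<psi>_def by blast
  have D0: "D x = (\<lambda>_. 0)" if x: "x \<notin> cbox a b" for x
  proof -
    have "(\<psi> has_derivative (\<lambda>_. 0)) (at x)"
      by (rule has_derivative_transform_within_open[of "\<lambda>_. 0" _ _ _ "- cbox a b"]) (use \<psi>0 x in auto)
    then show ?thesis using D(1) has_derivative_unique by blast
  qed
  have cont\<psi>: "continuous_on UNIV \<psi>"
    using D(1) by (intro continuous_at_imp_continuous_on ballI has_derivative_continuous)
  have contD: "continuous_on UNIV (\<lambda>x. D x i)"
    using flat_algebra_Ck[where k = 0, OF D(2)] by simp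
  define w where "w = (\<lambda>x. if x \<in> \<Omega> then u x * \<psi> x else 0)"
  \<comment> \<open>Derivative and continuity are checked separately on \<open>\<Omega>\<close> and
    on the complement of the closed box, two open sets that cover the space.\<close>
  define W where "W = (\<lambda>x h. if x \<in> \<Omega> then u x * D x h + (G x \<bullet> h) * \<psi> x else 0)"
  have out: "open (- cbox a b)" by auto
  have W0: "W x = (\<lambda>h. 0)" if "x \<notin> cbox a b" for x
    using D0[OF that] \<psi>0[OF that] by (auto simp: W_def)
  have deriv: "(w has_derivative W x) (at x)" for x
  proof (cases "x \<in> \<Omega>")
    case True
    have "((\<lambda>x. u x * \<psi> x) has_derivative W x) (at x)"
      using has_derivative_mult[OF has_gradient[OF True] D(1)] True by (simp add: W_def)
    then show ?thesis
      by (rule has_derivative_transform_within_open[OF _ open_domain True]) (simp add: w_def)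
  next
    case False
    then have x: "x \<in> - cbox a b" using ab by auto
    have "(w has_derivative (\<lambda>h. 0)) (at x)"
      by (rule has_derivative_transform_within_open[of "\<lambda>_. 0" _ _ _ "- cbox a b"]) (use \<psi>0 x in \<open>auto simp: w_def\<close>)
    then show ?thesis using W0 x by simp
  qed
  have contW: "continuous_on UNIV (\<lambda>x. W x i)"
  proof -
    have "continuous_on \<Omega> (\<lambda>x. u x * D x i + (G x \<bullet> i) * \<psi> x)"
      by (intro continuous_intros continuous continuous_gradient continuous_on_subset[OF contD] continuous_on_subset[OF cont\<psi>]) auto
    then have "continuous_on \<Omega> (\<lambda>x. W x i)" by (rule continuous_on_eq) (simp add: W_def)
    moreover have "continuous_on (- cbox a b) (\<lambda>x. W x i)"
      by (rule continuous_on_eq[of _ "\<lambda>_. 0"]) (use W0 in auto)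
    ultimately have "continuous_on (\<Omega> \<union> - cbox a b) (\<lambda>x. W x i)"
      using open_domain out by (intro continuous_on_open_Un)
    moreover have "\<Omega> \<union> - cbox a b = UNIV" using ab by auto
    ultimately show ?thesis by simp
  qed
  have mW: "(\<lambda>x. W x i) \<in> borel_measurable lborel"
    using borel_measurable_continuous_onI[OF contW] by simp
  have "integrable lborel (\<lambda>x. indicator (cbox a b) x *\<^sub>R W x i)"
    by (rule borel_integrable_compact) (auto intro: continuous_on_subset[OF contW])
  also have "(\<lambda>x. indicator (cbox a b) x *\<^sub>R W x i) = (\<lambda>x. W x i)"
    using W0 by (force simp: indicator_def)
  finally have iW: "integrable lebesgue (\<lambda>x. W x i)" by (simp add: integrable_completion mW)
  have "(LINT x|lborel. W x i) = 0"
    by (rule integral_directional_derivative_eq_0[OF deriv contW, of a b])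
       (use i \<psi>0 W0 in \<open>auto simp: w_def\<close>)
  then have zW: "(LINT x|lebesgue. W x i) = 0" by (subst integral_completion[OF mW])
  have I1: "integrable lebesgue (\<lambda>x. indicator \<Omega> x *\<^sub>R (u x * D x i))"
    using int unfolding set_integrable_def \<psi>_def[symmetric] fD .
  have split: "indicator \<Omega> x *\<^sub>R ((G x \<bullet> i) * \<psi> x) = W x i - indicator \<Omega> x *\<^sub>R (u x * D x i)" for x
    by (auto simp: W_def indicator_def)
  show "set_integrable lebesgue \<Omega> (\<lambda>x. (G x \<bullet> i) * box_bump k a b x)"
    unfolding set_integrable_def \<psi>_def[symmetric] split by (intro Bochner_Integration.integrable_diff iW I1)
  have "(LINT x:\<Omega>|lebesgue. (G x \<bullet> i) * \<psi> x) = (LINT x|lebesgue. W x i) - (LINT x:\<Omega>|lebesgue. u x * D x i)"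
    unfolding set_lebesgue_integral_def split by (intro Bochner_Integration.integral_diff iW I1)
  then show "(LINT x:\<Omega>|lebesgue. u x * frechet_derivative (box_bump k a b) (at x) i)
       = - (LINT x:\<Omega>|lebesgue. (G x \<bullet> i) * box_bump k a b x)"
    unfolding \<psi>_def[symmetric] fD using zW by simp
qed

text \<open>Both gradients satisfy the same integration by parts against bumps. As the bumps
  approach the indicator of a box, the integral of \<open>Du - G\<close> over every box with closure
  in \<open>\<Omega>\<close> vanishes, so the difference is 0 almost everywhere.\<close>

lemma weak_grad_eq_gradient:
  assumes weak: "weak_grad \<Omega> u Du" and meas: "set_borel_measurable lebesgue \<Omega> Du"
    and int: "set_integrable lebesgue \<Omega> (\<lambda>x. norm (Du x) powr p)" and p: "p \<ge> 1"
  shows "AE x in lebesgue. x \<in> \<Omega> \<longrightarrow> Du x = G x"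
proof -
  define f where "f = (\<lambda>i a b x. indicator (box a b) x * ((Du x - G x) \<bullet> i))"
  have fint: "integrable lebesgue (f i a b)" if ab: "cbox a b \<subseteq> \<Omega>" and i: "i \<in> Basis" for i a b
  proof -
    have m: "(\<lambda>x. indicator (box a b) x * (Du x \<bullet> i)) \<in> borel_measurable lebesgue"
    proof -
      have "(\<lambda>x. indicator (box a b) x * ((indicator \<Omega> x *\<^sub>R Du x) \<bullet> i)) \<in> borel_measurable lebesgue"
        using meas unfolding set_borel_measurable_def
        by (intro borel_measurable_times borel_measurable_indicator borel_measurable_inner) auto
      also have "(\<lambda>x. indicator (box a b) x * ((indicator \<Omega> x *\<^sub>R Du x) \<bullet> i)) = (\<lambda>x. indicator (box a b) x * (Du x \<bullet> i))"
        using ab box_subset_cbox[of a b] by (force simp: indicator_def)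
      finally show ?thesis .
    qed
    have I1: "integrable lebesgue (\<lambda>x. indicator (box a b) x * (Du x \<bullet> i))"
    proof (rule Bochner_Integration.integrable_bound[OF _ m])
      \<comment> \<open>A number is at most 1 plus its p-th power, so p-integrability gives
        integrability on the bounded box.\<close>
      show "integrable lebesgue (\<lambda>x. indicator (cbox a b) x + indicator \<Omega> x *\<^sub>R norm (Du x) powr p)"
        using int unfolding set_integrable_def
        by (intro Bochner_Integration.integrable_add integrable_real_indicator) (simp_all add: emeasure_bounded_finite[OF bounded_cbox, unfolded infinity_ennreal_def])
      show "AE x in lebesgue. norm (indicator (box a b) x * (Du x \<bullet> i)) \<le> norm (indicator (cbox a b) x + indicator \<Omega> x *\<^sub>R norm (Du x) powr p)"
      proof (intro AE_I2)
        fix x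
        show "norm (indicator (box a b) x * (Du x \<bullet> i)) \<le> norm (indicator (cbox a b) x + indicator \<Omega> x *\<^sub>R norm (Du x) powr p)"
        proof (cases "x \<in> box a b")
          case True
          then have x: "x \<in> cbox a b" "x \<in> \<Omega>" using ab box_subset_cbox by auto
          have "\<bar>Du x \<bullet> i\<bar> \<le> norm (Du x)" using i by (rule Basis_le_norm)
          also have "\<dots> \<le> 1 + norm (Du x) powr p"
          proof (cases "norm (Du x) \<le> 1")
            case False
            then have "norm (Du x) powr 1 \<le> norm (Du x) powr p" using p by (intro powr_mono) auto
            then show ?thesis using False by simp
          qed (simp add: add_increasing2)
          finally show ?thesis using True x by simp
        qed simp
      qed
    qed
    have I2: "integrable lebesgue (\<lambda>x. indicator (box a b) x * (G x \<bullet> i))"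
    proof -
      have c: "continuous_on (cbox a b) (\<lambda>x. G x \<bullet> i)"
        by (intro continuous_intros continuous_on_subset[OF continuous_gradient ab])
      have "integrable lborel (\<lambda>x. indicator (cbox a b) x *\<^sub>R (G x \<bullet> i))"
        by (rule borel_integrable_compact[OF compact_cbox c])
      from integrable_real_mult_indicator[OF _ this, of "box a b"]
      have "integrable lborel (\<lambda>x. indicator (cbox a b) x *\<^sub>R (G x \<bullet> i) * indicator (box a b) x)" by simp
      also have "(\<lambda>x. indicator (cbox a b) x *\<^sub>R (G x \<bullet> i) * indicator (box a b) x) = (\<lambda>x. indicator (box a b) x * (G x \<bullet> i))"
        using box_subset_cbox[of a b] by (force simp: indicator_def)
      finally show ?thesis by (subst integrable_completion) auto
    qed
    show ?thesis unfolding f_def inner_diff_left right_diff_distrib by (intro Bochner_Integration.integrable_diff I1 I2)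
  qed
  have zero: "(LINT x|lebesgue. f i a b x) = 0" if ab: "cbox a b \<subseteq> \<Omega>" and i: "i \<in> Basis" for i a b
  proof -
    have k0: "(LINT x|lebesgue. f i a b x * box_bump (Suc k) a b x) = 0" for k
    proof -
      define \<psi> where "\<psi> = box_bump (Suc k) a b"
      note W = weak[unfolded weak_grad_def, rule_format, OF conjI[OF test_fun_box_bump[OF ab] i], of "Suc k", folded \<psi>_def]
      note Gp = box_bump_integration_by_parts[OF ab i, of "Suc k", folded \<psi>_def]
      have "(LINT x:\<Omega>|lebesgue. (Du x \<bullet> i) * \<psi> x - (G x \<bullet> i) * \<psi> x) = 0"
        using W Gp by (subst set_integral_diff) auto
      also have "(LINT x:\<Omega>|lebesgue. (Du x \<bullet> i) * \<psi> x - (G x \<bullet> i) * \<psi> x) = (LINT x|lebesgue. f i a b x * \<psi> x)"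
        unfolding set_lebesgue_integral_def
      proof (intro Bochner_Integration.integral_cong refl)
        fix x
        show "indicator \<Omega> x *\<^sub>R ((Du x \<bullet> i) * \<psi> x - (G x \<bullet> i) * \<psi> x) = f i a b x * \<psi> x"
        proof (cases "x \<in> box a b")
          case True
          then have "x \<in> \<Omega>" using ab box_subset_cbox by auto
          with True show ?thesis by (simp add: f_def inner_diff_left algebra_simps)
        qed (simp add: \<psi>_def box_bump_eq_0)
      qed
      finally show ?thesis by (simp add: \<psi>_def)
    qed
    have "(\<lambda>k. LINT x|lebesgue. f i a b x * box_bump (Suc k) a b x) \<longlonglongrightarrow> (LINT x|lebesgue. f i a b x)"
    proof (rule integral_dominated_convergence[where w = "\<lambda>x. \<bar>f i a b x\<bar>"])
      show "f i a b \<in> borel_measurable lebesgue" using fint[OF ab i] by auto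
      show "(\<lambda>x. f i a b x * box_bump (Suc k) a b x) \<in> borel_measurable lebesgue" for k
      proof (intro borel_measurable_times)
        show "f i a b \<in> borel_measurable lebesgue" using fint[OF ab i] by auto
        have "continuous_on UNIV (box_bump (Suc k) a b)" using flat_algebra_Ck[where k = 0, OF box_bump_flat_algebra] by simp
        from borel_measurable_continuous_onI[OF this] show "box_bump (Suc k) a b \<in> borel_measurable lebesgue"
          by (intro measurable_completion) simp
      qed
      show "integrable lebesgue (\<lambda>x. \<bar>f i a b x\<bar>)" using fint[OF ab i] by auto
      show "AE x in lebesgue. norm (f i a b x * box_bump (Suc k) a b x) \<le> \<bar>f i a b x\<bar>" for k
      proof (intro AE_I2)
        fix x
        have "\<bar>box_bump (Suc k) a b x\<bar> \<le> 1" using box_bump_bounds[of "Suc k" a b x] by simp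
        then show "norm (f i a b x * box_bump (Suc k) a b x) \<le> \<bar>f i a b x\<bar>"
          by (simp add: abs_mult mult_left_le)
      qed
      show "AE x in lebesgue. (\<lambda>k. f i a b x * box_bump (Suc k) a b x) \<longlonglongrightarrow> f i a b x"
      proof (intro AE_I2)
        fix x
        have "(\<lambda>k. f i a b x * box_bump (Suc k) a b x) \<longlonglongrightarrow> f i a b x * indicator (box a b) x"
          by (intro tendsto_mult tendsto_const box_bump_tendsto)
        then show "(\<lambda>k. f i a b x * box_bump (Suc k) a b x) \<longlonglongrightarrow> f i a b x"
          by (cases "x \<in> box a b") (simp_all add: f_def)
      qed
    qed
    then show ?thesis using k0 by (simp add: LIMSEQ_const_iff)
  qed
  have ae_box: "AE x in lebesgue. x \<in> box a b \<longrightarrow> Du x = G x" if ab: "cbox a b \<subseteq> \<Omega>" for a b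
  proof -
    have "AE x in lebesgue. f i a b x = 0" if i: "i \<in> Basis" for i
    proof (rule AE_zero_if_box_integrals_zero[OF fint[OF ab i]])
      fix c d
      \<comment> \<open>The intersection of two boxes is again a box, so an arbitrary test box
        reduces to one whose closure stays in \<open>\<Omega>\<close>.\<close>
      define c' where "c' = (\<Sum>i\<in>Basis. max (c \<bullet> i) (a \<bullet> i) *\<^sub>R i :: 'a)"
      define d' where "d' = (\<Sum>i\<in>Basis. min (d \<bullet> i) (b \<bullet> i) *\<^sub>R i :: 'a)"
      have I: "box c d \<inter> box a b = box c' d'" unfolding c'_def d'_def by (rule box_Int_box)
      have eq: "(LINT x:box c d|lebesgue. f i a b x) = (LINT x|lebesgue. f i c' d' x)"
        unfolding set_lebesgue_integral_def f_def I[symmetric] by (simp add: indicator_inter_arith mult.assoc)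
      show "(LINT x:box c d|lebesgue. f i a b x) = 0"
      proof (cases "box c' d' = {}")
        case True then show ?thesis unfolding eq by (simp add: f_def)
      next
        case False
        have "box c' d' \<subseteq> box a b" using I by auto
        then have "cbox c' d' \<subseteq> cbox a b" using False by (metis closure_box closure_mono box_eq_empty(1) bot.extremum_uniqueI)
        then show ?thesis unfolding eq using ab i by (intro zero) auto
      qed
    qed
    then have "AE x in lebesgue. \<forall>i\<in>Basis. f i a b x = 0" by (subst AE_ball_countable) (auto intro: countable_finite)
    then show ?thesis
    proof eventually_elim
      case (elim x)
      show ?case
      proof
        assume x: "x \<in> box a b"
        have "(Du x - G x) \<bullet> i = 0" if "i \<in> Basis" for i using elim that x by (simp add: f_def)
        then have "Du x - G x = 0" by (metis euclidean_all_zero_iff)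
        then show "Du x = G x" by simp
      qed
    qed
  qed
  \<comment> \<open>Countably many boxes suffice to cover \<open>\<Omega>\<close>, so the
    exceptional null sets can be united.\<close>
  define \<B> where "\<B> = {box a b |a b. cbox a b \<subseteq> \<Omega>}"
  obtain \<B>' where B': "\<B>' \<subseteq> \<B>" "countable \<B>'" "\<Union> \<B>' = \<Union> \<B>"
    by (rule Lindelof[of \<B>]) (auto simp: \<B>_def)
  have "\<Omega> \<subseteq> \<Union> \<B>'"
  proof
    fix x assume "x \<in> \<Omega>"
    then obtain a b where "cbox a b \<subseteq> \<Omega>" "x \<in> box a b"
      using open_contains_cbox[OF open_domain] by metis
    then show "x \<in> \<Union> \<B>'" unfolding B'(3) \<B>_def by blast
  qed
  moreover have "AE x in lebesgue. \<forall>B\<in>\<B>'. x \<in> B \<longrightarrow> Du x = G x"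
    using B' ae_box by (subst AE_ball_countable) (auto simp: \<B>_def)
  ultimately show ?thesis by (elim AE_mp) (intro AE_I2, blast)
qed

end

section \<open>Level set estimate\<close>

text \<open>The slope of \<open>s powr q\<close> is below \<open>q\<close> to the left of 1 and
  above it to the right; the mean value theorem turns this into strictness on both sides.\<close>

lemma strict_Bernoulli_powr:
  fixes s q :: real
  assumes s: "s \<ge> 0" "s \<noteq> 1" and q: "q > 1"
  shows "1 + q * (s - 1) < s powr q"
proof -
  have d: "((\<lambda>x. x powr q) has_real_derivative q * x powr (q - 1)) (at x)" if "x > 0" for x
    using has_real_derivative_powr[OF that, of q] by simp
  consider "s = 0" | "0 < s" "s < 1" | "s > 1" using s by linarith
  then show ?thesis
  proof cases
    case 1 then show ?thesis using q by simp
  next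
    case 2
    obtain z where z: "s < z" "z < 1" "1 powr q - s powr q = (1 - s) * (q * z powr (q - 1))"
      using MVT2[OF 2(2), of "\<lambda>x. x powr q" "\<lambda>x. q * x powr (q - 1)"] d 2 by fastforce
    have "z powr (q - 1) < 1 powr (q - 1)" using z 2 q by (intro powr_less_mono2) auto
    then have "(1 - s) * (q * z powr (q - 1)) < (1 - s) * (q * 1)"
      using 2 q by (intro mult_strict_left_mono) auto
    then show ?thesis using z(3) by (simp add: algebra_simps)
  next
    case 3
    obtain z where z: "1 < z" "z < s" "s powr q - 1 powr q = (s - 1) * (q * z powr (q - 1))"
      using MVT2[OF 3, of "\<lambda>x. x powr q" "\<lambda>x. q * x powr (q - 1)"] d 3 by fastforce
    have "1 powr (q - 1) < z powr (q - 1)" using z q by (intro powr_less_mono2) auto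
    then have "(s - 1) * (q * 1) < (s - 1) * (q * z powr (q - 1))"
      using 3 q by (intro mult_strict_left_mono) auto
    then show ?thesis using z(3) by (simp add: algebra_simps)
  qed
qed

text \<open>With \<open>s = B / A powr (p - 1)\<close> and after division by \<open>A powr p\<close>
  the claim reads \<open>p * s < 1 + (p - 1) * s powr q\<close>, which is Bernoulli's inequality
  times \<open>p - 1\<close>, because \<open>(p - 1) * q = p\<close>. The excluded case is
  \<open>s = 1\<close>.\<close>

lemma strict_Young_powr:
  fixes A B p :: real
  assumes "A \<ge> 0" "B \<ge> 0" "p > 1" and ne: "B \<noteq> A powr (p - 1)"
  shows "p * A * B < A powr p + (p - 1) * B powr (p / (p - 1))"
proof (cases "A = 0")
  case True
  then have "B > 0" using assms by auto
  then have "B powr (p / (p - 1)) > 0" by simp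
  then show ?thesis using True assms(3) by simp
next
  case False
  then have A: "A > 0" using assms by simp
  define q where "q = p / (p - 1)"
  have q: "q > 1" "(p - 1) * q = p" using assms(3) by (auto simp: q_def field_simps)
  define s where "s = B / A powr (p - 1)"
  have B: "B = A powr (p - 1) * s" using A by (simp add: s_def)
  have s: "s \<ge> 0" "s \<noteq> 1" using A assms ne by (auto simp: s_def)
  have Bq: "B powr q = A powr p * s powr q"
    using A s unfolding B by (simp add: powr_mult powr_powr q(2))
  have AB: "p * A * B = A powr p * (p * s)"
    using A unfolding B by (simp add: powr_diff)
  have "p * s < 1 + (p - 1) * s powr q"
  proof -
    have "(p - 1) * (1 + q * (s - 1)) < (p - 1) * s powr q"
      using strict_Bernoulli_powr[OF s q(1)] assms(3) by (intro mult_strict_left_mono) auto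
    moreover have "(p - 1) * (1 + q * (s - 1)) = (p - 1) + p * (s - 1)"
      by (simp only: distrib_left mult_1_right mult.assoc[symmetric] q(2))
    ultimately show ?thesis by (simp add: algebra_simps)
  qed
  then have "A powr p * (p * s) < A powr p * (1 + (p - 1) * s powr q)"
    using A by (intro mult_strict_left_mono) auto
  then show ?thesis unfolding AB q_def[symmetric] Bq by (simp add: algebra_simps)
qed

lemma Young_powr:
  fixes A B p :: real
  assumes "A \<ge> 0" "B \<ge> 0" "p > 1"
  shows "p * A * B \<le> A powr p + (p - 1) * B powr (p / (p - 1))"
proof (cases "B = A powr (p - 1)")
  case True
  have "A powr (p - 1) * A = A powr p"
    using assms by (cases "A = 0") (auto simp: powr_diff)
  then have "p * A * B = p * A powr p" unfolding True by (simp add: mult.commute mult.left_commute)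
  moreover have "B powr (p / (p - 1)) = A powr p" using assms unfolding True by (simp add: powr_powr)
  then have "A powr p + (p - 1) * B powr (p / (p - 1)) = p * A powr p"
    by (simp only:) (simp add: algebra_simps)
  ultimately show ?thesis by (simp only: order_refl)
qed (use strict_Young_powr[OF assms] in simp)

section \<open>Weighted layer cake formula\<close>

definition layer_weight :: "real \<Rightarrow> real \<Rightarrow> ennreal" where
  "layer_weight p t = ennreal (p * t powr (p - 1)) * indicator {0<..<1} t"

lemma layer_weight_measurable [measurable]: "layer_weight p \<in> borel_measurable borel"
  unfolding layer_weight_def by measurable

lemma nn_integral_layer_weight:
  assumes p: "p > 1"
  shows "(\<integral>\<^sup>+t. layer_weight p t * indicator {..<s} t \<partial>lborel) = ennreal (min (max s 0) 1 powr p)"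
proof -
  define c where "c = min (max s 0) 1"
  have c: "c \<ge> 0" by (simp add: c_def)
  have "((\<lambda>t. t powr (p - 1)) has_integral (c powr (p - 1 + 1) / (p - 1 + 1))) {0..c}"
    using p c by (intro has_integral_powr_from_0) auto
  then have "((\<lambda>t. p * t powr (p - 1)) has_integral (p * (c powr p / p))) {0..c}"
    by (intro has_integral_mult_right) simp
  then have "((\<lambda>t. p * t powr (p - 1)) has_integral (c powr p)) {0..c}" using p by simp
  from nn_integral_has_integral_lebesgue[OF _ this]
  have "ennreal (c powr p) = (\<integral>\<^sup>+t. ennreal (p * t powr (p - 1) * indicator {0..c} t) \<partial>lborel)"
    using p by (simp add: mult.commute)
  also have "\<dots> = (\<integral>\<^sup>+t. layer_weight p t * indicator {..<s} t \<partial>lborel)"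
  proof (intro nn_integral_cong_AE AE_I[of _ _ "{0, 1, c}"])
    show "{t \<in> space lborel. ennreal (p * t powr (p - 1) * indicator {0..c} t) \<noteq> layer_weight p t * indicator {..<s} t} \<subseteq> {0, 1, c}"
      by (auto simp: layer_weight_def indicator_def c_def min_def max_def split: if_splits)
  qed (auto simp: emeasure_lborel_countable)
  finally show ?thesis by (simp add: c_def)
qed

text \<open>Tonelli for the product of \<open>lborel\<close> with the measure of density
  \<open>f\<close>. Taking the density makes the second factor finite, which matters because the
  Hausdorff measure is not sigma-finite. Since only levels between 0 and 1 are weighted, values of
  \<open>w\<close> outside that range are clipped.\<close>

lemma layer_cake_powr:
  fixes w :: "'b \<Rightarrow> real"
  assumes f: "f \<in> borel_measurable N" and w: "w \<in> borel_measurable N"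
    and fin: "(\<integral>\<^sup>+x. f x \<partial>N) \<noteq> \<infinity>" and p: "p > 1"
  shows "(\<lambda>t. \<integral>\<^sup>+x. f x * indicator {x. t < w x} x \<partial>N) \<in> borel_measurable borel"
    and "(\<integral>\<^sup>+t. layer_weight p t * (\<integral>\<^sup>+x. f x * indicator {x. t < w x} x \<partial>N) \<partial>lborel)
       = (\<integral>\<^sup>+x. f x * ennreal (min (max (w x) 0) 1 powr p) \<partial>N)"
proof -
  note [measurable] = f w
  define D where "D = density N f"
  interpret D: finite_measure D
    by standard (use fin in \<open>simp add: D_def emeasure_density cong: nn_integral_cong\<close>)
  interpret pair_sigma_finite lborel D ..
  have wD [measurable]: "w \<in> borel_measurable D" by (simp add: D_def)
  have sl: "(\<integral>\<^sup>+x. f x * indicator {x. t < w x} x \<partial>N) = (\<integral>\<^sup>+x. indicator {x \<in> space N. t < w x} x \<partial>D)" for t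
    unfolding D_def by (subst nn_integral_density) (auto intro!: nn_integral_cong simp: indicator_def)
  define k :: "real \<times> 'b \<Rightarrow> ennreal" where "k = (\<lambda>z. if fst z < w (snd z) then 1 else 0)"
  have k [measurable]: "k \<in> borel_measurable (lborel \<Otimes>\<^sub>M D)"
    unfolding k_def by measurable
  have sl': "(\<integral>\<^sup>+x. f x * indicator {x. t < w x} x \<partial>N) = (\<integral>\<^sup>+x. k (t, x) \<partial>D)" for t
    unfolding sl by (intro nn_integral_cong) (auto simp: D_def k_def indicator_def)
  have "(\<lambda>t. \<integral>\<^sup>+x. k (t, x) \<partial>D) \<in> borel_measurable lborel"
    by (rule D.borel_measurable_nn_integral_fst[OF k])
  then show m: "(\<lambda>t. \<integral>\<^sup>+x. f x * indicator {x. t < w x} x \<partial>N) \<in> borel_measurable borel"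
    unfolding sl' by simp
  have "(\<integral>\<^sup>+t. layer_weight p t * (\<integral>\<^sup>+x. f x * indicator {x. t < w x} x \<partial>N) \<partial>lborel)
     = (\<integral>\<^sup>+t. \<integral>\<^sup>+x. layer_weight p t * k (t, x) \<partial>D \<partial>lborel)"
    unfolding sl' by (intro nn_integral_cong nn_integral_cmult[symmetric]) measurable
  also have "\<dots> = (\<integral>\<^sup>+x. \<integral>\<^sup>+t. layer_weight p t * k (t, x) \<partial>lborel \<partial>D)"
    by (rule Fubini'[symmetric]) measurable
  also have "\<dots> = (\<integral>\<^sup>+x. ennreal (min (max (w x) 0) 1 powr p) \<partial>D)"
  proof (intro nn_integral_cong)
    fix x
    have "(\<integral>\<^sup>+t. layer_weight p t * k (t, x) \<partial>lborel)
      = (\<integral>\<^sup>+t. layer_weight p t * indicator {..<w x} t \<partial>lborel)"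
      by (intro nn_integral_cong) (auto simp: k_def indicator_def)
    then show "(\<integral>\<^sup>+t. layer_weight p t * k (t, x) \<partial>lborel) = ennreal (min (max (w x) 0) 1 powr p)"
      using nn_integral_layer_weight[OF p] by simp
  qed
  also have "\<dots> = (\<integral>\<^sup>+x. f x * ennreal (min (max (w x) 0) 1 powr p) \<partial>N)"
    unfolding D_def by (rule nn_integral_density) measurable
  finally show "(\<integral>\<^sup>+t. layer_weight p t * (\<integral>\<^sup>+x. f x * indicator {x. t < w x} x \<partial>N) \<partial>lborel)
       = (\<integral>\<^sup>+x. f x * ennreal (min (max (w x) 0) 1 powr p) \<partial>N)" .
qed

section \<open>The Hausdorff measure and its completion\<close>

definition borel_hausdorff :: "real \<Rightarrow> 'a::euclidean_space measure" where
  "borel_hausdorff s = measure_of UNIV (sets borel) (hausdorff_outer s)"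

lemma hausdorff_measure_eq: "hausdorff_measure s = completion (borel_hausdorff s)"
  by (simp add: hausdorff_measure_def borel_hausdorff_def)

lemma sets_borel_hausdorff: "sets (borel_hausdorff s) = sets borel"
  unfolding borel_hausdorff_def using sets.sigma_sets_eq[of borel] by simp

text \<open>\<^const>\<open>measure_of\<close> returns the zero measure unless the given set function is countably additive on the
  \<open>\<sigma>\<close>-algebra, so one nonzero integral certifies that the Hausdorff measure is not this junk value.\<close>

lemma emeasure_borel_hausdorff:
  fixes f :: "'a::euclidean_space \<Rightarrow> real"
  assumes nz: "integral\<^sup>L (hausdorff_measure s) f \<noteq> 0" and E: "E \<in> sets borel"
  shows "emeasure (borel_hausdorff s) E = hausdorff_outer s (E :: 'a set)"
proof (cases "measure_space UNIV (sigma_sets UNIV (sets borel)) (hausdorff_outer s :: 'a set \<Rightarrow> ennreal)")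
  case True
  then show ?thesis using E by (simp add: borel_hausdorff_def emeasure_measure_of_conv)
next
  case False
  then have "emeasure (borel_hausdorff s) (UNIV :: 'a set) = 0"
    by (simp add: borel_hausdorff_def emeasure_measure_of_conv)
  then have "(UNIV :: 'a set) \<in> null_sets (borel_hausdorff s)"
    by (auto simp: sets_borel_hausdorff)
  then have "AE x in borel_hausdorff s. f x = 0" by (rule AE_I') auto
  then have "AE x in hausdorff_measure s. f x = 0" unfolding hausdorff_measure_eq by (rule AE_completion)
  then have "integral\<^sup>L (hausdorff_measure s) f = 0" by (rule integral_eq_zero_AE)
  with nz show ?thesis by simp
qed

lemma ennreal_integral_le_nn_integral:
  fixes f :: "'b \<Rightarrow> real"
  assumes "\<And>x. f x \<ge> 0"
  shows "ennreal (integral\<^sup>L M f) \<le> (\<integral>\<^sup>+x. ennreal (f x) \<partial>M)"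
proof (cases "integrable M f")
  case True
  then show ?thesis using nn_integral_eq_integral[of M f] assms by simp
qed (simp add: not_integrable_integral_eq)

text \<open>A Borel version of \<open>r\<close> differs from it on a null set that may meet level
  sets in positive area. Making the Borel function infinite there leaves the volume integral
  unchanged, so the Borel inequality still applies.\<close>

lemma (in C1_function) coarea_inequality_lebesgue:
  assumes n: "DIM('a) \<ge> 2"
    and M: "sets M = sets borel" "\<And>E. E \<in> sets borel \<Longrightarrow> emeasure M E = hausdorff_outer (real (DIM('a) - 1)) E"
    and r: "r \<in> borel_measurable lebesgue"
  shows "upper_integral_le (\<lambda>t. \<integral>\<^sup>+x. ennreal (r x) * indicator {x \<in> regular. u x = t} x \<partial>completion M)
           (\<integral>\<^sup>+x. ennreal (r x * (norm (G x) * indicator regular x)) \<partial>lebesgue)"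
proof -
  obtain r' where r' [measurable]: "r' \<in> borel_measurable lborel" and ae: "AE x in lborel. r x = r' x"
    using completion_ex_borel_measurable_real[OF r] by blast
  obtain N where N: "N \<in> null_sets lborel" "\<And>x. x \<notin> N \<Longrightarrow> r x = r' x"
    by (rule AE_E3[OF ae]) auto
  have [measurable]: "N \<in> sets borel" using N(1) by auto
  \<comment> \<open>The value \<open>\<infinity>\<close> on the null set \<open>N\<close> dominates whatever \<open>r\<close> does on the slices of \<open>N\<close>.\<close>
  define f where "f = (\<lambda>x. if x \<in> N then top else ennreal (r' x))"
  have f: "f \<in> borel_measurable borel" unfolding f_def using r' by measurable
  have aeN: "AE x in lborel. x \<notin> N" using N(1) by (rule AE_not_in)
  show ?thesis
  proof (rule upper_integral_le_mono[OF coarea_inequality[OF n M f]])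
    fix t
    \<comment> \<open>Slices of \<open>r\<close> need not be measurable, but
      \<open>nn_integral\<close> is a supremum over simple functions from below, hence monotone for
      arbitrary functions.\<close>
    show "(\<integral>\<^sup>+x. ennreal (r x) * indicator {x \<in> regular. u x = t} x \<partial>completion M)
      \<le> (\<integral>\<^sup>+x. f x * indicator {x \<in> regular. u x = t} x \<partial>M)"
      unfolding nn_integral_completion
      using N(2) by (intro nn_integral_mono mult_right_mono) (auto simp: f_def)
  next
    have "(\<integral>\<^sup>+x. f x * (ennreal (norm (G x)) * indicator regular x) \<partial>lborel)
       = (\<integral>\<^sup>+x. ennreal (r x * (norm (G x) * indicator regular x)) \<partial>lborel)"
    proof (rule nn_integral_cong_AE)
      show "AE x in lborel. f x * (ennreal (norm (G x)) * indicator regular x) = ennreal (r x * (norm (G x) * indicator regular x))"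
        using aeN ae by eventually_elim (auto simp: f_def indicator_def ennreal_mult'')
    qed
    then show "(\<integral>\<^sup>+x. f x * (ennreal (norm (G x)) * indicator regular x) \<partial>lborel)
      \<le> (\<integral>\<^sup>+x. ennreal (r x * (norm (G x) * indicator regular x)) \<partial>lebesgue)"
      by (simp add: nn_integral_completion)
  qed
qed

section \<open>Anisotropic energy and the gap in Young's inequality\<close>

lemma anisotropicD:
  assumes "anisotropic p a b F"
  shows "F \<xi> \<ge> 0" "F (t *\<^sub>R \<xi>) = \<bar>t\<bar> * F \<xi>" "F 0 = 0" "F \<xi> \<le> b * norm \<xi>" "b > 0" "F \<in> borel_measurable borel"
proof -
  have F: "convex_on UNIV F" "\<And>\<xi>. F \<xi> \<ge> 0" "\<And>t \<xi>. F (t *\<^sub>R \<xi>) = \<bar>t\<bar> * F \<xi>" "\<And>\<xi>. F \<xi> \<le> b * norm \<xi>" "b > 0"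
    using assms unfolding anisotropic_def by auto
  show "F \<xi> \<ge> 0" "F (t *\<^sub>R \<xi>) = \<bar>t\<bar> * F \<xi>" "F \<xi> \<le> b * norm \<xi>" "b > 0" by (rule F)+
  show "F 0 = 0" using F(3)[of 0 0] by simp
  show "F \<in> borel_measurable borel"
    by (intro borel_measurable_continuous_onI convex_on_continuous F) auto
qed

context C1_function
begin

lemma grad_eq: "x \<in> \<Omega> \<Longrightarrow> grad u x = G x"
proof -
  assume x: "x \<in> \<Omega>"
  have "(u has_derivative (\<lambda>h. grad u x \<bullet> h)) (at x)"
    unfolding grad_def by (rule someI[of "\<lambda>g. (u has_derivative (\<lambda>h. g \<bullet> h)) (at x)", OF has_gradient[OF x]])
  then have "(\<lambda>h. grad u x \<bullet> h) = (\<lambda>h. G x \<bullet> h)" using has_gradient[OF x] has_derivative_unique by blast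
  then show ?thesis by (metis vector_eq_rdot inner_commute)
qed

text \<open>Young's inequality pointwise for \<open>F (G x)\<close> and
  \<open>u x powr (p - 1) * \<phi> x\<close>; the conjugate power of the latter is
  \<open>\<phi> x powr q * u x powr p\<close>. If the integrals were not strictly ordered, the
  nonnegative difference of the two sides would vanish almost everywhere, forcing the excluded
  identity for \<open>\<phi>\<close>.\<close>

lemma young_energy_gap:
  assumes F: "anisotropic p a b F" and p: "p > 1"
    and u_pos: "\<And>x. x \<in> \<Omega> \<Longrightarrow> 0 < u x" and u_le: "\<And>x. x \<in> \<Omega> \<Longrightarrow> u x \<le> 1"
    and intF: "set_integrable lebesgue \<Omega> (\<lambda>x. F (G x) powr p)"
    and \<phi>: "Lp (p / (p - 1)) \<Omega> \<phi>" "\<And>x. x \<in> \<Omega> \<Longrightarrow> 0 \<le> \<phi> x"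
    and ne: "\<not> (AE x in lebesgue. x \<in> \<Omega> \<longrightarrow> \<phi> x = F (grad u x) powr (p - 1) / u x powr (p - 1))"
  shows "set_integrable lebesgue \<Omega> (\<lambda>x. \<phi> x powr (p / (p - 1)) * u x powr p)"
    and "(\<integral>\<^sup>+x. ennreal (indicator \<Omega> x * (p * F (G x) * (u x powr (p - 1) * \<phi> x))) \<partial>lebesgue)
      < ennreal ((LINT x:\<Omega>|lebesgue. F (G x) powr p) + (p - 1) * (LINT x:\<Omega>|lebesgue. \<phi> x powr (p / (p - 1)) * u x powr p))"
proof -
  define q where "q = p / (p - 1)"
  have q: "q > 1" "q * (p - 1) = p" using p by (auto simp: q_def field_simps)
  note Fp = anisotropicD[OF F]
  have Om [measurable]: "\<Omega> \<in> sets borel" using open_domain by simp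
  have u0: "(\<lambda>x. indicator \<Omega> x *\<^sub>R u x) \<in> borel_measurable lebesgue"
    using borel_measurable_continuous_on_indicator[OF Om continuous]
    by (intro measurable_completion) (simp only: measurable_lborel2)
  have G0: "(\<lambda>x. indicator \<Omega> x *\<^sub>R G x) \<in> borel_measurable lebesgue"
    using borel_measurable_continuous_on_indicator[OF Om continuous_gradient]
    by (intro measurable_completion) (simp only: measurable_lborel2)
  have \<phi>0: "(\<lambda>x. indicator \<Omega> x *\<^sub>R \<phi> x) \<in> borel_measurable lebesgue"
    using \<phi>(1) by (simp add: Lp_def set_borel_measurable_def)
  have \<phi>int: "integrable lebesgue (\<lambda>x. indicator \<Omega> x *\<^sub>R (\<phi> x powr q))"
  proof -
    have "integrable lebesgue (\<lambda>x. indicator \<Omega> x *\<^sub>R (\<bar>\<phi> x\<bar> powr q))"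
      using \<phi>(1) by (simp add: Lp_def set_integrable_def q_def)
    also have "(\<lambda>x. indicator \<Omega> x *\<^sub>R (\<bar>\<phi> x\<bar> powr q)) = (\<lambda>x. indicator \<Omega> x *\<^sub>R (\<phi> x powr q))"
      using \<phi>(2) by (auto simp: indicator_def)
    finally show ?thesis .
  qed
  define \<Phi> where "\<Phi> = (\<lambda>x. indicator \<Omega> x *\<^sub>R (\<phi> x powr q * u x powr p))"
  define E where "E = (\<lambda>x. indicator \<Omega> x *\<^sub>R (F (G x) powr p))"
  define A where "A = (\<lambda>x. indicator \<Omega> x * (p * F (G x) * (u x powr (p - 1) * \<phi> x)))"
  have E: "integrable lebesgue E" using intF by (simp add: E_def set_integrable_def)
  have m\<Phi>: "\<Phi> \<in> borel_measurable lebesgue"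
  proof -
    have "(\<lambda>x. (indicator \<Omega> x *\<^sub>R \<phi> x) powr q * (indicator \<Omega> x *\<^sub>R u x) powr p) \<in> borel_measurable lebesgue"
      using u0 \<phi>0 by (intro borel_measurable_times powr_real_measurable borel_measurable_const)
    also have "(\<lambda>x. (indicator \<Omega> x *\<^sub>R \<phi> x) powr q * (indicator \<Omega> x *\<^sub>R u x) powr p) = \<Phi>"
      by (auto simp: \<Phi>_def indicator_def)
    finally show ?thesis .
  qed
  have \<Phi>: "integrable lebesgue \<Phi>"
  proof (rule Bochner_Integration.integrable_bound[OF \<phi>int m\<Phi>], intro AE_I2)
    fix x
    have "u x powr p \<le> 1" if "x \<in> \<Omega>" using u_pos[OF that] u_le[OF that] p by (simp add: powr_le1)
    then show "norm (\<Phi> x) \<le> norm (indicator \<Omega> x *\<^sub>R (\<phi> x powr q))"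
      by (auto simp: \<Phi>_def indicator_def abs_mult intro!: mult_left_le)
  qed
  then show "set_integrable lebesgue \<Omega> (\<lambda>x. \<phi> x powr (p / (p - 1)) * u x powr p)"
    by (simp add: set_integrable_def \<Phi>_def q_def)
  have mA: "A \<in> borel_measurable lebesgue"
  proof -
    have "(\<lambda>x. p * F (indicator \<Omega> x *\<^sub>R G x) * ((indicator \<Omega> x *\<^sub>R u x) powr (p - 1) * (indicator \<Omega> x *\<^sub>R \<phi> x))) \<in> borel_measurable lebesgue"
      using u0 \<phi>0 measurable_compose[OF G0 Fp(6)]
      by (intro borel_measurable_times powr_real_measurable borel_measurable_const)
    also have "(\<lambda>x. p * F (indicator \<Omega> x *\<^sub>R G x) * ((indicator \<Omega> x *\<^sub>R u x) powr (p - 1) * (indicator \<Omega> x *\<^sub>R \<phi> x))) = A"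
      by (auto simp: A_def indicator_def)
    finally show ?thesis .
  qed
  have A0: "A x \<ge> 0" for x
    using Fp(1)[of "G x"] \<phi>(2)[of x] p by (auto simp: A_def indicator_def)
  have B: "(u x powr (p - 1) * \<phi> x) powr q = \<phi> x powr q * u x powr p" if "x \<in> \<Omega>" for x
    using u_pos[OF that] \<phi>(2)[OF that] q(2) by (simp add: powr_mult powr_powr mult.commute)
  have Bn: "u x powr (p - 1) * \<phi> x \<ge> 0" if "x \<in> \<Omega>" for x using \<phi>(2)[OF that] by simp
  have le: "A x \<le> E x + (p - 1) * \<Phi> x" for x
    using Young_powr[OF Fp(1)[of "G x"] Bn p] B unfolding q_def[symmetric]
    by (auto simp: A_def E_def \<Phi>_def indicator_def)
  have less: "A x < E x + (p - 1) * \<Phi> x"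
    if "x \<in> \<Omega>" "\<phi> x \<noteq> F (grad u x) powr (p - 1) / u x powr (p - 1)" for x
  proof -
    have "u x powr (p - 1) * \<phi> x \<noteq> F (G x) powr (p - 1)"
      using that(2) u_pos[OF that(1)] by (auto simp: grad_eq[OF that(1)] field_simps)
    from strict_Young_powr[OF Fp(1)[of "G x"] Bn[OF that(1)] p this]
    show ?thesis using that(1) B[OF that(1)] unfolding q_def[symmetric]
      by (simp add: A_def E_def \<Phi>_def)
  qed
  have R: "integrable lebesgue (\<lambda>x. E x + (p - 1) * \<Phi> x)"
    using E \<Phi> by (intro Bochner_Integration.integrable_add integrable_mult_right)
  have iA: "integrable lebesgue A"
    by (rule Bochner_Integration.integrable_bound[OF R mA]) (use A0 le in \<open>auto intro!: AE_I2 intro: order_trans[OF le abs_ge_self]\<close>)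
  have "integral\<^sup>L lebesgue A < (LINT x|lebesgue. E x + (p - 1) * \<Phi> x)"
  proof (rule ccontr)
    assume "\<not> ?thesis"
    moreover have "(LINT x|lebesgue. (E x + (p - 1) * \<Phi> x) - A x) = (LINT x|lebesgue. E x + (p - 1) * \<Phi> x) - integral\<^sup>L lebesgue A"
      using R iA by (rule Bochner_Integration.integral_diff)
    moreover have "(LINT x|lebesgue. (E x + (p - 1) * \<Phi> x) - A x) \<ge> 0"
      using le by (intro integral_nonneg_AE AE_I2) simp
    ultimately have "(LINT x|lebesgue. (E x + (p - 1) * \<Phi> x) - A x) = 0" by linarith
    then have "AE x in lebesgue. (E x + (p - 1) * \<Phi> x) - A x = 0"
      using le by (subst (asm) integral_nonneg_eq_0_iff_AE) (auto intro!: Bochner_Integration.integrable_diff R iA)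
    then have "AE x in lebesgue. x \<in> \<Omega> \<longrightarrow> \<phi> x = F (grad u x) powr (p - 1) / u x powr (p - 1)"
      by eventually_elim (use less in force)
    with ne show False by contradiction
  qed
  also have "(LINT x|lebesgue. E x + (p - 1) * \<Phi> x) = (LINT x|lebesgue. E x) + (p - 1) * (LINT x|lebesgue. \<Phi> x)"
    using E \<Phi> by (subst Bochner_Integration.integral_add) auto
  finally have less_real: "integral\<^sup>L lebesgue A < (LINT x|lebesgue. E x) + (p - 1) * (LINT x|lebesgue. \<Phi> x)" .
  have "integral\<^sup>L lebesgue A \<ge> 0" using A0 by (intro integral_nonneg_AE AE_I2)
  with less_real have "ennreal (integral\<^sup>L lebesgue A) < ennreal ((LINT x|lebesgue. E x) + (p - 1) * (LINT x|lebesgue. \<Phi> x))"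
    by (intro ennreal_lessI) linarith+
  also have "ennreal (integral\<^sup>L lebesgue A) = (\<integral>\<^sup>+x. ennreal (A x) \<partial>lebesgue)"
    using iA A0 by (intro nn_integral_eq_integral[symmetric]) auto
  finally show "(\<integral>\<^sup>+x. ennreal (indicator \<Omega> x * (p * F (G x) * (u x powr (p - 1) * \<phi> x))) \<partial>lebesgue)
      < ennreal ((LINT x:\<Omega>|lebesgue. F (G x) powr p) + (p - 1) * (LINT x:\<Omega>|lebesgue. \<phi> x powr (p / (p - 1)) * u x powr p))"
    by (simp add: A_def E_def \<Phi>_def set_lebesgue_integral_def q_def)
qed

end

section \<open>Comparison of the integrals over all levels\<close>

theorem theorem6p2:
  fixes F :: "'a::euclidean_space \<Rightarrow> real"
    and p a b \<alpha> :: real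
    and \<Omega> :: "'a set"
    and \<beta> u g \<phi> :: "'a \<Rightarrow> real"
    and Du :: "'a \<Rightarrow> 'a"
  assumes dim: "DIM('a) \<ge> 2"
    and p: "1 < p"
    and F: "anisotropic p a b F"
    and \<Omega>: "open \<Omega>" "bounded \<Omega>" "0 < \<alpha>" "\<alpha> < 1" "C1alpha_boundary \<alpha> \<Omega>"
    and \<beta>: "set_integrable Hn1 (frontier \<Omega>) \<beta>" "\<forall>x\<in>frontier \<Omega>. 0 \<le> \<beta> x"
           "(LINT x:frontier \<Omega>|Hn1. \<beta> x * F (outer_normal \<Omega> x)) > 0"
    and u_reg: "C1alpha_on \<alpha> \<Omega> u"
    and u_pos: "\<forall>x\<in>\<Omega>. 0 < u x"
    and u_sup: "\<forall>x\<in>\<Omega>. u x \<le> 1" "(SUP x\<in>\<Omega>. u x) = 1"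
    and u_min: "admissible p F \<beta> \<Omega> u Du g" "rayleigh p F \<beta> \<Omega> u Du g = ell1 p F \<beta> \<Omega>"
    and \<phi>: "Lp (p / (p - 1)) \<Omega> \<phi>" "\<forall>x\<in>\<Omega>. 0 \<le> \<phi> x"
           "\<not> (AE x in lebesgue. x \<in> \<Omega> \<longrightarrow> \<phi> x = F (grad u x) powr (p - 1) / u x powr (p - 1))"
  shows "\<exists>S. S \<subseteq> {0<..<1} \<and> S \<in> sets lebesgue \<and> emeasure lebesgue S > 0
           \<and> (\<forall>t\<in>S. ell1 p F \<beta> \<Omega> > level_functional p F \<beta> \<Omega> u g \<phi> t)"
proof -
  obtain G where G: "\<forall>x\<in>\<Omega>. (u has_derivative (\<lambda>h. G x \<bullet> h)) (at x)" "continuous_on \<Omega> G"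
    using u_reg unfolding C1alpha_on_def by blast
  interpret C1_function \<Omega> u G by standard (use \<Omega>(1) G in auto)
  note Fp = anisotropicD[OF F]
  define ell where "ell = ell1 p F \<beta> \<Omega>"
  define q where "q = p / (p - 1)"
  have q: "q > 1" "q * (p - 1) = p" using p by (auto simp: q_def field_simps)
  define H where "H = (borel_hausdorff (real (DIM('a) - 1)) :: 'a measure)"
  have Hn1: "Hn1 = completion H" by (simp add: H_def hausdorff_measure_eq)
  define N :: "'a measure" where "N = completion H"
  define \<sigma> where "\<sigma> = (\<lambda>x. indicator (frontier \<Omega>) x * (\<beta> x * F (outer_normal \<Omega> x)))"
  have \<sigma>0: "\<sigma> x \<ge> 0" for x using \<beta>(2) Fp(1) by (auto simp: \<sigma>_def indicator_def)
  \<comment> \<open>Positivity is used twice: a nonzero Bochner integral forces integrability of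
    \<open>\<sigma>\<close>, and it certifies through \<open>emeasure_borel_hausdorff\<close> that
    \<open>H\<close> agrees with the Hausdorff outer measure on Borel sets.\<close>
  have \<sigma>pos: "integral\<^sup>L N \<sigma> > 0"
    using \<beta>(3) unfolding set_lebesgue_integral_def Hn1 by (simp add: \<sigma>_def N_def)
  then have \<sigma>int: "integrable N \<sigma>" using not_integrable_integral_eq by fastforce
  have setsH: "sets H = sets borel" unfolding H_def by (rule sets_borel_hausdorff)
  have \<sigma>nz: "integral\<^sup>L Hn1 \<sigma> \<noteq> 0" unfolding Hn1 N_def[symmetric] using \<sigma>pos by simp
  have emH: "emeasure H E = hausdorff_outer (real (DIM('a) - 1)) E" if "E \<in> sets borel" for E
    unfolding H_def
    by (rule emeasure_borel_hausdorff[OF \<sigma>nz that])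

  have adm: "Lp p \<Omega> u" "set_borel_measurable lebesgue \<Omega> Du"
    "set_integrable lebesgue \<Omega> (\<lambda>x. norm (Du x) powr p)" "weak_grad \<Omega> u Du"
    "set_borel_measurable N (frontier \<Omega>) g"
    "set_integrable N (frontier \<Omega>) (\<lambda>x. \<beta> x * \<bar>g x\<bar> powr p * F (outer_normal \<Omega> x))"
    "\<not> (AE x in lebesgue. x \<in> \<Omega> \<longrightarrow> u x = 0)"
    using u_min(1) unfolding admissible_def sobolev_def is_trace_def Hn1 N_def by blast+
  \<comment> \<open>Links the energy in the Rayleigh quotient, stated with \<open>Du\<close>, to the
    normals of the level sets, stated with the classical gradient.\<close>
  have DuG: "AE x in lebesgue. x \<in> \<Omega> \<longrightarrow> Du x = G x"
    using weak_grad_eq_gradient[OF adm(4,2,3)] p by simp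
  have Om [measurable]: "\<Omega> \<in> sets borel" using \<Omega>(1) by simp
  define u0 where "u0 = (\<lambda>x. indicator \<Omega> x *\<^sub>R u x)"
  have u0m: "u0 \<in> borel_measurable lebesgue"
    using borel_measurable_continuous_on_indicator[OF Om continuous] unfolding u0_def
    by (intro measurable_completion) (simp only: measurable_lborel2)
  have G0m: "(\<lambda>x. indicator \<Omega> x *\<^sub>R G x) \<in> borel_measurable lebesgue"
    using borel_measurable_continuous_on_indicator[OF Om continuous_gradient]
    by (intro measurable_completion) (simp only: measurable_lborel2)
  have Du0m: "(\<lambda>x. indicator \<Omega> x *\<^sub>R Du x) \<in> borel_measurable lebesgue"
    using adm(2) by (simp add: set_borel_measurable_def)
  have \<phi>0m: "(\<lambda>x. indicator \<Omega> x *\<^sub>R \<phi> x) \<in> borel_measurable lebesgue"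
    using \<phi>(1) by (simp add: Lp_def set_borel_measurable_def)
  have FGm: "(\<lambda>x. indicator \<Omega> x *\<^sub>R F (V x) powr p) \<in> borel_measurable lebesgue"
    if "(\<lambda>x. indicator \<Omega> x *\<^sub>R V x) \<in> borel_measurable lebesgue" for V
  proof -
    have "(\<lambda>x. F (indicator \<Omega> x *\<^sub>R V x) powr p) \<in> borel_measurable lebesgue"
      using measurable_compose[OF that Fp(6)] by (intro powr_real_measurable borel_measurable_const)
    also have "(\<lambda>x. F (indicator \<Omega> x *\<^sub>R V x) powr p) = (\<lambda>x. indicator \<Omega> x *\<^sub>R F (V x) powr p)"
      by (auto simp: indicator_def Fp(3))
    finally show ?thesis .
  qed
  have intF: "set_integrable lebesgue \<Omega> (\<lambda>x. F (G x) powr p)"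
    unfolding set_integrable_def
  proof (rule Bochner_Integration.integrable_bound[OF _ FGm[OF G0m]])
    show "integrable lebesgue (\<lambda>x. b powr p * (indicator \<Omega> x *\<^sub>R norm (Du x) powr p))"
      using adm(3) unfolding set_integrable_def by (rule integrable_mult_right)
    show "AE x in lebesgue. norm (indicator \<Omega> x *\<^sub>R F (G x) powr p) \<le> norm (b powr p * (indicator \<Omega> x *\<^sub>R norm (Du x) powr p))"
      using DuG
    proof eventually_elim
      case (elim x)
      have "F (G x) powr p \<le> (b * norm (G x)) powr p" using Fp(1,4) p by (intro powr_mono2) auto
      also have "\<dots> = b powr p * norm (G x) powr p" using Fp(5) by (simp add: powr_mult)
      finally show ?case using elim by (auto simp: indicator_def)
    qed
  qed
  define EF where "EF = (LINT x:\<Omega>|lebesgue. F (G x) powr p)"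
  have EF: "(LINT x:\<Omega>|lebesgue. F (Du x) powr p) = EF"
    unfolding EF_def set_lebesgue_integral_def
    by (intro integral_cong_AE FGm G0m Du0m) (use DuG in eventually_elim, auto simp: indicator_def)
  define Y where "Y = (LINT x:frontier \<Omega>|N. \<beta> x * \<bar>g x\<bar> powr p * F (outer_normal \<Omega> x))"
  define D where "D = (LINT x:\<Omega>|lebesgue. \<bar>u x\<bar> powr p)"
  have Dint: "integrable lebesgue (\<lambda>x. indicator \<Omega> x *\<^sub>R \<bar>u x\<bar> powr p)"
    using adm(1) by (simp add: Lp_def set_integrable_def)
  \<comment> \<open>A quotient with denominator 0 would be 0 by convention, and
    \<open>ell * D = EF + Y\<close> could not be recovered from it.\<close>
  have "D \<noteq> 0"
  proof
    assume "D = 0"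
    then have "AE x in lebesgue. indicator \<Omega> x *\<^sub>R \<bar>u x\<bar> powr p = 0"
      unfolding D_def set_lebesgue_integral_def
      by (subst (asm) integral_nonneg_eq_0_iff_AE[OF Dint]) auto
    then have "AE x in lebesgue. x \<in> \<Omega> \<longrightarrow> u x = 0" by eventually_elim (auto simp: indicator_def)
    then show False using adm(7) by contradiction
  qed
  moreover have D0: "D \<ge> 0" unfolding D_def set_lebesgue_integral_def by (intro integral_nonneg_AE AE_I2) auto
  ultimately have D: "D > 0" by simp
  have ray: "ell = (EF + Y) / D"
    using u_min(2) unfolding rayleigh_def EF Hn1 N_def[symmetric] Y_def[symmetric] D_def[symmetric] ell_def by simp
  have EF0: "EF \<ge> 0" unfolding EF_def set_lebesgue_integral_def by (intro integral_nonneg_AE AE_I2) auto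
  have Ynn: "indicator (frontier \<Omega>) x *\<^sub>R (\<beta> x * \<bar>g x\<bar> powr p * F (outer_normal \<Omega> x)) \<ge> 0" for x
    using \<beta>(2) Fp(1) by (auto simp: indicator_def)
  have Y0: "Y \<ge> 0" unfolding Y_def set_lebesgue_integral_def by (intro integral_nonneg_AE AE_I2 Ynn)
  have ell0: "ell \<ge> 0" unfolding ray using EF0 Y0 D by simp
  have ellD: "ell * D = EF + Y" unfolding ray using D by simp

  have \<phi>q: "integrable lebesgue (\<lambda>x. indicator \<Omega> x *\<^sub>R (\<phi> x powr q))"
  proof -
    have "integrable lebesgue (\<lambda>x. indicator \<Omega> x *\<^sub>R (\<bar>\<phi> x\<bar> powr q))"
      using \<phi>(1) by (simp add: Lp_def set_integrable_def q_def)
    also have "(\<lambda>x. indicator \<Omega> x *\<^sub>R (\<bar>\<phi> x\<bar> powr q)) = (\<lambda>x. indicator \<Omega> x *\<^sub>R (\<phi> x powr q))"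
      using \<phi>(2) by (auto simp: indicator_def)
    finally show ?thesis .
  qed
  define P where "P = (LINT x:\<Omega>|lebesgue. \<phi> x powr q * u x powr p)"
  have u_le: "u x \<le> 1" "0 < u x" if "x \<in> \<Omega>" for x using u_sup(1) u_pos that by auto
  note gap = young_energy_gap[OF F p u_le(2,1) intF \<phi>(1) \<phi>(2)[rule_format] \<phi>(3), folded q_def, folded EF_def P_def]

  have lin: "(LINT x|lebesgue. k * f x + l * f' x) = k * integral\<^sup>L lebesgue f + l * integral\<^sup>L lebesgue f'"
    if "integrable lebesgue f" "integrable lebesgue f'" for f f' :: "'a \<Rightarrow> real" and k l
    using that by simp
  \<comment> \<open>The inequality is rearranged so that nothing is subtracted: \<open>E1\<close>
    collects the eigenvalue and \<open>\<phi>\<close> volume terms, to be compared with the boundary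
    term \<open>E2\<close> plus the surface term. All are nonnegative and can live in
    \<open>ennreal\<close>.\<close>
  define f1 where "f1 = (\<lambda>x. ennreal (indicator \<Omega> x *\<^sub>R (ell + (p - 1) * \<phi> x powr q)))"
  define E1 where "E1 t = (\<integral>\<^sup>+x. f1 x * indicator {x. t < u0 x} x \<partial>lebesgue)" for t
  have Omfin: "emeasure lebesgue \<Omega> < \<infinity>" using emeasure_bounded_finite[OF \<Omega>(2)] by simp
  have indO: "integrable lebesgue (\<lambda>x. indicator \<Omega> x *\<^sub>R ell)"
    using Omfin by (simp add: mult.commute[of _ ell])
  have if1: "integrable lebesgue (\<lambda>x. indicator \<Omega> x *\<^sub>R (ell + (p - 1) * \<phi> x powr q))"
  proof -
    have "integrable lebesgue (\<lambda>x. indicator \<Omega> x *\<^sub>R ell + (p - 1) * (indicator \<Omega> x *\<^sub>R (\<phi> x powr q)))"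
      by (intro Bochner_Integration.integrable_add indO integrable_mult_right \<phi>q)
    also have "(\<lambda>x. indicator \<Omega> x *\<^sub>R ell + (p - 1) * (indicator \<Omega> x *\<^sub>R (\<phi> x powr q))) = (\<lambda>x. indicator \<Omega> x *\<^sub>R (ell + (p - 1) * \<phi> x powr q))"
      by (auto simp: indicator_def)
    finally show ?thesis .
  qed
  have f1nn: "indicator \<Omega> x *\<^sub>R (ell + (p - 1) * \<phi> x powr q) \<ge> 0" for x using ell0 p by (simp add: indicator_def)
  have f1m: "f1 \<in> borel_measurable lebesgue" unfolding f1_def using if1 by auto
  have f1fin: "(\<integral>\<^sup>+x. f1 x \<partial>lebesgue) \<noteq> \<infinity>"
    unfolding f1_def using nn_integral_eq_integral[OF if1] f1nn by simp
  note lc1 = layer_cake_powr[OF f1m u0m f1fin p, folded E1_def]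
  have X: "(\<integral>\<^sup>+t. layer_weight p t * E1 t \<partial>lborel) = ennreal (ell * D + (p - 1) * P)"
  proof -
    have "(\<integral>\<^sup>+t. layer_weight p t * E1 t \<partial>lborel)
       = (\<integral>\<^sup>+x. ennreal (ell * (indicator \<Omega> x *\<^sub>R \<bar>u x\<bar> powr p) + (p - 1) * (indicator \<Omega> x *\<^sub>R (\<phi> x powr q * u x powr p))) \<partial>lebesgue)"
      unfolding lc1(2)
    proof (intro nn_integral_cong)
      fix x
      show "f1 x * ennreal (min (max (u0 x) 0) 1 powr p) = ennreal (ell * (indicator \<Omega> x *\<^sub>R \<bar>u x\<bar> powr p) + (p - 1) * (indicator \<Omega> x *\<^sub>R (\<phi> x powr q * u x powr p)))"
      proof (cases "x \<in> \<Omega>")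
        case True
        then have "f1 x * ennreal (min (max (u0 x) 0) 1 powr p) = ennreal (ell + (p - 1) * \<phi> x powr q) * ennreal (u x powr p)"
          using u_le[OF True] by (simp add: f1_def u0_def)
        also have "\<dots> = ennreal ((ell + (p - 1) * \<phi> x powr q) * u x powr p)"
          by (rule ennreal_mult'' [symmetric]) simp
        finally show ?thesis using True u_le[OF True] by (simp add: algebra_simps)
      qed (simp add: f1_def)
    qed
    also have "\<dots> = ennreal (LINT x|lebesgue. ell * (indicator \<Omega> x *\<^sub>R \<bar>u x\<bar> powr p) + (p - 1) * (indicator \<Omega> x *\<^sub>R (\<phi> x powr q * u x powr p)))"
      using Dint gap(1)[unfolded set_integrable_def] ell0 p
      by (intro nn_integral_eq_integral Bochner_Integration.integrable_add integrable_mult_right AE_I2) (auto simp: indicator_def)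
    also have "(LINT x|lebesgue. ell * (indicator \<Omega> x *\<^sub>R \<bar>u x\<bar> powr p) + (p - 1) * (indicator \<Omega> x *\<^sub>R (\<phi> x powr q * u x powr p)))
      = ell * D + (p - 1) * P"
      unfolding D_def P_def set_lebesgue_integral_def
      by (rule lin[OF Dint gap(1)[unfolded set_integrable_def]])
    finally show ?thesis .
  qed

  define f2 where "f2 = (\<lambda>x. ennreal (\<sigma> x))"
  define g0 where "g0 = (\<lambda>x. indicator (frontier \<Omega>) x *\<^sub>R g x)"
  define E2 where "E2 t = (\<integral>\<^sup>+x. f2 x * indicator {x. t < g0 x} x \<partial>N)" for t
  have f2m: "f2 \<in> borel_measurable N" unfolding f2_def using \<sigma>int by auto
  have g0m: "g0 \<in> borel_measurable N" unfolding g0_def using adm(5) by (simp add: set_borel_measurable_def)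
  have f2fin: "(\<integral>\<^sup>+x. f2 x \<partial>N) \<noteq> \<infinity>"
    unfolding f2_def using nn_integral_eq_integral[OF \<sigma>int] \<sigma>0 by simp
  note lc2 = layer_cake_powr[OF f2m g0m f2fin p, folded E2_def]
  \<comment> \<open>Only an upper bound: the trace \<open>g\<close> is not known to lie between 0
    and 1, and its clipped value is at most its absolute value.\<close>
  have X2: "(\<integral>\<^sup>+t. layer_weight p t * E2 t \<partial>lborel) \<le> ennreal Y"
  proof -
    have "(\<integral>\<^sup>+t. layer_weight p t * E2 t \<partial>lborel)
       \<le> (\<integral>\<^sup>+x. ennreal (indicator (frontier \<Omega>) x *\<^sub>R (\<beta> x * \<bar>g x\<bar> powr p * F (outer_normal \<Omega> x))) \<partial>N)"
      unfolding lc2(2)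
    proof (intro nn_integral_mono)
      fix x
      show "f2 x * ennreal (min (max (g0 x) 0) 1 powr p) \<le> ennreal (indicator (frontier \<Omega>) x *\<^sub>R (\<beta> x * \<bar>g x\<bar> powr p * F (outer_normal \<Omega> x)))"
      proof (cases "x \<in> frontier \<Omega>")
        case True
        have "min (max (g x) 0) 1 powr p \<le> \<bar>g x\<bar> powr p" using p by (intro powr_mono2) auto
        then have "\<sigma> x * min (max (g x) 0) 1 powr p \<le> \<sigma> x * \<bar>g x\<bar> powr p" using \<sigma>0 by (intro mult_left_mono)
        then show ?thesis using True by (simp add: f2_def g0_def ennreal_mult'' [symmetric] \<sigma>_def mult_ac ennreal_leI)
      qed (simp add: f2_def \<sigma>_def)
    qed
    also have "\<dots> = ennreal Y"
      unfolding Y_def set_lebesgue_integral_def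
      using adm(6)[unfolded set_integrable_def] Ynn by (intro nn_integral_eq_integral) auto
    finally show ?thesis .
  qed

  \<comment> \<open>On the level \<open>t\<close> the factor \<open>p * u x powr (p - 1)\<close> is
    the layer weight itself, so the weight sits inside the surface integrand. In the coarea
    inequality, \<open>norm (G x)\<close> then cancels the normalization of the gradient by
    homogeneity of \<open>F\<close>.\<close>
  define r where "r = (\<lambda>x. indicator \<Omega> x *\<^sub>R (p * u x powr (p - 1) * \<phi> x * F ((1 / norm (G x)) *\<^sub>R G x)))"
  have rm: "r \<in> borel_measurable lebesgue"
  proof -
    have n: "(\<lambda>x. (1 / norm (indicator \<Omega> x *\<^sub>R G x)) *\<^sub>R (indicator \<Omega> x *\<^sub>R G x)) \<in> borel_measurable lebesgue"
      by (rule measurable_compose[OF G0m]) measurable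
    have "(\<lambda>x. p * (u0 x) powr (p - 1) * (indicator \<Omega> x *\<^sub>R \<phi> x) * F ((1 / norm (indicator \<Omega> x *\<^sub>R G x)) *\<^sub>R (indicator \<Omega> x *\<^sub>R G x))) \<in> borel_measurable lebesgue"
      using u0m \<phi>0m measurable_compose[OF n Fp(6)]
      by (intro borel_measurable_times powr_real_measurable borel_measurable_const)
    also have "(\<lambda>x. p * (u0 x) powr (p - 1) * (indicator \<Omega> x *\<^sub>R \<phi> x) * F ((1 / norm (indicator \<Omega> x *\<^sub>R G x)) *\<^sub>R (indicator \<Omega> x *\<^sub>R G x))) = r"
      by (auto simp: r_def u0_def indicator_def)
    finally show ?thesis .
  qed
  obtain c where c: "c \<in> borel_measurable lborel"
      "\<And>t. (\<integral>\<^sup>+x. ennreal (r x) * indicator {x \<in> regular. u x = t} x \<partial>N) \<le> c t"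
      "(\<integral>\<^sup>+t. c t \<partial>lborel) \<le> (\<integral>\<^sup>+x. ennreal (r x * (norm (G x) * indicator regular x)) \<partial>lebesgue)"
    using coarea_inequality_lebesgue[OF dim setsH emH rm] unfolding upper_integral_le_def N_def by blast
  have cK: "(\<integral>\<^sup>+t. c t \<partial>lborel) < ennreal (EF + (p - 1) * P)"
  proof -
    note c(3)
    also have "(\<integral>\<^sup>+x. ennreal (r x * (norm (G x) * indicator regular x)) \<partial>lebesgue)
      \<le> (\<integral>\<^sup>+x. ennreal (indicator \<Omega> x * (p * F (G x) * (u x powr (p - 1) * \<phi> x))) \<partial>lebesgue)"
    proof (intro nn_integral_mono ennreal_leI)
      fix x
      have "F ((1 / norm (G x)) *\<^sub>R G x) * norm (G x) = F (G x)" if "x \<in> regular"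
        using that by (simp add: Fp(2) regular_def)
      then have "x \<in> regular \<Longrightarrow> r x * norm (G x) = indicator \<Omega> x * (p * F (G x) * (u x powr (p - 1) * \<phi> x))"
        by (simp add: r_def mult_ac)
      moreover have "indicator \<Omega> x * (p * F (G x) * (u x powr (p - 1) * \<phi> x)) \<ge> 0"
        using p Fp(1)[of "G x"] \<phi>(2) by (auto simp: indicator_def)
      ultimately show "r x * (norm (G x) * indicator regular x) \<le> indicator \<Omega> x * (p * F (G x) * (u x powr (p - 1) * \<phi> x))"
        by (auto simp: indicator_def)
    qed
    also note gap(2)
    finally show ?thesis .
  qed

  \<comment> \<open>Defined through the majorant \<open>c\<close>, which already contains the
    weight, instead of the surface integral; this makes \<open>T\<close> a Borel set.\<close>
  define T where "T = {t \<in> {0<..<1}. layer_weight p t * E2 t + c t < layer_weight p t * E1 t}"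
  have [measurable]: "E1 \<in> borel_measurable borel" "E2 \<in> borel_measurable borel" "c \<in> borel_measurable borel"
    using lc1(1) lc2(1) c(1) by auto
  have Tm: "T \<in> sets borel" unfolding T_def by measurable
  have Tpos: "emeasure lborel T > 0"
  proof (rule ccontr)
    assume "\<not> ?thesis"
    then have "T \<in> null_sets lborel" using Tm by auto
    then have "AE t in lborel. t \<notin> T" by (rule AE_not_in)
    \<comment> \<open>Levels outside the unit interval have weight 0, so there the inequality is
      trivial.\<close>
    then have "AE t in lborel. layer_weight p t * E1 t \<le> layer_weight p t * E2 t + c t"
      by eventually_elim (auto simp: T_def layer_weight_def indicator_def not_less)
    then have "ennreal (ell * D + (p - 1) * P) \<le> (\<integral>\<^sup>+t. layer_weight p t * E2 t + c t \<partial>lborel)"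
      unfolding X[symmetric] by (rule nn_integral_mono_AE)
    also have "\<dots> = (\<integral>\<^sup>+t. layer_weight p t * E2 t \<partial>lborel) + (\<integral>\<^sup>+t. c t \<partial>lborel)"
      by (rule nn_integral_add) auto
    also have "\<dots> \<le> ennreal Y + (\<integral>\<^sup>+t. c t \<partial>lborel)" using X2 by (rule add_right_mono)
    also have "\<dots> < ennreal Y + ennreal (EF + (p - 1) * P)" using cK by (simp add: ennreal_add_left_cancel_less)
    also have "\<dots> = ennreal (ell * D + (p - 1) * P)"
    proof -
      have "P \<ge> 0" unfolding P_def set_lebesgue_integral_def by (intro integral_nonneg_AE AE_I2) auto
      then have "(p - 1) * P \<ge> 0" using p by simp
      then have "ennreal Y + ennreal (EF + (p - 1) * P) = ennreal (Y + (EF + (p - 1) * P))"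
        using Y0 EF0 by (intro ennreal_plus [symmetric]) auto
      also have "Y + (EF + (p - 1) * P) = ell * D + (p - 1) * P" unfolding ellD by simp
      finally show ?thesis .
    qed
    finally show False by simp
  qed

  have "level_functional p F \<beta> \<Omega> u g \<phi> t < ell" if tT: "t \<in> T" for t
  proof -
    have t: "0 < t" "t < 1" "layer_weight p t * E2 t + c t < layer_weight p t * E1 t" using tT by (auto simp: T_def)
    define h where "h = p * t powr (p - 1)"
    have h: "h > 0" using p t by (simp add: h_def)
    have lw: "layer_weight p t = ennreal h" using t by (simp add: layer_weight_def h_def)
    define U where "U = {x \<in> \<Omega>. u x > t}"
    define S where "S = {x \<in> \<Omega>. u x = t}"
    define \<Gamma> where "\<Gamma> = {x \<in> frontier \<Omega>. g x > t}"
    have Uopen: "open U"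
    proof -
      have "U = \<Omega> \<inter> u -` {t<..}" by (auto simp: U_def)
      then show ?thesis using continuous_open_preimage[OF continuous \<Omega>(1), of "{t<..}"] by simp
    qed
    \<comment> \<open>The supremum 1 exceeds \<open>t\<close>, so the open set \<open>U\<close> is
      nonempty and has positive volume, by which the functional divides.\<close>
    have "\<Omega> \<noteq> {}" using adm(7) by auto
    moreover have "bdd_above (u ` \<Omega>)" using u_le by (intro bdd_aboveI2[of _ _ 1]) auto
    ultimately obtain x0 where "x0 \<in> U"
      using t(2) u_sup(2) less_cSUP_iff[of \<Omega> u t] by (auto simp: U_def)
    then have Une: "U \<noteq> {}" by auto
    have Ufin: "emeasure lebesgue U < \<infinity>"
    proof -
      have "bounded U" using \<Omega>(2) by (rule bounded_subset) (auto simp: U_def)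
      from emeasure_bounded_finite[OF this] show ?thesis using Uopen by simp
    qed
    define m where "m = measure lebesgue U"
    have m: "m > 0"
    proof -
      have "\<not> negligible U" using Uopen Une open_not_negligible by blast
      then have "m \<noteq> 0" unfolding m_def using Ufin Uopen
        by (auto simp: negligible_iff_measure fmeasurable_def)
      then show ?thesis by (simp add: m_def less_le)
    qed
    define \<Psi> where "\<Psi> = (LINT x:U|lebesgue. \<phi> x powr q)"
    define C where "C = (LINT x:S|N. \<phi> x * F ((1 / norm (grad u x)) *\<^sub>R grad u x))"
    define B where "B = (LINT x:\<Gamma>|N. \<beta> x * F (outer_normal \<Omega> x))"
    have lf: "level_functional p F \<beta> \<Omega> u g \<phi> t = (1 / m) * (- (p - 1) * \<Psi> + C + B)"
      unfolding level_functional_def Let_def Hn1 N_def[symmetric] U_def[symmetric] S_def[symmetric] \<Gamma>_def[symmetric]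
        m_def \<Psi>_def C_def B_def q_def by simp
    have E1t: "E1 t = ennreal (ell * m + (p - 1) * \<Psi>)"
    proof -
      have iU: "integrable lebesgue (\<lambda>x. indicator U x *\<^sub>R \<phi> x powr q)"
        using set_integrable_subset[of lebesgue \<Omega> "\<lambda>x. \<phi> x powr q" U] \<phi>q Uopen by (auto simp: set_integrable_def U_def)
      have iU0: "integrable lebesgue (indicat_real U)"
        using Ufin Uopen by (intro integrable_real_indicator) auto
      have i1: "integrable lebesgue (\<lambda>x. ell * indicator U x)"
        using iU0 by (rule integrable_mult_right)
      have "E1 t = (\<integral>\<^sup>+x. ennreal (ell * indicator U x + (p - 1) * (indicator U x *\<^sub>R \<phi> x powr q)) \<partial>lebesgue)"
        unfolding E1_def by (intro nn_integral_cong) (use t in \<open>auto simp: f1_def u0_def U_def indicator_def\<close>)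
      also have "\<dots> = ennreal (LINT x|lebesgue. ell * indicator U x + (p - 1) * (indicator U x *\<^sub>R \<phi> x powr q))"
        using ell0 p iU i1
        by (intro nn_integral_eq_integral Bochner_Integration.integrable_add integrable_mult_right AE_I2) (auto simp: indicator_def)
      also have "(LINT x|lebesgue. ell * indicator U x + (p - 1) * (indicator U x *\<^sub>R \<phi> x powr q)) = ell * m + (p - 1) * \<Psi>"
        using lin[OF iU0 iU, of ell "p - 1"] Uopen by (simp add: m_def \<Psi>_def set_lebesgue_integral_def)
      finally show ?thesis .
    qed
    \<comment> \<open>If the integrand is not integrable on \<open>S\<close>, then \<open>C = 0\<close>, so an upper bound never needs integrability;
      at critical points the integrand vanishes because \<open>F 0 = 0\<close>.\<close>
    have hC: "ennreal (h * C) \<le> c t"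
    proof -
      have nn: "h * (indicator S x *\<^sub>R (\<phi> x * F ((1 / norm (grad u x)) *\<^sub>R grad u x))) \<ge> 0" for x
        using h \<phi>(2) Fp(1) by (auto simp: S_def indicator_def)
      have "h * C = (LINT x|N. h * (indicator S x *\<^sub>R (\<phi> x * F ((1 / norm (grad u x)) *\<^sub>R grad u x))))"
        unfolding C_def set_lebesgue_integral_def by simp
      also have "ennreal \<dots> \<le> (\<integral>\<^sup>+x. ennreal (h * (indicator S x *\<^sub>R (\<phi> x * F ((1 / norm (grad u x)) *\<^sub>R grad u x)))) \<partial>N)"
        by (rule ennreal_integral_le_nn_integral) (rule nn)
      also have "\<dots> \<le> (\<integral>\<^sup>+x. ennreal (r x) * indicator {x \<in> regular. u x = t} x \<partial>N)"
      proof (intro nn_integral_mono)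
        fix x
        show "ennreal (h * (indicator S x *\<^sub>R (\<phi> x * F ((1 / norm (grad u x)) *\<^sub>R grad u x)))) \<le> ennreal (r x) * indicator {x \<in> regular. u x = t} x"
        proof (cases "x \<in> S")
          case True
          then have x: "x \<in> \<Omega>" "u x = t" by (auto simp: S_def)
          show ?thesis
          proof (cases "G x = 0")
            case True then show ?thesis using x by (simp add: grad_eq Fp(3))
          next
            case False
            then show ?thesis using x True by (simp add: regular_def r_def h_def grad_eq mult.assoc)
          qed
        qed simp
      qed
      also note c(2)
      finally show ?thesis .
    qed
    have BE: "ennreal B \<le> E2 t"
    proof -
      have "ennreal B \<le> (\<integral>\<^sup>+x. ennreal (indicator \<Gamma> x *\<^sub>R (\<beta> x * F (outer_normal \<Omega> x))) \<partial>N)"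
        unfolding B_def set_lebesgue_integral_def
        by (rule ennreal_integral_le_nn_integral) (use \<beta>(2) Fp(1) in \<open>auto simp: \<Gamma>_def indicator_def\<close>)
      also have "\<dots> = E2 t"
        unfolding E2_def by (intro nn_integral_cong) (use t in \<open>auto simp: f2_def g0_def \<Gamma>_def \<sigma>_def indicator_def\<close>)
      finally show ?thesis .
    qed
    have B0: "B \<ge> 0" "C \<ge> 0"
      unfolding B_def C_def set_lebesgue_integral_def
      by (intro integral_nonneg_AE AE_I2; use \<beta>(2) \<phi>(2) Fp(1) in \<open>auto simp: \<Gamma>_def S_def indicator_def\<close>)+
    have "ennreal (h * (B + C)) = ennreal h * ennreal B + ennreal (h * C)"
      using h B0 by (simp add: ennreal_mult [symmetric] ennreal_plus [symmetric] distrib_left del: ennreal_plus)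
    also have "\<dots> \<le> layer_weight p t * E2 t + c t"
      unfolding lw using BE hC by (intro add_mono mult_left_mono) auto
    also note t(3)
    also have "layer_weight p t * E1 t = ennreal (h * (ell * m + (p - 1) * \<Psi>))"
      unfolding lw E1t using h by (simp add: ennreal_mult')
    \<comment> \<open>\<open>ennreal\<close> is monotone on all reals, so a strict inequality
      between images gives one between the reals by contraposition, with no sign conditions.\<close>
    finally have "h * (B + C) < h * (ell * m + (p - 1) * \<Psi>)"
      by (rule contrapos_pp) (simp add: not_less ennreal_leI)
    then have "B + C < ell * m + (p - 1) * \<Psi>" using h by simp
    then have "- (p - 1) * \<Psi> + C + B < ell * m" by (simp add: algebra_simps)
    then show ?thesis unfolding lf using m by (simp add: field_simps)
  qed
  moreover have "T \<subseteq> {0<..<1}" by (auto simp: T_def)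
  moreover have "T \<in> sets lebesgue" using Tm by simp
  moreover have "emeasure lebesgue T > 0" using Tpos Tm by simp
  ultimately show ?thesis unfolding ell_def by blast
qed

end
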